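(* Let $\mathcal F$ be a $(G,h)$-constellation on $X$. Then $\mathcal F$ has a unique filtration $$0=\mathcal F_0\subsetneq\mathcal F_1\subsetneq\mathcal F_2\subsetneq\cdots\subsetneq\mathcal F_t\subsetneq\mathcal F_{t+1}=\mathcal F$$ such that (i) each $\mathcal F_i$ is an $(\mathcal O_X,G)$-submodule generated in $D_-$; (ii) each quotient $\mathcal F^i:=\mathcal F_i/\mathcal F_{i-1}$ is $\mu_\theta$-semistable; and (iii) the slopes of the quotients are strictly decreasing: $\mu_\theta(\mathcal F^1)>\mu_\theta(\mathcal F^2)>\cdots>\mu_\theta(\mathcal F^t)>\mu_\theta(\mathcal F^{t+1})$.
   Context: We work over $\mathbb C$. $G$ is an infinite reductive algebraic group (possibly non-connected), $\operatorname{Irr}G$ is the set of isomorphism classes of irreducible $G$-modules $\rho:G\to \mathrm{GL}(V_\rho)$, and $X$ is an affine $G$-scheme of finite type. An $(\mathcal O_X,G)$-module is a $G$-equivariant coherent $\mathcal O_X$-module $\mathcal F$ whose $G$-module of global sections has finite multiplicities; write $H^0(\mathcal F)=\bigoplus_{\rho}\mathcal F_\rho\otimes V_\rho$ with $\mathcal F_\rho=\operatorname{Hom}_G(V_\rho,H^0(\mathcal F))$. The Hilbert function of $\mathcal F$ is $\rho\mapsto\dim\mathcal F_\rho$. Fix a non-zero Hilbert function $h:\operatorname{Irr}G\to\mathbb Z_{\ge0}$. Stability function: a fixed sequence of rationals $\theta=(\theta_\rho)_{\rho\in\operatorname{Irr}G}$ with $\theta_\rho<0$ for only finitely many $\rho$;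 $\theta_\rho>0$ for infinitely many $\rho$; $\theta_\rho=0$ if $h(\rho)=0$; and $\sum_\rho\theta_\rho h(\rho)=0$. Put $\theta(\mathcal F)=\sum_\rho\theta_\rho\dim\mathcal F_\rho$ and $D_-=\{\rho:\theta_\rho<0\}$. $\mathcal F$ is generated in $D_-$ if it is generated as an $\mathcal O_X$-module by its negative part $\bigoplus_{\rho\in D_-}\mathcal F_\rho\otimes V_\rho$. A $(G,h)$-constellation on $X$ is an $(\mathcal O_X,G)$-module generated in $D_-$ with Hilbert function $h$. For an $(\mathcal O_X,G)$-module $\mathcal F$ with non-zero negative part, $r(\mathcal F)=\sum_{\rho\in D_-}\dim\mathcal F_\rho$ and $\mu_\theta(\mathcal F)=-\theta(\mathcal F)/r(\mathcal F)$. An $(\mathcal O_X,G)$-module $\mathcal F$ generated in $D_-$ is $\mu_\theta$-semistable if $\mu_\theta(\mathcal F')\le\mu_\theta(\mathcal F)$ for every $(\mathcal O_X,G)$-submodule $0\ne\mathcal F'\subsetneq\mathcal F$ generated in $D_-$. *)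

theory Defs
  imports
    "Jordan_Normal_Form.Missing_VectorSpace"
    "HOL-Algebra.Generated_Rings"
    "HOL-Analysis.Analysis"
begin

text \<open>
  Conventions. Linear algebraic groups are Zariski closed subgroups of \<open>GL_n(\<complex>)\<close>. An affine
  \<open>G\<close>-scheme \<open>X\<close> of finite type is given by its coordinate ring with the induced rational
  \<open>G\<close>-action, and an equivariant coherent sheaf on it by its finitely generated module of
  global sections. Modules are records in the style of HOL-Algebra, so that submodules and
  quotients are again objects of the same kind; the record fields \<open>mult\<close> and \<open>one\<close>, inherited
  from rings, play no role for modules.
\<close>

section \<open>Reductive groups\<close>

text \<open>The coordinate ring of \<open>GL_n\<close>: polynomials in the matrix entries and \<open>1/det\<close>.\<close>

inductive_set regular_functions :: "(complex^'n^'n \<Rightarrow> complex) set" where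
  const: "(\<lambda>g. c) \<in> regular_functions"
| entry: "(\<lambda>g. g $ i $ j) \<in> regular_functions"
| inverse_det: "(\<lambda>g. inverse (det g)) \<in> regular_functions"
| add: "f \<in> regular_functions \<Longrightarrow> f' \<in> regular_functions \<Longrightarrow> (\<lambda>g. f g + f' g) \<in> regular_functions"
| mult: "f \<in> regular_functions \<Longrightarrow> f' \<in> regular_functions \<Longrightarrow> (\<lambda>g. f g * f' g) \<in> regular_functions"

definition zariski_closed :: "(complex^'n^'n) set \<Rightarrow> bool" where
  "zariski_closed Z \<longleftrightarrow>
     (\<exists>P \<subseteq> regular_functions. Z = {g. invertible g \<and> (\<forall>f\<in>P. f g = 0)})"

definition zariski_connected :: "(complex^'n^'n) set \<Rightarrow> bool" where
  "zariski_connected U \<longleftrightarrow>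
     \<not> (\<exists>A B. zariski_closed A \<and> zariski_closed B \<and> U \<subseteq> A \<union> B \<and> U \<inter> A \<inter> B = {} \<and>
              U \<inter> A \<noteq> {} \<and> U \<inter> B \<noteq> {})"

definition linear_algebraic_group :: "(complex^'n^'n) set \<Rightarrow> bool" where
  "linear_algebraic_group G \<longleftrightarrow>
     zariski_closed G \<and> mat 1 \<in> G \<and> (\<forall>g\<in>G. \<forall>h\<in>G. g ** h \<in> G) \<and> (\<forall>g\<in>G. matrix_inv g \<in> G)"

text \<open>The iterate is the matrix power \<open>(g - 1)^k\<close>; the operator \<open>^\<close> on this type would be
  the entrywise power.\<close>

definition unipotent :: "complex^'n^'n \<Rightarrow> bool" where
  "unipotent g \<longleftrightarrow> (\<exists>k. ((\<lambda>A. (g - mat 1) ** A) ^^ k) (mat 1) = 0)"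

text \<open>Reductive means trivial unipotent radical; \<open>G\<close> itself need not be connected.\<close>

definition reductive_group :: "(complex^'n^'n) set \<Rightarrow> bool" where
  "reductive_group G \<longleftrightarrow>
     linear_algebraic_group G \<and>
     (\<forall>U. U \<subseteq> G \<and> linear_algebraic_group U \<and> zariski_connected U \<and>
          (\<forall>g\<in>G. \<forall>u\<in>U. g ** u ** matrix_inv g \<in> U) \<and> (\<forall>u\<in>U. unipotent u)
        \<longrightarrow> U = {mat 1})"

section \<open>G-modules\<close>

definition complex_field :: "complex ring" where
  "complex_field = \<lparr>carrier = UNIV, monoid.mult = (*), one = 1, zero = 0, add = (+)\<rparr>"

record ('a, 'b, 'n) gmodule = "('a, 'b) module" +
  gact :: "complex^'n^'n \<Rightarrow> 'b \<Rightarrow> 'b"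

text \<open>Rationality is the last clause: \<open>\<Sum>\<^sub>i w\<^sub>i \<otimes> f\<^sub>i\<close> is the value at \<open>v\<close> of the
  coaction \<open>V \<rightarrow> V \<otimes> \<O>(G)\<close>. Regular functions on the closed subgroup \<open>G\<close> are the
  restrictions of those on \<open>GL_n\<close>.\<close>

definition rational_gmodule ::
    "(complex^'n^'n) set \<Rightarrow> (complex, 'b, 'n) gmodule \<Rightarrow> bool" where
  "rational_gmodule G V \<longleftrightarrow>
     Module.module complex_field V \<and>
     (\<forall>g\<in>G. gact V g \<in> LinearCombinations.module_hom complex_field V V) \<and>
     (\<forall>v\<in>carrier V. gact V (mat 1) v = v) \<and>
     (\<forall>g\<in>G. \<forall>h\<in>G. \<forall>v\<in>carrier V. gact V (g ** h) v = gact V g (gact V h v)) \<and>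
     (\<forall>v\<in>carrier V. \<exists>(k::nat) f w.
        (\<forall>i<k. f i \<in> regular_functions \<and> w i \<in> carrier V) \<and>
        (\<forall>g\<in>G. gact V g v = (\<Oplus>\<^bsub>V\<^esub>i\<in>{..<k}. f i g \<odot>\<^bsub>V\<^esub> w i)))"

definition irreducible_gmodule ::
    "(complex^'n^'n) set \<Rightarrow> (complex, 'b, 'n) gmodule \<Rightarrow> bool" where
  "irreducible_gmodule G V \<longleftrightarrow>
     rational_gmodule G V \<and> carrier V \<noteq> {\<zero>\<^bsub>V\<^esub>} \<and>
     (\<forall>N. LinearCombinations.submodule complex_field N V \<and> (\<forall>g\<in>G. \<forall>v\<in>N. gact V g v \<in> N)
        \<longrightarrow> N = {\<zero>\<^bsub>V\<^esub>} \<or> N = carrier V)"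

text \<open>\<open>Hom_G(V, W)\<close>, as a set of maps that are \<open>undefined\<close> outside the carrier of \<open>V\<close>, and
  as a complex vector space under the pointwise operations.\<close>

definition gHom ::
    "(complex^'n^'n) set \<Rightarrow> (complex, 'b, 'n) gmodule \<Rightarrow> (complex, 'c, 'n) gmodule \<Rightarrow>
     ('b \<Rightarrow> 'c) set" where
  "gHom G V W =
     {f \<in> LinearCombinations.module_hom complex_field V W. f \<in> extensional (carrier V) \<and>
        (\<forall>g\<in>G. \<forall>v\<in>carrier V. f (gact V g v) = gact W g (f v))}"

definition gHom_space ::
    "(complex^'n^'n) set \<Rightarrow> (complex, 'b, 'n) gmodule \<Rightarrow> (complex, 'c, 'n) gmodule \<Rightarrow>
     (complex, 'b \<Rightarrow> 'c) module" where
  "gHom_space G V W =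
     \<lparr>carrier = gHom G V W, monoid.mult = undefined, one = undefined,
      zero = (\<lambda>v\<in>carrier V. \<zero>\<^bsub>W\<^esub>),
      add = (\<lambda>f f'. \<lambda>v\<in>carrier V. f v \<oplus>\<^bsub>W\<^esub> f' v),
      module.smult = (\<lambda>c f. \<lambda>v\<in>carrier V. c \<odot>\<^bsub>W\<^esub> f v)\<rparr>"

definition gmodule_iso ::
    "(complex^'n^'n) set \<Rightarrow> (complex, 'b, 'n) gmodule \<Rightarrow> (complex, 'c, 'n) gmodule \<Rightarrow> bool" where
  "gmodule_iso G V W \<longleftrightarrow> (\<exists>f\<in>gHom G V W. bij_betw f (carrier V) (carrier W))"

text \<open>Irreducible rational modules are finite-dimensional, and every \<open>\<complex>^d\<close> embeds in
  \<open>nat \<Rightarrow> complex\<close>, so modules carried by subsets of that type (with arbitrary module structure)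
  represent all isomorphism classes.\<close>

type_synonym 'n irrep = "(complex, nat \<Rightarrow> complex, 'n) gmodule"

definition Irr :: "(complex^'n^'n) set \<Rightarrow> 'n irrep set set" where
  "Irr G = {V. irreducible_gmodule G V} //
     {(V, W). irreducible_gmodule G V \<and> irreducible_gmodule G W \<and> gmodule_iso G V W}"

definition irrep_of :: "'n::finite irrep set \<Rightarrow> 'n irrep" where
  "irrep_of \<rho> = (SOME V. V \<in> \<rho>)"

abbreviation mult_space ::
    "(complex^'n^'n) set \<Rightarrow> (complex, 'b, 'n) gmodule \<Rightarrow> 'n irrep set \<Rightarrow>
     (complex, (nat \<Rightarrow> complex) \<Rightarrow> 'b) module" where
  "mult_space G V \<rho> \<equiv> gHom_space G (irrep_of \<rho>) V"

definition mult_dim ::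
    "(complex^'n^'n) set \<Rightarrow> (complex, 'b, 'n) gmodule \<Rightarrow> 'n irrep set \<Rightarrow> nat" where
  "mult_dim G V \<rho> = vectorspace.dim complex_field (mult_space G V \<rho>)"

text \<open>The image of the evaluation map \<open>Hom_G(V\<^sub>\<rho>, V) \<otimes> V\<^sub>\<rho> \<rightarrow> V\<close>, which is injective
  by Schur's lemma. The sum of these images over different \<open>\<rho>\<close> is always direct.\<close>

definition isotypic ::
    "(complex^'n^'n) set \<Rightarrow> (complex, 'b, 'n) gmodule \<Rightarrow> 'n irrep set \<Rightarrow> 'b set" where
  "isotypic G V \<rho> =
     LinearCombinations.module.span complex_field V
       (\<Union>f\<in>gHom G (irrep_of \<rho>) V. f ` carrier (irrep_of \<rho>))"

text \<open>\<open>V = \<Oplus>\<^sub>\<rho> Hom_G(V\<^sub>\<rho>, V) \<otimes> V\<^sub>\<rho>\<close> with all multiplicity spaces finite-dimensional.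
  For reductive \<open>G\<close> the decomposition itself holds for every rational module.\<close>

definition finite_multiplicities ::
    "(complex^'n^'n) set \<Rightarrow> (complex, 'b, 'n) gmodule \<Rightarrow> bool" where
  "finite_multiplicities G V \<longleftrightarrow>
     LinearCombinations.module.span complex_field V (\<Union>\<rho>\<in>Irr G. isotypic G V \<rho>) = carrier V \<and>
     (\<forall>\<rho>\<in>Irr G. vectorspace.fin_dim complex_field (mult_space G V \<rho>))"

section \<open>Affine G-schemes and equivariant coherent modules\<close>

text \<open>The coordinate ring of \<open>X\<close>, its structure map from \<open>\<complex>\<close>, and the \<open>G\<close>-action
  \<open>(g \<cdot> a)(x) = a(g\<inverse> x)\<close>.\<close>

record ('a, 'n) gscheme = "'a ring" +
  scal :: "complex \<Rightarrow> 'a"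
  ract :: "complex^'n^'n \<Rightarrow> 'a \<Rightarrow> 'a"

definition coordinate_gmodule :: "('a, 'n::finite) gscheme \<Rightarrow> (complex, 'a, 'n) gmodule" where
  "coordinate_gmodule X =
     \<lparr>carrier = carrier X, monoid.mult = undefined, one = undefined, zero = \<zero>\<^bsub>X\<^esub>,
      add = (\<oplus>\<^bsub>X\<^esub>), module.smult = (\<lambda>c a. scal X c \<otimes>\<^bsub>X\<^esub> a), gact = ract X\<rparr>"

definition affine_gscheme :: "(complex^'n^'n) set \<Rightarrow> ('a, 'n) gscheme \<Rightarrow> bool" where
  "affine_gscheme G X \<longleftrightarrow>
     cring X \<and> scal X \<in> ring_hom complex_field X \<and>
     (\<exists>S \<subseteq> carrier X. finite S \<and> generate_ring X (range (scal X) \<union> S) = carrier X) \<and>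
     (\<forall>g\<in>G. ract X g \<in> ring_hom X X) \<and>
     rational_gmodule G (coordinate_gmodule X)"

text \<open>\<open>H\<^sup>0\<close> as a \<open>G\<close>-module: restriction of scalars to \<open>\<complex>\<close>.\<close>

definition global_sections ::
    "('a, 'n::finite) gscheme \<Rightarrow> ('a, 'b, 'n) gmodule \<Rightarrow> (complex, 'b, 'n) gmodule" where
  "global_sections X M =
     \<lparr>carrier = carrier M, monoid.mult = undefined, one = undefined, zero = \<zero>\<^bsub>M\<^esub>,
      add = (\<oplus>\<^bsub>M\<^esub>), module.smult = (\<lambda>c m. scal X c \<odot>\<^bsub>M\<^esub> m), gact = gact M\<rparr>"

definition OXG_module ::
    "(complex^'n^'n) set \<Rightarrow> ('a, 'n) gscheme \<Rightarrow> ('a, 'b, 'n) gmodule \<Rightarrow> bool" where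
  "OXG_module G X M \<longleftrightarrow>
     Module.module X M \<and>
     (\<exists>S \<subseteq> carrier M. finite S \<and> LinearCombinations.module.span X M S = carrier M) \<and>
     rational_gmodule G (global_sections X M) \<and>
     (\<forall>g\<in>G. \<forall>a\<in>carrier X. \<forall>m\<in>carrier M.
        gact M g (a \<odot>\<^bsub>M\<^esub> m) = ract X g a \<odot>\<^bsub>M\<^esub> gact M g m) \<and>
     finite_multiplicities G (global_sections X M)"

definition OXG_submodule ::
    "(complex^'n^'n) set \<Rightarrow> ('a, 'n) gscheme \<Rightarrow> 'b set \<Rightarrow> ('a, 'b, 'n) gmodule \<Rightarrow> bool" where
  "OXG_submodule G X N M \<longleftrightarrow> N \<subseteq> carrier M \<and> OXG_module G X (M\<lparr>carrier := N\<rparr>)"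

text \<open>The quotient by a submodule \<open>N\<close> consists of the cosets of \<open>N\<close>, as for quotient rings in
  HOL-Algebra.\<close>

definition quotient_gmodule :: "('a, 'b, 'n::finite) gmodule \<Rightarrow> 'b set \<Rightarrow> ('a, 'b set, 'n) gmodule" where
  "quotient_gmodule M N =
     \<lparr>carrier = a_rcosets\<^bsub>M\<^esub> N, monoid.mult = undefined, one = undefined, zero = N,
      add = set_add M,
      module.smult = (\<lambda>a C. \<Union>m\<in>C. N +>\<^bsub>M\<^esub> (a \<odot>\<^bsub>M\<^esub> m)),
      gact = (\<lambda>g C. \<Union>m\<in>C. N +>\<^bsub>M\<^esub> gact M g m)\<rparr>"

section \<open>Constellations and slope stability\<close>

type_synonym 'n stability = "'n irrep set \<Rightarrow> rat"

definition D_minus :: "(complex^'n^'n) set \<Rightarrow> 'n stability \<Rightarrow> 'n irrep set set" where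
  "D_minus G \<theta> = {\<rho> \<in> Irr G. \<theta> \<rho> < 0}"

definition stability_function ::
    "(complex^'n^'n) set \<Rightarrow> ('n irrep set \<Rightarrow> nat) \<Rightarrow> 'n stability \<Rightarrow> bool" where
  "stability_function G h \<theta> \<longleftrightarrow>
     finite (D_minus G \<theta>) \<and>
     infinite {\<rho> \<in> Irr G. \<theta> \<rho> > 0} \<and>
     (\<forall>\<rho>\<in>Irr G. h \<rho> = 0 \<longrightarrow> \<theta> \<rho> = 0) \<and>
     ((\<lambda>\<rho>. real_of_rat (\<theta> \<rho>) * real (h \<rho>)) has_sum 0) (Irr G)"

definition negative_part ::
    "(complex^'n^'n) set \<Rightarrow> 'n stability \<Rightarrow> (complex, 'b, 'n) gmodule \<Rightarrow> 'b set" where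
  "negative_part G \<theta> V =
     LinearCombinations.module.span complex_field V (\<Union>\<rho>\<in>D_minus G \<theta>. isotypic G V \<rho>)"

definition generated_in_D_minus ::
    "(complex^'n^'n) set \<Rightarrow> ('a, 'n) gscheme \<Rightarrow> 'n stability \<Rightarrow> ('a, 'b, 'n) gmodule \<Rightarrow> bool" where
  "generated_in_D_minus G X \<theta> M \<longleftrightarrow>
     LinearCombinations.module.span X M (negative_part G \<theta> (global_sections X M)) = carrier M"

definition constellation ::
    "(complex^'n^'n) set \<Rightarrow> ('a, 'n) gscheme \<Rightarrow> ('n irrep set \<Rightarrow> nat) \<Rightarrow> 'n stability \<Rightarrow>
     ('a, 'b, 'n) gmodule \<Rightarrow> bool" where
  "constellation G X h \<theta> M \<longleftrightarrow>
     OXG_module G X M \<and> generated_in_D_minus G X \<theta> M \<and>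
     (\<forall>\<rho>\<in>Irr G. mult_dim G (global_sections X M) \<rho> = h \<rho>)"

text \<open>The sum converges for every subquotient of a constellation, by comparison with
  \<open>\<Sum>\<^sub>\<rho> \<theta>\<^sub>\<rho> h(\<rho>)\<close>; its value need not be rational.\<close>

definition theta ::
    "(complex^'n^'n) set \<Rightarrow> ('a, 'n) gscheme \<Rightarrow> 'n stability \<Rightarrow> ('a, 'b, 'n) gmodule \<Rightarrow> real" where
  "theta G X \<theta> M =
     (\<Sum>\<^sub>\<infinity>\<rho>\<in>Irr G. real_of_rat (\<theta> \<rho>) * real (mult_dim G (global_sections X M) \<rho>))"

definition neg_rank ::
    "(complex^'n^'n) set \<Rightarrow> ('a, 'n) gscheme \<Rightarrow> 'n stability \<Rightarrow> ('a, 'b, 'n) gmodule \<Rightarrow> nat" where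
  "neg_rank G X \<theta> M = (\<Sum>\<rho>\<in>D_minus G \<theta>. mult_dim G (global_sections X M) \<rho>)"

definition slope ::
    "(complex^'n^'n) set \<Rightarrow> ('a, 'n) gscheme \<Rightarrow> 'n stability \<Rightarrow> ('a, 'b, 'n) gmodule \<Rightarrow> real" where
  "slope G X \<theta> M = - theta G X \<theta> M / real (neg_rank G X \<theta> M)"

definition mu_semistable ::
    "(complex^'n^'n) set \<Rightarrow> ('a, 'n) gscheme \<Rightarrow> 'n stability \<Rightarrow> ('a, 'b, 'n) gmodule \<Rightarrow> bool" where
  "mu_semistable G X \<theta> M \<longleftrightarrow>
     OXG_module G X M \<and> generated_in_D_minus G X \<theta> M \<and>
     (\<forall>N. OXG_submodule G X N M \<and> generated_in_D_minus G X \<theta> (M\<lparr>carrier := N\<rparr>) \<and>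
          {\<zero>\<^bsub>M\<^esub>} \<noteq> N \<and> N \<subset> carrier M
        \<longrightarrow> slope G X \<theta> (M\<lparr>carrier := N\<rparr>) \<le> slope G X \<theta> M)"

text \<open>The quotient \<open>F\<^sub>i\<^sub>+\<^sub>1 / F\<^sub>i\<close> of consecutive members of a list of submodules.\<close>

definition graded_piece ::
    "('a, 'b, 'n::finite) gmodule \<Rightarrow> 'b set list \<Rightarrow> nat \<Rightarrow> ('a, 'b set, 'n) gmodule" where
  "graded_piece M Fs i = quotient_gmodule (M\<lparr>carrier := Fs ! Suc i\<rparr>) (Fs ! i)"

end

theory Submission
  imports Defs
begin

text \<open>
  The submodules of \<open>F\<close> generated in \<open>D\<^sub>-\<close> form a lattice: the join is the sum, the meet
  is the submodule generated by the negative part of the intersection. On it the rank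
  \<open>r\<close> is strictly monotone and modular, because a submodule generated in \<open>D\<^sub>-\<close> is determined
  by its finite-dimensional negative part, and \<open>-\<theta>\<close> is supermodular and bounded, because passing
  from an intersection to the meet loses only multiplicities with \<open>\<theta>\<^sub>\<rho> \<ge> 0\<close>. These properties
  alone give existence and uniqueness of the Harder--Narasimhan chain: take the largest element
  of maximal slope and iterate.

  Additivity of multiplicities rests on complete reducibility. It holds because \<open>H\<^sup>0(F)\<close> is
  by assumption spanned by images of irreducible modules, so that every invariant subspace has an
  invariant complement. Submodules generated in \<open>D\<^sub>-\<close> are automatically finitely generated, since
  irreducible rational modules are finite-dimensional.
\<close>


section \<open>Harder--Narasimhan chains in lattices with slopes\<close>

text \<open>Slopes behave badly under sums and intersections, so they are compared through the
  functional d - c r (\<open>twist c\<close>): on an interval A < B its increment has the sign of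
  the slope minus c, and it inherits supermodularity from d because r is modular. Freezing c at the
  slope under study turns statements about slopes into signs. The analytic obstacle is that
  -\<theta> is a real infinite sum: its values on submodules need not be discrete, so a supremum of
  slopes is not visibly attained. The algebraic obstacle is that the quotients of a filtration
  consist of cosets and do not live in the lattice. They are replaced by intervals, which requires
  that a submodule of P/N is generated in D_- exactly when its preimage in P is. One direction is
  formal. For the other, an extension of generated modules must be generated, so negative generators
  of the quotient have to be lifted, and complete reducibility enters once more.\<close>

locale slope_lattice =
  fixes L :: "'a::order set" and top :: 'a and join meet :: "'a \<Rightarrow> 'a \<Rightarrow> 'a"
    and d :: "'a \<Rightarrow> real" and r :: "'a \<Rightarrow> nat" and K :: real
  assumes top_in: "top \<in> L" and le_top: "A \<in> L \<Longrightarrow> A \<le> top"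
    and join_in: "A \<in> L \<Longrightarrow> B \<in> L \<Longrightarrow> join A B \<in> L"
    and join_ge1: "A \<in> L \<Longrightarrow> B \<in> L \<Longrightarrow> A \<le> join A B"
    and join_ge2: "A \<in> L \<Longrightarrow> B \<in> L \<Longrightarrow> B \<le> join A B"
    and join_least: "A \<in> L \<Longrightarrow> B \<in> L \<Longrightarrow> C \<in> L \<Longrightarrow> A \<le> C \<Longrightarrow> B \<le> C \<Longrightarrow> join A B \<le> C"
    and meet_in: "A \<in> L \<Longrightarrow> B \<in> L \<Longrightarrow> meet A B \<in> L"
    and meet_le1: "A \<in> L \<Longrightarrow> B \<in> L \<Longrightarrow> meet A B \<le> A"
    and meet_le2: "A \<in> L \<Longrightarrow> B \<in> L \<Longrightarrow> meet A B \<le> B"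
    and meet_greatest: "A \<in> L \<Longrightarrow> B \<in> L \<Longrightarrow> C \<in> L \<Longrightarrow> C \<le> A \<Longrightarrow> C \<le> B \<Longrightarrow> C \<le> meet A B"
    and rank_strict: "A \<in> L \<Longrightarrow> B \<in> L \<Longrightarrow> A < B \<Longrightarrow> r A < r B"
    and rank_modular: "A \<in> L \<Longrightarrow> B \<in> L \<Longrightarrow> r (join A B) + r (meet A B) = r A + r B"
    and deg_supermodular: "A \<in> L \<Longrightarrow> B \<in> L \<Longrightarrow> d A + d B \<le> d (join A B) + d (meet A B)"
    and deg_bounded: "A \<in> L \<Longrightarrow> d A \<le> K"
begin

text \<open>The slope of the subquotient B/A, expressed through the ends of the interval, so that
  quotients need not be elements of the lattice.\<close>

definition sl :: "'a \<Rightarrow> 'a \<Rightarrow> real" where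
  "sl A B = (d B - d A) / (real (r B) - real (r A))"

definition twist :: "real \<Rightarrow> 'a \<Rightarrow> real" where
  "twist c A = d A - c * real (r A)"

definition semistable :: "'a \<Rightarrow> 'a \<Rightarrow> bool" where
  "semistable A B \<longleftrightarrow> (\<forall>N\<in>L. A < N \<and> N < B \<longrightarrow> sl A N \<le> sl A B)"

lemma rank_mono: "A \<in> L \<Longrightarrow> B \<in> L \<Longrightarrow> A \<le> B \<Longrightarrow> r A \<le> r B"
  using rank_strict[of A B] by (cases "A = B") (auto simp: order_less_le)

lemma rank_inject: "A \<in> L \<Longrightarrow> B \<in> L \<Longrightarrow> A \<le> B \<Longrightarrow> r B \<le> r A \<Longrightarrow> A = B"
  using rank_strict[of A B] by (cases "A = B") (auto simp: order_less_le)

text \<open>Modularity of the rank is an equality, so its multiple by c may be subtracted for c of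
  either sign.\<close>

lemma twist_supermodular:
  assumes "A \<in> L" "B \<in> L"
  shows "twist c A + twist c B \<le> twist c (join A B) + twist c (meet A B)"
proof -
  have "real (r A) + real (r B) = real (r (join A B)) + real (r (meet A B))"
    using rank_modular[OF assms] by (metis of_nat_add)
  then have "c * real (r A) + c * real (r B) = c * real (r (join A B)) + c * real (r (meet A B))"
    by (metis distrib_left)
  with deg_supermodular[OF assms] show ?thesis by (simp add: twist_def)
qed

lemma twist_diff:
  assumes "A \<in> L" "B \<in> L" "A < B"
  shows "twist c B - twist c A = (sl A B - c) * (real (r B) - real (r A))"
  using rank_strict[OF assms] by (simp add: sl_def twist_def field_simps)

lemma twist_le_iff:
  assumes "A \<in> L" "B \<in> L" "A < B"
  shows "twist c B \<le> twist c A \<longleftrightarrow> sl A B \<le> c"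
proof -
  have "real (r B) - real (r A) > 0" using rank_strict[OF assms] by simp
  then have "(sl A B - c) * (real (r B) - real (r A)) \<le> 0 \<longleftrightarrow> sl A B - c \<le> 0"
    by (simp add: mult_le_0_iff)
  with twist_diff[OF assms, of c] show ?thesis by linarith
qed

lemma twist_less_iff:
  assumes "A \<in> L" "B \<in> L" "A < B"
  shows "twist c B < twist c A \<longleftrightarrow> sl A B < c"
proof -
  have "real (r B) - real (r A) > 0" using rank_strict[OF assms] by simp
  then have "(sl A B - c) * (real (r B) - real (r A)) < 0 \<longleftrightarrow> sl A B - c < 0"
    by (simp add: mult_less_0_iff)
  with twist_diff[OF assms, of c] show ?thesis by linarith
qed

lemma meet_absorb: "A \<in> L \<Longrightarrow> B \<in> L \<Longrightarrow> A \<le> B \<Longrightarrow> meet A B = A"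
  by (meson antisym meet_greatest meet_le1 order_refl)

lemma meet_absorb2: "A \<in> L \<Longrightarrow> B \<in> L \<Longrightarrow> B \<le> A \<Longrightarrow> meet A B = B"
  by (meson antisym meet_greatest meet_le2 order_refl)

text \<open>Lets a link from a to b of a chain be studied inside N: it relates the traces of N on b
  and on a.\<close>

lemma meet_meet:
  assumes "A \<in> L" "B \<in> L" "N \<in> L" "A \<le> B"
  shows "meet (meet N B) A = meet N A"
proof (rule antisym)
  have i: "meet N B \<in> L" "meet N A \<in> L" "meet (meet N B) A \<in> L" using assms meet_in by auto
  show "meet (meet N B) A \<le> meet N A"
    using meet_greatest[OF assms(3,1) i(3)] meet_le1[OF i(1) assms(1)] meet_le2[OF i(1) assms(1)]
      meet_le1[OF assms(3,2)] order_trans by blast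
  show "meet N A \<le> meet (meet N B) A"
    using meet_greatest[OF i(1) assms(1) i(2)] meet_greatest[OF assms(3,2) i(2)]
      meet_le1[OF assms(3,1)] meet_le2[OF assms(3,1)] assms(4) order_trans by blast
qed

text \<open>A supremum of slopes need not be attained a priori. Here it is: the set of elements with
  deficit \<open>g\<close> below \<open>\<epsilon>\<close> is nearly closed under joins, so its elements of largest possible rank
  are eventually unique as \<open>\<epsilon> \<rightarrow> 0\<close>.\<close>

lemma maximal_destabilizing:
  assumes a: "a \<in> L" and "a < top"
  obtains b where "b \<in> L" "a < b" "\<And>N. N \<in> L \<Longrightarrow> a < N \<Longrightarrow> sl a N \<le> sl a b"
    "\<And>N. N \<in> L \<Longrightarrow> a < N \<Longrightarrow> sl a N = sl a b \<Longrightarrow> N \<le> b"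
proof -
  define I where "I = {N \<in> L. a < N}"
  \<comment> \<open>The rank difference is at least 1, so dividing by it cannot increase a
    non-negative bound; the absolute values make the bound non-negative.\<close>
  have bnd: "sl a N \<le> \<bar>K\<bar> + \<bar>d a\<bar>" if "N \<in> I" for N
  proof -
    have N: "N \<in> L" "r a < r N" using that rank_strict[OF a] by (auto simp: I_def)
    then have den: "real (r N) - real (r a) \<ge> 1" by linarith
    have "d N - d a \<le> \<bar>K\<bar> + \<bar>d a\<bar>" using deg_bounded[OF N(1)] by linarith
    also have "\<dots> \<le> (\<bar>K\<bar> + \<bar>d a\<bar>) * (real (r N) - real (r a))"
      using mult_left_mono[OF den, of "\<bar>K\<bar> + \<bar>d a\<bar>"] by simp
    finally show ?thesis using den by (simp add: sl_def divide_le_eq)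
  qed
  have bdd: "bdd_above (sl a ` I)" using bnd by (intro bdd_aboveI[of _ "\<bar>K\<bar> + \<bar>d a\<bar>"]) auto
  have ne: "I \<noteq> {}" using top_in assms by (auto simp: I_def)
  define c where "c = (SUP N\<in>I. sl a N)"
  have le_c: "sl a N \<le> c" if "N \<in> I" for N
    unfolding c_def using that bdd by (rule cSUP_upper)
  \<comment> \<open>The deficit of N against the supremum c, weighted by rank. On \<open>I\<close>
    it vanishes exactly when N attains c.\<close>
  define g where "g N = twist c a - twist c N" for N
  have g_eq: "g N = (c - sl a N) * (real (r N) - real (r a))" if "N \<in> I" for N
    using twist_diff[OF a, of N c] that by (simp add: I_def g_def algebra_simps)
  have g_nonneg: "0 \<le> g N" if "N \<in> L" "a \<le> N" for N
    using twist_le_iff[OF a that(1), of c] le_c[of N] that by (cases "a = N") (auto simp: I_def g_def)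
  \<comment> \<open>The meet of N and N' still lies above a, so its deficit is non-negative and
    supermodularity makes g subadditive on joins.\<close>
  have g_join: "g (join N N') \<le> g N + g N'" if "N \<in> I" "N' \<in> I" for N N'
  proof -
    have i: "N \<in> L" "N' \<in> L" "a \<le> N" "a \<le> N'" using that by (auto simp: I_def)
    have "0 \<le> g (meet N N')" using g_nonneg meet_in meet_greatest a i by auto
    with twist_supermodular[OF i(1,2), of c] show ?thesis by (simp add: g_def)
  qed
  have joinI: "join N N' \<in> I" if "N \<in> I" "N' \<in> I" for N N'
    using that join_in join_ge1 by (auto simp: I_def intro: less_le_trans)
  \<comment> \<open>R is the largest possible rank difference, so a slope within
    \<open>e / R\<close> of the supremum has deficit below e.\<close>
  have small: "\<exists>N\<in>I. g N < e" if "e > 0" for e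
  proof -
    define R where "R = real (r top) - real (r a)"
    have R: "R > 0" using rank_strict[OF a top_in assms(2)] by (simp add: R_def)
    then have "c - e / R < c" using that by simp
    then obtain N where N: "N \<in> I" "c - e / R < sl a N"
      unfolding c_def using less_cSUP_iff[OF ne bdd] by blast
    have rk: "0 < real (r N) - real (r a)" "real (r N) - real (r a) \<le> R"
      using N rank_strict[OF a, of N] rank_mono[of N top] le_top top_in by (auto simp: I_def R_def)
    have "g N < (e / R) * (real (r N) - real (r a))"
      unfolding g_eq[OF N(1)] using N rk by (intro mult_strict_right_mono) auto
    also have "\<dots> \<le> (e / R) * R" using rk R that by (intro mult_left_mono) auto
    also have "\<dots> = e" using R by simp
    finally show ?thesis using N by auto
  qed
  \<comment> \<open>\<open>Q k\<close> says that k bounds the rank of all elements of small enough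
    deficit. The least such k is the largest rank that occurs at arbitrarily small deficit.\<close>
  define Q where "Q k \<longleftrightarrow> (\<exists>e>0. \<forall>N\<in>I. g N < e \<longrightarrow> r N \<le> k)" for k
  define k where "k = (LEAST k. Q k)"
  have "Q (r top)" unfolding Q_def using rank_mono top_in le_top by (auto simp: I_def intro!: exI[of _ 1])
  then have "Q k" unfolding k_def by (rule LeastI)
  then obtain e where e: "e > 0" "\<And>N. N \<in> I \<Longrightarrow> g N < e \<Longrightarrow> r N \<le> k" unfolding Q_def by blast
  \<comment> \<open>Failure of \<open>Q (k - 1)\<close> gives rank at least k at every deficit
    level, and e caps it by k. For k = 0 the natural number \<open>k - 1\<close> is k itself, hence
    the case split.\<close>
  have large: "\<exists>N\<in>I. g N < e' \<and> r N = k" if e': "e' > 0" "e' \<le> e" for e'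
  proof -
    have "\<exists>N\<in>I. g N < e' \<and> k \<le> r N"
    proof (cases "k = 0")
      case True
      then show ?thesis using small e' by auto
    next
      case False
      then have "\<not> Q (k - 1)" using not_less_Least[of "k - 1" Q] by (simp add: k_def)
      then obtain N where "N \<in> I" "g N < e'" "\<not> r N \<le> k - 1" unfolding Q_def using e'(1) by blast
      then show ?thesis by (intro bexI[of _ N]) auto
    qed
    then show ?thesis using e e' by (meson le_antisym less_le_trans)
  qed
  obtain b where b: "b \<in> I" "g b < e / 2" "r b = k" using large[of "e/2"] e by auto
  \<comment> \<open>Two deficits below \<open>e / 2\<close> add up to less than e, so joining N to b
    cannot raise the rank above k, the rank of b. Equal rank forces the join to be b.\<close>
  have absorb: "N \<le> b" if "N \<in> I" "g N < e / 2" for N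
  proof -
    have "g (join b N) < e" using g_join[OF b(1) that(1)] b that by linarith
    then have "r (join b N) \<le> k" using e joinI b that by auto
    then have "join b N = b"
      using rank_inject[of b "join b N"] b that join_in join_ge1 by (auto simp: I_def)
    then show ?thesis using join_ge2[of b N] b that by (auto simp: I_def)
  qed
  \<comment> \<open>A positive deficit could be undercut by another element of rank k, which
    \<open>absorb\<close> places below b and equality of ranks identifies with b.\<close>
  have "g b = 0"
  proof (rule ccontr)
    assume "g b \<noteq> 0"
    then have pos: "g b > 0" using g_nonneg[of b] b by (auto simp: I_def order_less_le)
    have "0 < min (g b) (e / 2)" "min (g b) (e / 2) \<le> e" using pos e(1) by auto
    then obtain N where N: "N \<in> I" "g N < min (g b) (e / 2)" "r N = k" using large by blast
    then have "N = b" using absorb[of N] rank_inject[of N b] b by (auto simp: I_def)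
    with N show False by simp
  qed
  then have slb: "sl a b = c"
    using g_eq[OF b(1)] rank_strict[OF a, of b] b by (auto simp: I_def)
  have "N \<le> b" if "N \<in> I" "sl a N = sl a b" for N
    using absorb[OF that(1)] g_eq[OF that(1)] that slb e by simp
  then show thesis using that[of b] b le_c slb by (auto simp: I_def)
qed

text \<open>The list holds the members strictly above a, while a is an argument: tails are then
  chains of the same kind, each starting at its own bottom.\<close>

fun hn_chain :: "'a \<Rightarrow> 'a list \<Rightarrow> bool" where
  "hn_chain a [] \<longleftrightarrow> a = top"
| "hn_chain a (b # bs) \<longleftrightarrow> b \<in> L \<and> a < b \<and> semistable a b \<and>
     (bs \<noteq> [] \<longrightarrow> sl a b > sl b (hd bs)) \<and> hn_chain b bs"

lemma hn_chain_exists: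
  assumes "a \<in> L"
  shows "\<exists>bs. hn_chain a bs"
  using assms
proof (induction "r top - r a" arbitrary: a rule: less_induct)
  case less
  show ?case
  proof (cases "a = top")
    case True
    then show ?thesis by (intro exI[of _ "[]"]) simp
  next
    case False
    then have "a < top" using le_top less.prems by (simp add: order_less_le)
    from maximal_destabilizing[OF less.prems this] obtain b
      where b: "b \<in> L" "a < b" "\<And>N. N \<in> L \<Longrightarrow> a < N \<Longrightarrow> sl a N \<le> sl a b"
        "\<And>N. N \<in> L \<Longrightarrow> a < N \<Longrightarrow> sl a N = sl a b \<Longrightarrow> N \<le> b" by blast
    have "r top - r b < r top - r a"
      using rank_strict[OF less.prems b(1,2)] rank_mono[OF b(1) top_in le_top[OF b(1)]] by linarith
    then obtain bs where bs: "hn_chain b bs" using less.hyps b(1) by blast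
    \<comment> \<open>Equality of slopes would put N below b, so the slope from a to N is strictly
      smaller than \<open>sl a b\<close>. At the level \<open>sl a b\<close> the twists of a and b
      agree, which transfers the strict inequality to the interval from b to N.\<close>
    have "sl a b > sl b N" if N: "N \<in> L" "b < N" for N
    proof -
      have aN: "a < N" using b N by simp
      then have "sl a N < sl a b" using b(3,4)[of N] N by force
      then have "twist (sl a b) N < twist (sl a b) a"
        using twist_less_iff[OF less.prems N(1) aN] by simp
      also have "\<dots> = twist (sl a b) b" using twist_diff[OF less.prems b(1,2), of "sl a b"] by simp
      finally show ?thesis using twist_less_iff[OF b(1) N] by simp
    qed
    then have "hn_chain a (b # bs)"
      using b bs by (cases bs) (auto simp: semistable_def)
    then show ?thesis ..
  qed
qed

section \<open>Uniqueness of the chain\<close>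

lemma semistable_twist_le:
  assumes "a \<in> L" "b \<in> L" "a < b" "semistable a b" "sl a b \<le> c" "N \<in> L" "a \<le> N" "N \<le> b"
  shows "twist c N \<le> twist c a"
proof (cases "N = a")
  case False
  then have "a < N" using assms by simp
  moreover from this have "sl a N \<le> sl a b"
    using assms by (cases "N = b") (auto simp: semistable_def)
  ultimately show ?thesis using twist_le_iff[of a N c] assms by auto
qed simp

lemma semistable_twist_less:
  assumes "a \<in> L" "b \<in> L" "a < b" "semistable a b" "sl a b < c" "N \<in> L" "a < N" "N \<le> b"
  shows "twist c N < twist c a"
proof -
  have "sl a N \<le> sl a b" using assms by (cases "N = b") (auto simp: semistable_def)
  then show ?thesis using twist_less_iff[of a N c] assms by auto
qed

text \<open>Heuristically, the trace of N on b/a is a subobject of b/a and has slope at most c. In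
  the lattice, the join of \<open>meet N b\<close> with a lies between a and b, where the twist
  cannot exceed its value at a, and supermodularity passes this on to the meets.\<close>

lemma twist_meet_le:
  assumes "a \<in> L" "b \<in> L" "a < b" "semistable a b" "sl a b \<le> c" "N \<in> L"
  shows "twist c (meet N b) \<le> twist c (meet N a)"
proof -
  have i: "meet N b \<in> L" using assms meet_in by auto
  have "twist c (join (meet N b) a) \<le> twist c a"
    using semistable_twist_le[OF assms(1-5), of "join (meet N b) a"] join_in[OF i assms(1)]
      join_ge2[OF i assms(1)] join_least[OF i assms(1,2)] meet_le2 assms by auto
  with twist_supermodular[OF i assms(1), of c] show ?thesis
    using meet_meet[OF assms(1,2,6)] assms(3) by simp
qed

text \<open>Strictness comes from the join of N with a lying strictly above a.\<close>

lemma twist_meet_less: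
  assumes "a \<in> L" "b \<in> L" "a < b" "semistable a b" "sl a b < c" "N \<in> L" "N \<le> b" "\<not> N \<le> a"
  shows "twist c N < twist c (meet N a)"
proof -
  have "join N a \<noteq> a" using join_ge1[of N a] assms by metis
  then have "twist c (join N a) < twist c a"
    using semistable_twist_less[OF assms(1-5), of "join N a"] join_in[OF assms(6,1)]
      join_ge2[OF assms(6,1)] join_least[OF assms(6,1,2)] assms by auto
  with twist_supermodular[OF assms(6,1), of c] show ?thesis by simp
qed

text \<open>Slopes decrease along the chain, so every link obeys the bound c. The inequalities of
  \<open>twist_meet_le\<close> telescope down from the top, whose meet with N is N.\<close>

lemma hn_chain_twist_le:
  assumes "hn_chain a bs" "a \<in> L" "bs \<noteq> [] \<longrightarrow> sl a (hd bs) \<le> c" "N \<in> L"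
  shows "twist c N \<le> twist c (meet N a)"
  using assms
proof (induction bs arbitrary: a)
  case Nil
  then show ?case using meet_absorb le_top by simp
next
  case (Cons b bs)
  then have "twist c N \<le> twist c (meet N b)" by auto
  also have "\<dots> \<le> twist c (meet N a)" using Cons.prems by (intro twist_meet_le) auto
  finally show ?case .
qed

text \<open>The strict drop happens at the first member of the chain that contains N; the links
  below it contribute weak inequalities.\<close>

lemma hn_chain_twist_less:
  assumes "hn_chain a bs" "a \<in> L" "bs \<noteq> [] \<longrightarrow> sl a (hd bs) < c" "N \<in> L" "\<not> N \<le> a"
  shows "twist c N < twist c (meet N a)"
  using assms
proof (induction bs arbitrary: a)
  case Nil
  then show ?case using le_top by auto
next
  case (Cons b bs)
  show ?case
  proof (cases "N \<le> b")
    case True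
    then show ?thesis using Cons.prems by (intro twist_meet_less[of a b]) auto
  next
    case False
    then have "twist c N < twist c (meet N b)" using Cons by auto
    also have "\<dots> \<le> twist c (meet N a)" using Cons.prems by (intro twist_meet_le) auto
    finally show ?thesis .
  qed
qed

text \<open>At the level c = \<open>sl a b\<close> the first link is weak and all later ones are
  strict, which separates the elements below b from the others. Hence any chain begins with the
  largest element of maximal slope, the one found by \<open>maximal_destabilizing\<close>.\<close>

lemma hn_chain_first_maximal:
  assumes "hn_chain a (b # bs)" "a \<in> L" "N \<in> L" "a < N"
  shows "sl a N \<le> sl a b" and "sl a N = sl a b \<Longrightarrow> N \<le> b"
proof -
  define c where "c = sl a b"
  have eq: "meet N a = a" using meet_absorb2 assms by auto
  have le: "twist c N \<le> twist c a" using hn_chain_twist_le[OF assms(1,2) _ assms(3), of c] eq by (simp add: c_def)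
  then show "sl a N \<le> sl a b" using twist_le_iff[OF assms(2-4), of c] by (simp add: c_def)
  assume "sl a N = sl a b"
  then have eqN: "twist c N = twist c a" using twist_diff[OF assms(2-4), of c] by (simp add: c_def)
  show "N \<le> b"
  proof (rule ccontr)
    assume "\<not> N \<le> b"
    then have "twist c N < twist c (meet N b)"
      using hn_chain_twist_less[of b bs c N] assms by (auto simp: c_def)
    also have "\<dots> \<le> twist c a" using twist_meet_le[of a b c N] assms eq by (auto simp: c_def)
    finally show False using eqN by simp
  qed
qed

text \<open>Each first member bounds the slope of the other, so the slopes agree and each of the two
  lies below the other. The tails then start at the same element.\<close>

lemma hn_chain_unique:
  assumes "hn_chain a bs" "hn_chain a bs'" "a \<in> L"
  shows "bs = bs'"
  using assms
proof (induction bs arbitrary: a bs')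
  case Nil
  then show ?case using le_top by (cases bs') (auto simp: less_le_not_le)
next
  case (Cons b bs)
  then obtain b' cs where bs': "bs' = b' # cs" using le_top by (cases bs') (auto simp: less_le_not_le)
  have in_L: "b \<in> L" "b' \<in> L" "a < b" "a < b'" using Cons.prems bs' by auto
  note 1 = hn_chain_first_maximal[OF Cons.prems(1,3) in_L(2,4)]
  note 2 = hn_chain_first_maximal[OF Cons.prems(2)[unfolded bs'] Cons.prems(3) in_L(1,3)]
  have "b = b'" using 1 2 by auto
  then show ?case using Cons bs' by auto
qed

text \<open>Bridge from the recursion to indexed filtrations: \<open>(a # bs) ! i\<close> is the
  predecessor of \<open>bs ! i\<close>, with a itself at i = 0.\<close>

lemma hn_chain_iff_nth:
  "hn_chain a bs \<longleftrightarrow> (a # bs) ! length bs = top \<and>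
     (\<forall>i<length bs. bs ! i \<in> L \<and> (a # bs) ! i < bs ! i \<and> semistable ((a # bs) ! i) (bs ! i)) \<and>
     (\<forall>i. Suc i < length bs \<longrightarrow> sl ((a # bs) ! i) (bs ! i) > sl (bs ! i) (bs ! Suc i))"
proof (induction bs arbitrary: a)
  case (Cons b bs)
  have *: "(\<forall>i. Suc i < length (b # bs) \<longrightarrow> P i) \<longleftrightarrow> (bs \<noteq> [] \<longrightarrow> P 0) \<and> (\<forall>i. Suc i < length bs \<longrightarrow> P (Suc i))" for P
    by (auto simp: gr0_conv_Suc less_Suc_eq_0_disj) (metis not0_implies_Suc)
  show ?case
    unfolding hn_chain.simps Cons.IH * 
    by (auto simp: All_less_Suc2 hd_conv_nth)
qed simp

theorem hn_filtration_unique_exists: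
  assumes "a \<in> L" "a < top"
  shows "\<exists>!Fs. \<exists>t. length Fs = t + 2 \<and> Fs ! 0 = a \<and> Fs ! (t + 1) = top \<and>
    (\<forall>i\<le>t. Fs ! i < Fs ! (i + 1)) \<and> (\<forall>i\<le>t+1. Fs ! i \<in> L) \<and>
    (\<forall>i\<le>t. semistable (Fs ! i) (Fs ! (i + 1))) \<and>
    (\<forall>i<t. sl (Fs ! i) (Fs ! (i + 1)) > sl (Fs ! (i + 1)) (Fs ! (i + 2)))"
    (is "\<exists>!Fs. ?P Fs")
proof -
  have P: "?P Fs \<longleftrightarrow> (\<exists>bs. Fs = a # bs \<and> hn_chain a bs)" for Fs
  proof
    assume "?P Fs"
    then obtain t where t: "length Fs = t + 2" "Fs ! 0 = a" "Fs ! (t + 1) = top"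
      "\<forall>i\<le>t. Fs ! i < Fs ! (i + 1)" "\<forall>i\<le>t+1. Fs ! i \<in> L" "\<forall>i\<le>t. semistable (Fs ! i) (Fs ! (i + 1))"
      "\<forall>i<t. sl (Fs ! i) (Fs ! (i + 1)) > sl (Fs ! (i + 1)) (Fs ! (i + 2))" by blast
    then obtain bs where "Fs = a # bs" by (cases Fs) auto
    with t show "\<exists>bs. Fs = a # bs \<and> hn_chain a bs" unfolding hn_chain_iff_nth by (auto simp: less_Suc_eq_le)
  next
    assume "\<exists>bs. Fs = a # bs \<and> hn_chain a bs"
    then obtain bs where bs: "Fs = a # bs" "hn_chain a bs" by blast
    \<comment> \<open>As a < top, the list is non-empty, and its length minus 1 is the required
      t.\<close>
    then have "bs \<noteq> []" using assms by auto
    then obtain t where t: "length bs = Suc t" by (cases bs) auto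
    show "?P Fs"
    proof (intro exI[of _ t] conjI allI impI)
      fix i assume "i \<le> t + 1"
      then show "Fs ! i \<in> L" using bs t assms(1) unfolding hn_chain_iff_nth by (cases i) auto
    qed (use bs t in \<open>auto simp: hn_chain_iff_nth less_Suc_eq_le\<close>)
  qed
  show ?thesis unfolding P using hn_chain_exists[OF assms(1)] hn_chain_unique[OF _ _ assms(1)] by blast
qed

end

section \<open>Equivariant modules\<close>

lemma field_complex_field: "field complex_field"
proof -
  have "\<exists>y. y + x = 0" for x :: complex by (intro exI[of _ "-x"]) simp
  then have "cring complex_field"
    by (intro cringI abelian_groupI comm_monoidI)
      (auto simp: complex_field_def algebra_simps)
  moreover have "Units complex_field = carrier complex_field - {\<zero>\<^bsub>complex_field\<^esub>}"
  proof -
    have "\<exists>y. y * x = 1 \<and> x * y = 1" if "x \<noteq> 0" for x :: complex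
      using that by (intro exI[of _ "inverse x"]) simp
    then show ?thesis by (auto simp: complex_field_def Units_def)
  qed
  ultimately show ?thesis by (rule cring.cring_fieldI)
qed

text \<open>The ring \<open>R\<close> is \<open>\<complex>\<close> or the coordinate ring of \<open>X\<close>. In the second case \<open>G\<close> acts only
  semilinearly, so nothing but additivity of the action is required.\<close>

definition gmod ::
    "(complex^'n^'n) set \<Rightarrow> ('r, 'z) ring_scheme \<Rightarrow> ('r, 'b, 'n) gmodule \<Rightarrow> bool" where
  "gmod G R M \<longleftrightarrow> Module.module R M \<and> (\<forall>g\<in>G. \<forall>m\<in>carrier M. gact M g m \<in> carrier M) \<and>
     (\<forall>g\<in>G. \<forall>m\<in>carrier M. \<forall>m'\<in>carrier M. gact M g (m \<oplus>\<^bsub>M\<^esub> m') = gact M g m \<oplus>\<^bsub>M\<^esub> gact M g m')"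

definition gsub ::
    "(complex^'n^'n) set \<Rightarrow> ('r, 'z) ring_scheme \<Rightarrow> 'b set \<Rightarrow> ('r, 'b, 'n) gmodule \<Rightarrow> bool" where
  "gsub G R N M \<longleftrightarrow> LinearCombinations.submodule R N M \<and> (\<forall>g\<in>G. \<forall>m\<in>N. gact M g m \<in> N)"

text \<open>In contrast to \<open>gHom\<close> there is no extensionality, so composites and coset
  maps are members as they stand; \<open>restrict_ghom\<close> leads back to
  \<open>gHom\<close>.\<close>

definition ghom ::
    "(complex^'n^'n) set \<Rightarrow> ('r, 'z) ring_scheme \<Rightarrow> ('r, 'b, 'n) gmodule \<Rightarrow> ('r, 'c, 'n) gmodule \<Rightarrow>
     ('b \<Rightarrow> 'c) set" where
  "ghom G R M N = {f \<in> LinearCombinations.module_hom R M N. \<forall>g\<in>G. \<forall>m\<in>carrier M. f (gact M g m) = gact N g (f m)}"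

lemma gmodD:
  assumes "gmod G R M"
  shows "Module.module R M"
    and "g \<in> G \<Longrightarrow> m \<in> carrier M \<Longrightarrow> gact M g m \<in> carrier M"
    and "g \<in> G \<Longrightarrow> m \<in> carrier M \<Longrightarrow> m' \<in> carrier M \<Longrightarrow>
      gact M g (m \<oplus>\<^bsub>M\<^esub> m') = gact M g m \<oplus>\<^bsub>M\<^esub> gact M g m'"
  using assms by (auto simp: gmod_def)

lemma gsubD:
  assumes "gsub G R N M"
  shows "LinearCombinations.submodule R N M" "N \<subseteq> carrier M" "\<zero>\<^bsub>M\<^esub> \<in> N"
    and "x \<in> N \<Longrightarrow> x \<in> carrier M"
    and "x \<in> N \<Longrightarrow> y \<in> N \<Longrightarrow> x \<oplus>\<^bsub>M\<^esub> y \<in> N"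
    and "c \<in> carrier R \<Longrightarrow> x \<in> N \<Longrightarrow> c \<odot>\<^bsub>M\<^esub> x \<in> N"
    and "g \<in> G \<Longrightarrow> x \<in> N \<Longrightarrow> gact M g x \<in> N"
  using assms by (auto simp: gsub_def LinearCombinations.submodule_def)

lemma gsubI:
  assumes "Module.module R M" "N \<subseteq> carrier M" "\<zero>\<^bsub>M\<^esub> \<in> N"
    and "\<And>x y. x \<in> N \<Longrightarrow> y \<in> N \<Longrightarrow> x \<oplus>\<^bsub>M\<^esub> y \<in> N"
    and "\<And>c x. c \<in> carrier R \<Longrightarrow> x \<in> N \<Longrightarrow> c \<odot>\<^bsub>M\<^esub> x \<in> N"
    and "\<And>g x. g \<in> G \<Longrightarrow> x \<in> N \<Longrightarrow> gact M g x \<in> N"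
  shows "gsub G R N M"
  using assms by (auto simp: gsub_def LinearCombinations.submodule_def)

lemma ghomD:
  assumes "f \<in> ghom G R M N"
  shows "x \<in> carrier M \<Longrightarrow> f x \<in> carrier N"
    and "x \<in> carrier M \<Longrightarrow> y \<in> carrier M \<Longrightarrow> f (x \<oplus>\<^bsub>M\<^esub> y) = f x \<oplus>\<^bsub>N\<^esub> f y"
    and "c \<in> carrier R \<Longrightarrow> x \<in> carrier M \<Longrightarrow> f (c \<odot>\<^bsub>M\<^esub> x) = c \<odot>\<^bsub>N\<^esub> f x"
    and "g \<in> G \<Longrightarrow> x \<in> carrier M \<Longrightarrow> f (gact M g x) = gact N g (f x)"
  using assms by (auto simp: ghom_def LinearCombinations.module_hom_def)

lemma ghomI:
  assumes "\<And>x. x \<in> carrier M \<Longrightarrow> f x \<in> carrier N"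
    and "\<And>x y. x \<in> carrier M \<Longrightarrow> y \<in> carrier M \<Longrightarrow> f (x \<oplus>\<^bsub>M\<^esub> y) = f x \<oplus>\<^bsub>N\<^esub> f y"
    and "\<And>c x. c \<in> carrier R \<Longrightarrow> x \<in> carrier M \<Longrightarrow> f (c \<odot>\<^bsub>M\<^esub> x) = c \<odot>\<^bsub>N\<^esub> f x"
    and "\<And>g x. g \<in> G \<Longrightarrow> x \<in> carrier M \<Longrightarrow> f (gact M g x) = gact N g (f x)"
  shows "f \<in> ghom G R M N"
  using assms by (auto simp: ghom_def LinearCombinations.module_hom_def)

lemma module_hom_zero:
  assumes "Module.module R M" "Module.module R N" "f \<in> LinearCombinations.module_hom R M N"
  shows "f \<zero>\<^bsub>M\<^esub> = \<zero>\<^bsub>N\<^esub>"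
proof -
  interpret mod_hom R M N f using assms by (simp add: mod_hom_def mod_hom_axioms_def)
  show ?thesis by simp
qed

lemma ghom_zero:
  assumes "gmod G R M" "gmod G R N" "f \<in> ghom G R M N"
  shows "f \<zero>\<^bsub>M\<^esub> = \<zero>\<^bsub>N\<^esub>"
  using assms by (intro module_hom_zero[of R]) (auto simp: gmod_def ghom_def)

lemma ghom_minus:
  assumes "gmod G R M" "gmod G R N" "f \<in> ghom G R M N" "x \<in> carrier M" "y \<in> carrier M"
  shows "f (x \<ominus>\<^bsub>M\<^esub> y) = f x \<ominus>\<^bsub>N\<^esub> f y"
proof -
  interpret mod_hom R M N f using assms by (simp add: gmod_def ghom_def mod_hom_def mod_hom_axioms_def)
  show ?thesis using assms by simp
qed

lemma gmod_gact_zero: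
  assumes "gmod G R M" "g \<in> G"
  shows "gact M g \<zero>\<^bsub>M\<^esub> = \<zero>\<^bsub>M\<^esub>"
proof -
  interpret Module.module R M using assms by (simp add: gmod_def)
  have "gact M g \<zero>\<^bsub>M\<^esub> \<oplus>\<^bsub>M\<^esub> gact M g \<zero>\<^bsub>M\<^esub> = gact M g \<zero>\<^bsub>M\<^esub> \<oplus>\<^bsub>M\<^esub> \<zero>\<^bsub>M\<^esub>"
    using gmodD[OF assms(1)] assms(2) by (metis M.r_zero M.zero_closed)
  then show ?thesis using gmodD(2)[OF assms] by (metis M.add.l_cancel_one M.r_zero M.zero_closed)
qed

lemma ghom_comp:
  assumes "f \<in> ghom G R L M" "f' \<in> ghom G R M N"
  shows "(\<lambda>x. f' (f x)) \<in> ghom G R L N"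
  using ghomD[OF assms(1)] ghomD[OF assms(2)] by (intro ghomI) auto

text \<open>Submodules are closed under addition and scalars by definition; negatives are multiples
  by -1.\<close>

lemma submodule_minus:
  assumes "LinearCombinations.submodule R N M" "x \<in> N" "y \<in> N"
  shows "\<ominus>\<^bsub>M\<^esub> x \<in> N" "x \<ominus>\<^bsub>M\<^esub> y \<in> N"
proof -
  interpret Module.module R M using assms(1) by (simp add: LinearCombinations.submodule_def)
  have *: "\<ominus>\<^bsub>M\<^esub> z \<in> N" if z: "z \<in> N" for z
  proof -
    have "z \<in> carrier M" using z assms(1) by (auto simp: LinearCombinations.submodule_def)
    moreover have "(\<ominus>\<^bsub>R\<^esub> \<one>\<^bsub>R\<^esub>) \<odot>\<^bsub>M\<^esub> z \<in> N"
      using z by (intro LinearCombinations.submodule.smult_closed[OF assms(1)]) auto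
    ultimately show ?thesis using smult_minus_1[of z] by simp
  qed
  show "\<ominus>\<^bsub>M\<^esub> x \<in> N" "x \<ominus>\<^bsub>M\<^esub> y \<in> N" using assms(2,3) * LinearCombinations.submodule.m_closed[OF assms(1)] by (simp_all add: a_minus_def)
qed

text \<open>The universal property of the span, which takes the place of explicit linear
  combinations: a span is bounded by exhibiting a submodule that contains the generators, typically
  a preimage.\<close>

lemma submodule_span_subset_iff:
  assumes "LinearCombinations.submodule R T M" "S \<subseteq> carrier M"
  shows "LinearCombinations.module.span R M S \<subseteq> T \<longleftrightarrow> S \<subseteq> T"
proof -
  interpret Module.module R M using assms by (simp add: LinearCombinations.submodule_def)
  show ?thesis using span_is_subset[of S T] in_own_span[OF assms(2)] assms by blast
qed

lemma gmod_restrict: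
  assumes "gmod G R M" "gsub G R N M"
  shows "gmod G R (M\<lparr>carrier := N\<rparr>)"
proof -
  interpret Module.module R M using assms by (simp add: gmod_def)
  show ?thesis
    using submodule_is_module[OF gsubD(1)[OF assms(2)]] gsubD[OF assms(2)] gmodD[OF assms(1)]
    by (auto simp: gmod_def)
qed

lemma gsub_restrict_iff:
  assumes "gmod G R M" "gsub G R N M"
  shows "gsub G R T (M\<lparr>carrier := N\<rparr>) \<longleftrightarrow> gsub G R T M \<and> T \<subseteq> N"
  using assms gmod_restrict[OF assms] gsubD(2)[OF assms(2)]
  by (auto simp: gsub_def LinearCombinations.submodule_def gmod_def)

lemma gsub_of_restrict_gmod:
  assumes "gmod G R M" "N \<subseteq> carrier M" "gmod G R (M\<lparr>carrier := N\<rparr>)"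
  shows "gsub G R N M"
proof -
  interpret M: Module.module R M using assms by (simp add: gmod_def)
  interpret N: Module.module R "M\<lparr>carrier := N\<rparr>" using assms by (simp add: gmod_def)
  show ?thesis using gmodD[OF assms(3)] N.M.zero_closed N.M.a_closed N.smult_closed assms(2)
    by (intro gsubI) (auto intro: M.module_axioms)
qed

lemma gsub_carrier: "gmod G R M \<Longrightarrow> gsub G R (carrier M) M"
proof -
  assume a: "gmod G R M"
  interpret M: Module.module R M using a by (simp add: gmod_def)
  show ?thesis using gmodD[OF a] by (intro gsubI) auto
qed

lemma gsub_zero: "gmod G R M \<Longrightarrow> gsub G R {\<zero>\<^bsub>M\<^esub>} M"
proof -
  assume a: "gmod G R M"
  interpret M: Module.module R M using a by (simp add: gmod_def)
  show ?thesis using gmodD[OF a] gmod_gact_zero[OF a] by (intro gsubI) auto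
qed

lemma gsub_inter:
  assumes "gsub G R A M" "gsub G R B M"
  shows "gsub G R (A \<inter> B) M"
  using assms by (auto simp: gsub_def LinearCombinations.submodule_def)

lemma gsub_vimage:
  assumes "gmod G R M" "gmod G R N" "f \<in> ghom G R M N" "gsub G R T N"
  shows "gsub G R {x \<in> carrier M. f x \<in> T} M"
proof -
  interpret M: Module.module R M using assms by (simp add: gmod_def)
  show ?thesis
    using ghomD[OF assms(3)] gsubD[OF assms(4)] gmodD[OF assms(1)] ghom_zero[OF assms(1-3)]
    by (intro gsubI) auto
qed

lemma gsub_image:
  assumes "gmod G R M" "gmod G R N" "f \<in> ghom G R M N" "gsub G R T M"
  shows "gsub G R (f ` T) N"
proof (rule gsubI)
  note f = ghomD[OF assms(3)] and T = gsubD[OF assms(4)]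
  show "Module.module R N" using assms by (simp add: gmod_def)
  show "f ` T \<subseteq> carrier N" using f T by auto
  show "\<zero>\<^bsub>N\<^esub> \<in> f ` T" using T(3) ghom_zero[OF assms(1-3)] by (metis imageI)
  fix x g c assume "x \<in> f ` T"
  then obtain t where t: "t \<in> T" "x = f t" by blast
  { fix y assume "y \<in> f ` T"
    then obtain u where "u \<in> T" "y = f u" by blast
    then show "x \<oplus>\<^bsub>N\<^esub> y \<in> f ` T" using t f(2)[of t u] T by (metis imageI) }
  show "c \<in> carrier R \<Longrightarrow> c \<odot>\<^bsub>N\<^esub> x \<in> f ` T" using t f(3)[of c t] T by (metis imageI)
  show "g \<in> G \<Longrightarrow> gact N g x \<in> f ` T" using t f(4)[of g t] T by (metis imageI)
qed

section \<open>Sums of invariant submodules\<close>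

definition msum :: "('r, 'b, 'n) gmodule \<Rightarrow> 'b set \<Rightarrow> 'b set \<Rightarrow> 'b set" where
  "msum M A B = {a \<oplus>\<^bsub>M\<^esub> b |a b. a \<in> A \<and> b \<in> B}"

lemma msumI: "a \<in> A \<Longrightarrow> b \<in> B \<Longrightarrow> a \<oplus>\<^bsub>M\<^esub> b \<in> msum M A B"
  by (auto simp: msum_def)

lemma gsub_msum:
  assumes "gmod G R M" "gsub G R A M" "gsub G R B M"
  shows "gsub G R (msum M A B) M"
proof (rule gsubI)
  note A = gsubD[OF assms(2)] and B = gsubD[OF assms(3)]
  show m: "Module.module R M" using assms by (simp add: gmod_def)
  interpret M: Module.module R M by fact
  show "msum M A B \<subseteq> carrier M" using A(4) B(4) by (auto simp: msum_def)
  show "\<zero>\<^bsub>M\<^esub> \<in> msum M A B" using msumI[OF A(3) B(3), of M] by simp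
  fix x g c assume "x \<in> msum M A B"
  then obtain a b where x: "a \<in> A" "b \<in> B" "x = a \<oplus>\<^bsub>M\<^esub> b" by (auto simp: msum_def)
  { fix y assume "y \<in> msum M A B"
    then obtain a' b' where y: "a' \<in> A" "b' \<in> B" "y = a' \<oplus>\<^bsub>M\<^esub> b'" by (auto simp: msum_def)
    have "x \<oplus>\<^bsub>M\<^esub> y = (a \<oplus>\<^bsub>M\<^esub> a') \<oplus>\<^bsub>M\<^esub> (b \<oplus>\<^bsub>M\<^esub> b')"
      using x y A(4) B(4) by (simp add: M.M.a_ac)
    then show "x \<oplus>\<^bsub>M\<^esub> y \<in> msum M A B" using x y A B msumI by metis }
  show "c \<odot>\<^bsub>M\<^esub> x \<in> msum M A B" if "c \<in> carrier R"
    using x that A(4) B(4) msumI[OF A(6)[OF that x(1)] B(6)[OF that x(2)], of M] by (simp add: M.smult_r_distr)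
  show "gact M g x \<in> msum M A B" if "g \<in> G"
    using x that A(4) B(4) msumI[OF A(7)[OF that x(1)] B(7)[OF that x(2)], of M] gmodD(3)[OF assms(1)] by simp
qed

lemma msum_upper:
  assumes "gmod G R M" "gsub G R A M" "gsub G R B M"
  shows "A \<subseteq> msum M A B" "B \<subseteq> msum M A B"
proof -
  note A = gsubD[OF assms(2)] and B = gsubD[OF assms(3)]
  interpret M: Module.module R M using assms by (simp add: gmod_def)
  show "A \<subseteq> msum M A B"
  proof
    fix a assume "a \<in> A" then show "a \<in> msum M A B" using msumI[of a A _ B M, OF _ B(3)] A(4) by simp
  qed
  show "B \<subseteq> msum M A B"
  proof
    fix b assume "b \<in> B" then show "b \<in> msum M A B" using msumI[of _ A b B M, OF A(3)] B(4) by simp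
  qed
qed

lemma msum_least:
  assumes "gsub G R C M" "A \<subseteq> C" "B \<subseteq> C"
  shows "msum M A B \<subseteq> C"
  using gsubD(5)[OF assms(1)] assms(2,3) by (auto simp: msum_def)

text \<open>N starts as a bare record, and every axiom is pulled back along the surjection, so none
  has to be verified on cosets. The value at zero is a hypothesis because preservation of zero
  follows from additivity only once N is known to be a group.\<close>

lemma image_module:
  assumes "Module.module R M" "f \<in> LinearCombinations.module_hom R M N" "f ` carrier M = carrier N" "f \<zero>\<^bsub>M\<^esub> = \<zero>\<^bsub>N\<^esub>"
  shows "Module.module R N"
proof -
  interpret M: Module.module R M by fact
  \<comment> \<open>Oriented so that operations of N become images of operations of M, which reduces
    each axiom to the one of M.\<close>
  note [simp] = LinearCombinations.module_hom_add[OF assms(2), symmetric] LinearCombinations.module_hom_smult[OF assms(2), symmetric] assms(4)[symmetric]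
  have ex: "\<exists>x\<in>carrier M. f x = y" if "y \<in> carrier N" for y
    using that unfolding assms(3)[symmetric] by blast
  have cl[simp]: "f x \<in> carrier N" if "x \<in> carrier M" for x using that assms(3) by auto
  show ?thesis
  proof (rule module_criteria; (intro allI ballI impI; (elim conjE)?)?)
    show "cring R" by (rule M.R.is_cring)
    show "\<zero>\<^bsub>N\<^esub> \<in> carrier N" by simp
    fix v w assume "v \<in> carrier N" "w \<in> carrier N"
    then obtain x y where [simp]: "x \<in> carrier M" "v = f x" "y \<in> carrier M" "w = f y" using ex by metis
    show "v \<oplus>\<^bsub>N\<^esub> w \<in> carrier N" by simp
    show "v \<oplus>\<^bsub>N\<^esub> w = w \<oplus>\<^bsub>N\<^esub> v" by (simp add: M.M.a_comm)
    { fix z assume "z \<in> carrier N"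
      then obtain u where [simp]: "u \<in> carrier M" "z = f u" using ex by metis
      show "(v \<oplus>\<^bsub>N\<^esub> w) \<oplus>\<^bsub>N\<^esub> z = v \<oplus>\<^bsub>N\<^esub> (w \<oplus>\<^bsub>N\<^esub> z)" by (simp add: M.M.a_assoc) }
    fix c assume "c \<in> carrier R"
    then show "c \<odot>\<^bsub>N\<^esub> (v \<oplus>\<^bsub>N\<^esub> w) = c \<odot>\<^bsub>N\<^esub> v \<oplus>\<^bsub>N\<^esub> c \<odot>\<^bsub>N\<^esub> w" by (simp add: M.smult_r_distr)
  next
    fix v assume "v \<in> carrier N"
    then obtain x where [simp]: "x \<in> carrier M" "v = f x" using ex by metis
    show "v \<oplus>\<^bsub>N\<^esub> \<zero>\<^bsub>N\<^esub> = v" by simp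
    show "\<one>\<^bsub>R\<^esub> \<odot>\<^bsub>N\<^esub> v = v" by simp
    show "\<exists>w\<in>carrier N. v \<oplus>\<^bsub>N\<^esub> w = \<zero>\<^bsub>N\<^esub>"
      by (intro bexI[of _ "f (\<ominus>\<^bsub>M\<^esub> x)"]) (simp_all add: M.M.r_neg)
    fix c assume [simp]: "c \<in> carrier R"
    show "c \<odot>\<^bsub>N\<^esub> v \<in> carrier N" by simp
    fix c' assume [simp]: "c' \<in> carrier R"
    show "(c \<otimes>\<^bsub>R\<^esub> c') \<odot>\<^bsub>N\<^esub> v = c \<odot>\<^bsub>N\<^esub> (c' \<odot>\<^bsub>N\<^esub> v)" by (simp add: M.smult_assoc1)
    show "(c \<oplus>\<^bsub>R\<^esub> c') \<odot>\<^bsub>N\<^esub> v = c \<odot>\<^bsub>N\<^esub> v \<oplus>\<^bsub>N\<^esub> c' \<odot>\<^bsub>N\<^esub> v" by (simp add: M.smult_l_distr)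
  qed
qed

lemma image_gmod:
  assumes "gmod G R M" "f \<in> ghom G R M N" "f ` carrier M = carrier N" "f \<zero>\<^bsub>M\<^esub> = \<zero>\<^bsub>N\<^esub>"
  shows "gmod G R N"
proof -
  have ex: "\<exists>x\<in>carrier M. f x = y" if "y \<in> carrier N" for y
    using that unfolding assms(3)[symmetric] by blast
  have "Module.module R N"
    using assms by (intro image_module[of R M f]) (auto simp: ghom_def gmod_def)
  moreover have "gact N g y \<in> carrier N" if "g \<in> G" "y \<in> carrier N" for g y
    using ex[OF that(2)] ghomD[OF assms(2)] gmodD[OF assms(1)] that(1) by metis
  moreover have "gact N g (y \<oplus>\<^bsub>N\<^esub> y') = gact N g y \<oplus>\<^bsub>N\<^esub> gact N g y'"
    if g: "g \<in> G" "y \<in> carrier N" "y' \<in> carrier N" for g y y'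
  proof -
    interpret M: Module.module R M using assms by (simp add: gmod_def)
    obtain x x' where x: "x \<in> carrier M" "y = f x" "x' \<in> carrier M" "y' = f x'" using ex g by metis
    have "gact N g (f (x \<oplus>\<^bsub>M\<^esub> x')) = f (gact M g (x \<oplus>\<^bsub>M\<^esub> x'))"
      using x g ghomD(4)[OF assms(2)] by simp
    also have "\<dots> = f (gact M g x) \<oplus>\<^bsub>N\<^esub> f (gact M g x')"
      using x g gmodD[OF assms(1)] ghomD(2)[OF assms(2)] by simp
    finally show ?thesis using x g ghomD[OF assms(2)] by simp
  qed
  ultimately show ?thesis by (auto simp: gmod_def)
qed

lemma a_rcosets_eq_image: "a_rcosets\<^bsub>M\<^esub> N = (\<lambda>m. N +>\<^bsub>M\<^esub> m) ` carrier M"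
  by (auto simp: A_RCOSETS_def' )

text \<open>Later proofs reach quotients only through these facts: a surjection that respects all
  operations and has kernel N.\<close>

lemma coset_map:
  assumes M: "gmod G R M" and N: "gsub G R N M"
  defines "f \<equiv> \<lambda>m. N +>\<^bsub>M\<^esub> m"
  shows "f \<in> ghom G R M (quotient_gmodule M N)"
    and "f ` carrier M = carrier (quotient_gmodule M N)"
    and "f \<zero>\<^bsub>M\<^esub> = \<zero>\<^bsub>quotient_gmodule M N\<^esub>"
    and "{m \<in> carrier M. f m = \<zero>\<^bsub>quotient_gmodule M N\<^esub>} = N"
proof -
  interpret M: Module.module R M using M by (simp add: gmod_def)
  note n = gsubD[OF N]
  have "additive_subgroup N M"
    using n submodule_minus[OF n(1)]
    by (intro additive_subgroupI M.M.add.subgroupI) (auto simp: a_inv_def[symmetric])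
  then interpret N: abelian_subgroup N M
    using M.M.abelian_group_axioms by (rule abelian_subgroupI3)
  have eq: "f m = f m'" if "m \<in> carrier M" "m' \<in> carrier M" "m' \<in> f m" for m m'
    using N.a_repr_independence'[of m' m] that by (simp add: f_def)
  have self: "m \<in> f m" if "m \<in> carrier M" for m
    using N.a_rcos_self[OF that] by (simp add: f_def)
  have sub: "m' \<in> carrier M" if "m \<in> carrier M" "m' \<in> f m" for m m'
    using that N.a_elemrcos_carrier unfolding f_def by blast
  \<comment> \<open>Scalars and group elements act on a coset by a union over its representatives.
    An additive h that preserves N sends all of them into one coset, so the union collapses.\<close>
  have un: "(\<Union>m'\<in>f m. f (h m')) = f (h m)"
    if m: "m \<in> carrier M" and h: "\<And>x. x \<in> carrier M \<Longrightarrow> h x \<in> carrier M" "\<And>x. x \<in> N \<Longrightarrow> h x \<in> N"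
      "\<And>x y. x \<in> carrier M \<Longrightarrow> y \<in> carrier M \<Longrightarrow> h (x \<oplus>\<^bsub>M\<^esub> y) = h x \<oplus>\<^bsub>M\<^esub> h y" for m h
  proof -
    have "f (h m') = f (h m)" if m': "m' \<in> f m" for m'
    proof -
      obtain x where x: "x \<in> N" "m' = x \<oplus>\<^bsub>M\<^esub> m" using m' by (auto simp: f_def a_r_coset_def')
      then have "h m' = h x \<oplus>\<^bsub>M\<^esub> h m" using h(3) m n(4) by simp
      then have "h m' \<in> f (h m)" using h(2)[OF x(1)] by (auto simp: f_def a_r_coset_def')
      then show ?thesis using eq[of "h m" "h m'"] h(1) m sub that by auto
    qed
    then have "(\<Union>m'\<in>f m. f (h m')) = (\<Union>m'\<in>f m. f (h m))" by (rule SUP_cong[OF refl])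
    also have "\<dots> = f (h m)" using self[OF m] by blast
    finally show ?thesis .
  qed
  show "f \<in> ghom G R M (quotient_gmodule M N)"
  proof (rule ghomI)
    fix x y c g assume x: "x \<in> carrier M"
    show "f x \<in> carrier (quotient_gmodule M N)" using x by (simp add: quotient_gmodule_def a_rcosets_eq_image f_def)
    show "f (x \<oplus>\<^bsub>M\<^esub> y) = f x \<oplus>\<^bsub>quotient_gmodule M N\<^esub> f y" if "y \<in> carrier M"
      using N.a_rcos_sum[OF x that] by (simp add: quotient_gmodule_def f_def)
    show "f (c \<odot>\<^bsub>M\<^esub> x) = c \<odot>\<^bsub>quotient_gmodule M N\<^esub> f x" if "c \<in> carrier R"
      using un[OF x, of "\<lambda>x. c \<odot>\<^bsub>M\<^esub> x"] that n M.smult_r_distr by (simp add: quotient_gmodule_def f_def)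
    show "f (gact M g x) = gact (quotient_gmodule M N) g (f x)" if "g \<in> G"
      using un[OF x, of "gact M g"] that n gmodD[OF M] by (simp add: quotient_gmodule_def f_def)
  qed
  show "f ` carrier M = carrier (quotient_gmodule M N)"
    by (simp add: quotient_gmodule_def a_rcosets_eq_image f_def)
  have f0: "f x = N" if "x \<in> N" for x
    using that N.a_rcos_const by (simp add: f_def)
  then show "f \<zero>\<^bsub>M\<^esub> = \<zero>\<^bsub>quotient_gmodule M N\<^esub>" using n(3) by (simp add: quotient_gmodule_def)
  show "{m \<in> carrier M. f m = \<zero>\<^bsub>quotient_gmodule M N\<^esub>} = N"
    using f0 self n(4) by (auto simp: quotient_gmodule_def)
qed

section \<open>Complete reducibility\<close>

lemma module_hom_finsum:
  assumes "Module.module R M" "Module.module R N" "f \<in> LinearCombinations.module_hom R M N"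
    and "finite A" "h \<in> A \<rightarrow> carrier M"
  shows "f (\<Oplus>\<^bsub>M\<^esub>i\<in>A. h i) = (\<Oplus>\<^bsub>N\<^esub>i\<in>A. f (h i))"
proof -
  interpret mod_hom R M N f using assms by (simp add: mod_hom_def mod_hom_axioms_def)
  show ?thesis using assms(4,5)
  proof (induction A rule: finite_induct)
    case (insert i A)
    then have "h \<in> A \<rightarrow> carrier M" "h i \<in> carrier M" "(\<lambda>i. f (h i)) \<in> A \<rightarrow> carrier N" by auto
    then show ?case using insert f_im by (simp add: M.M.finsum_insert N.M.finsum_insert)
  qed simp
qed

lemma rational_gmod: "rational_gmodule G V \<Longrightarrow> gmod G complex_field V"
  by (auto simp: rational_gmodule_def gmod_def LinearCombinations.module_hom_def)

text \<open>The vectors that witness rationality at a preimage of y are pushed forward by f;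
  linearity and the group laws of the action descend in the same way.\<close>

lemma rational_image:
  assumes G: "linear_algebraic_group G" and V: "rational_gmodule G V" and f: "f \<in> ghom G complex_field V W"
    and surj: "f ` carrier V = carrier W" and zero: "f \<zero>\<^bsub>V\<^esub> = \<zero>\<^bsub>W\<^esub>"
  shows "rational_gmodule G W"
proof -
  note gV = rational_gmod[OF V]
  note gW = image_gmod[OF gV f surj zero]
  interpret W: Module.module complex_field W using gW by (simp add: gmod_def)
  interpret V: Module.module complex_field V using gV by (simp add: gmod_def)
  have ex: "\<exists>x\<in>carrier V. f x = y" if "y \<in> carrier W" for y
    using that unfolding surj[symmetric] by blast
  note fD = ghomD[OF f]
  have act: "gact W g \<in> LinearCombinations.module_hom complex_field W W" if g: "g \<in> G" for g
  proof -
    have "gact W g (c \<odot>\<^bsub>W\<^esub> y) = c \<odot>\<^bsub>W\<^esub> gact W g y"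
      if y: "y \<in> carrier W" "c \<in> carrier complex_field" for c y
    proof -
      obtain x where x: "x \<in> carrier V" "y = f x" using ex y(1) by blast
      have "gact V g (c \<odot>\<^bsub>V\<^esub> x) = c \<odot>\<^bsub>V\<^esub> gact V g x"
        using V g x y(2) by (auto simp: rational_gmodule_def LinearCombinations.module_hom_def)
      then have "f (gact V g (c \<odot>\<^bsub>V\<^esub> x)) = f (c \<odot>\<^bsub>V\<^esub> gact V g x)" by simp
      then show ?thesis using x y(2) g fD gmodD(2)[OF gV g x(1)] by simp
    qed
    then show ?thesis using gmodD[OF gW] g by (auto simp: LinearCombinations.module_hom_def)
  qed
  have grp: "mat 1 \<in> G" "\<And>g h. g \<in> G \<Longrightarrow> h \<in> G \<Longrightarrow> g ** h \<in> G"
    using G by (auto simp: linear_algebraic_group_def)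
  show ?thesis
    unfolding rational_gmodule_def
  proof (intro conjI ballI)
    show "Module.module complex_field W" by (rule W.module_axioms)
    show "gact W g \<in> LinearCombinations.module_hom complex_field W W" if "g \<in> G" for g by (rule act[OF that])
    fix y assume "y \<in> carrier W"
    then obtain x where x: "x \<in> carrier V" "y = f x" using ex by blast
    have "gact V (mat 1) x = x" using V x(1) by (simp add: rational_gmodule_def)
    then show "gact W (mat 1) y = y" using fD(4)[OF grp(1) x(1)] x(2) by simp
    show "gact W (g ** h) y = gact W g (gact W h y)" if gh: "g \<in> G" "h \<in> G" for g h
    proof -
      have "gact V (g ** h) x = gact V g (gact V h x)"
        using V x(1) gh by (simp add: rational_gmodule_def)
      then show ?thesis
        using fD(4)[OF grp(2)[OF gh] x(1)] fD(4)[OF gh(1) gmodD(2)[OF gV gh(2) x(1)]] fD(4)[OF gh(2) x(1)] x(2)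
        by simp
    qed
    obtain k :: nat and a w where
      w: "\<And>i. i < k \<Longrightarrow> a i \<in> regular_functions" "\<And>i. i < k \<Longrightarrow> w i \<in> carrier V"
      and eq: "\<And>g. g \<in> G \<Longrightarrow> gact V g x = (\<Oplus>\<^bsub>V\<^esub>i\<in>{..<k}. a i g \<odot>\<^bsub>V\<^esub> w i)"
    proof -
      have "\<exists>(k::nat) a w. (\<forall>i<k. a i \<in> regular_functions \<and> w i \<in> carrier V) \<and>
          (\<forall>g\<in>G. gact V g x = (\<Oplus>\<^bsub>V\<^esub>i\<in>{..<k}. a i g \<odot>\<^bsub>V\<^esub> w i))"
        using V x(1) unfolding rational_gmodule_def by simp
      then show ?thesis using that by blast
    qed
    have "gact W g y = (\<Oplus>\<^bsub>W\<^esub>i\<in>{..<k}. a i g \<odot>\<^bsub>W\<^esub> f (w i))" if g: "g \<in> G" for g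
    proof -
      have c: "c \<in> carrier complex_field" for c by (simp add: complex_field_def)
      have "gact W g y = f (\<Oplus>\<^bsub>V\<^esub>i\<in>{..<k}. a i g \<odot>\<^bsub>V\<^esub> w i)"
        using fD(4)[OF g x(1)] eq[OF g] x(2) by simp
      also have "\<dots> = (\<Oplus>\<^bsub>W\<^esub>i\<in>{..<k}. f (a i g \<odot>\<^bsub>V\<^esub> w i))"
        using f w c by (intro module_hom_finsum[OF V.module_axioms W.module_axioms]) (auto simp: ghom_def)
      also have "\<dots> = (\<Oplus>\<^bsub>W\<^esub>i\<in>{..<k}. a i g \<odot>\<^bsub>W\<^esub> f (w i))"
        using w c fD by (intro W.M.finsum_cong') auto
      finally show ?thesis .
    qed
    then show "\<exists>(k::nat) a w. (\<forall>i<k. a i \<in> regular_functions \<and> w i \<in> carrier W) \<and>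
        (\<forall>g\<in>G. gact W g y = (\<Oplus>\<^bsub>W\<^esub>i\<in>{..<k}. a i g \<odot>\<^bsub>W\<^esub> w i))"
      using w fD(1) by (intro exI[of _ k] exI[of _ a] exI[of _ "\<lambda>i. f (w i)"]) auto
  qed
qed

section \<open>Irreducible modules, their images, and complements\<close>

lemma gHom_eq: "gHom G U V = ghom G complex_field U V \<inter> extensional (carrier U)"
  by (auto simp: gHom_def ghom_def)

lemma restrict_ghom:
  assumes "gmod G complex_field U" "f \<in> ghom G complex_field U V"
  shows "restrict f (carrier U) \<in> gHom G U V"
proof -
  interpret U: Module.module complex_field U using assms by (simp add: gmod_def)
  show ?thesis unfolding gHom_eq using ghomD[OF assms(2)] gmodD[OF assms(1)]
    by (auto intro!: ghomI)
qed

text \<open>The identity map shows that isomorphism is reflexive. So the class contains a module,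
  and the choice in \<open>irrep_of\<close> lands in the class.\<close>

lemma irreducible_irrep_of:
  fixes \<rho> :: "'n::finite irrep set"
  assumes "\<rho> \<in> Irr G"
  shows "irreducible_gmodule G (irrep_of \<rho>)"
proof -
  define R :: "('n irrep \<times> 'n irrep) set" where "R = {(V, W). irreducible_gmodule G V \<and> irreducible_gmodule G W \<and> gmodule_iso G V W}"
  obtain V where V: "\<rho> = R `` {V}" "irreducible_gmodule G V"
    using assms by (auto simp: Irr_def R_def quotient_def)
  have "gmod G complex_field V" using V(2) by (auto simp: irreducible_gmodule_def rational_gmod)
  then have "(\<lambda>x\<in>carrier V. x) \<in> gHom G V V" by (rule restrict_ghom) (auto intro: ghomI)
  then have "gmodule_iso G V V" unfolding gmodule_iso_def by (rule bexI[rotated]) (auto simp: bij_betw_def inj_on_def)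
  then have "V \<in> \<rho>" using V by (simp add: R_def)
  then have "irrep_of \<rho> \<in> \<rho>" unfolding irrep_of_def by (rule someI)
  then show ?thesis using V by (simp add: R_def)
qed

lemma irrep_gmod: "\<rho> \<in> Irr G \<Longrightarrow> gmod G complex_field (irrep_of \<rho>)"
  using irreducible_irrep_of by (auto simp: irreducible_gmodule_def intro: rational_gmod)

text \<open>Raw generators instead of the iterated spans in \<open>isotypic\<close> and
  \<open>negative_part\<close>: homomorphisms send generators to generators, and subspaces cannot
  tell the generators from their span.\<close>

definition gens ::
    "(complex^'n^'n) set \<Rightarrow> 'n irrep set set \<Rightarrow> (complex, 'b, 'n) gmodule \<Rightarrow> 'b set" where
  "gens G D V = (\<Union>\<rho>\<in>D. \<Union>f\<in>gHom G (irrep_of \<rho>) V. f ` carrier (irrep_of \<rho>))"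

lemma gens_subset: "gens G D V \<subseteq> carrier V"
  by (auto simp: gens_def gHom_eq dest: ghomD)

text \<open>With \<open>D = Irr G\<close> this tests whether T contains the span of all isotypic
  parts, with \<open>D_minus\<close> whether it contains the negative part.\<close>

lemma isotypic_span_subset_iff:
  assumes "LinearCombinations.submodule complex_field T V"
  shows "LinearCombinations.module.span complex_field V (\<Union>\<rho>\<in>D. isotypic G V \<rho>) \<subseteq> T \<longleftrightarrow> gens G D V \<subseteq> T"
proof -
  interpret V: Module.module complex_field V using assms by (simp add: LinearCombinations.submodule_def)
  have gen: "(\<Union>f\<in>gHom G (irrep_of \<rho>) V. f ` carrier (irrep_of \<rho>)) \<subseteq> carrier V" for \<rho>
    by (auto simp: gHom_eq dest: ghomD)
  have 1: "isotypic G V \<rho> \<subseteq> T \<longleftrightarrow> (\<Union>f\<in>gHom G (irrep_of \<rho>) V. f ` carrier (irrep_of \<rho>)) \<subseteq> T" for \<rho>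
    unfolding isotypic_def by (rule submodule_span_subset_iff[OF assms gen])
  have "isotypic G V \<rho> \<subseteq> carrier V" for \<rho>
    unfolding isotypic_def by (rule V.span_is_subset2[OF gen])
  then have 2: "(\<Union>\<rho>\<in>D. isotypic G V \<rho>) \<subseteq> carrier V" by blast
  show ?thesis unfolding submodule_span_subset_iff[OF assms 2] UN_subset_iff 1 gens_def by simp
qed

text \<open>Zorn's lemma gives a maximal invariant W that meets N only in zero. If N + W missed part
  of the image of an irreducible module, irreducibility would make that image meet N + W only in
  zero, and W could be enlarged by it.\<close>

lemma invariant_complement:
  assumes V: "gmod G complex_field V"
    and span: "LinearCombinations.module.span complex_field V (\<Union>\<rho>\<in>Irr G. isotypic G V \<rho>) = carrier V"
    and N: "gsub G complex_field N V"
  obtains W where "gsub G complex_field W V" "N \<inter> W = {\<zero>\<^bsub>V\<^esub>}" "msum V N W = carrier V"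
proof -
  interpret V: Module.module complex_field V using V by (simp add: gmod_def)
  define \<A> where "\<A> = {W. gsub G complex_field W V \<and> N \<inter> W = {\<zero>\<^bsub>V\<^esub>}}"
  have zero: "{\<zero>\<^bsub>V\<^esub>} \<in> \<A>" using gsub_zero[OF V] gsubD(3)[OF N] by (auto simp: \<A>_def)
  have chain: "\<Union>\<C> \<in> \<A>" if ne: "\<C> \<noteq> {}" and C: "subset.chain \<A> \<C>" for \<C>
  proof -
    have sub: "\<And>W. W \<in> \<C> \<Longrightarrow> gsub G complex_field W V"
      and triv: "\<And>W. W \<in> \<C> \<Longrightarrow> N \<inter> W = {\<zero>\<^bsub>V\<^esub>}"
      and lin: "\<And>A B. A \<in> \<C> \<Longrightarrow> B \<in> \<C> \<Longrightarrow> A \<subseteq> B \<or> B \<subseteq> A"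
      using C by (auto simp: subset.chain_def \<A>_def)
    have "gsub G complex_field (\<Union>\<C>) V"
    proof (rule gsubI[OF V.module_axioms])
      show "\<Union>\<C> \<subseteq> carrier V" using gsubD(2)[OF sub] by blast
      show "\<zero>\<^bsub>V\<^esub> \<in> \<Union>\<C>" using ne gsubD(3)[OF sub] by blast
      show "x \<oplus>\<^bsub>V\<^esub> y \<in> \<Union>\<C>" if xy: "x \<in> \<Union>\<C>" "y \<in> \<Union>\<C>" for x y
      proof -
        obtain W where "W \<in> \<C>" "x \<in> W" "y \<in> W" using xy lin by blast
        then show ?thesis using gsubD(5)[OF sub] by blast
      qed
      show "c \<odot>\<^bsub>V\<^esub> x \<in> \<Union>\<C>" if "c \<in> carrier complex_field" "x \<in> \<Union>\<C>" for c x
        using that gsubD(6)[OF sub] by blast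
      show "gact V g x \<in> \<Union>\<C>" if "g \<in> G" "x \<in> \<Union>\<C>" for g x
        using that gsubD(7)[OF sub] by blast
    qed
    then show ?thesis using ne triv by (fastforce simp: \<A>_def)
  qed
  obtain W where W: "W \<in> \<A>" and max: "\<And>Z. Z \<in> \<A> \<Longrightarrow> W \<subseteq> Z \<Longrightarrow> Z = W"
    using subset_Zorn_nonempty[of \<A>] zero chain by blast
  then have gW: "gsub G complex_field W V" and NW: "N \<inter> W = {\<zero>\<^bsub>V\<^esub>}" by (auto simp: \<A>_def)
  define T where "T = msum V N W"
  have T: "gsub G complex_field T V" unfolding T_def by (rule gsub_msum[OF V N gW])
  have upper: "N \<subseteq> T" "W \<subseteq> T" unfolding T_def using msum_upper[OF V N gW] by auto
  have "f ` carrier (irrep_of \<rho>) \<subseteq> T" if \<rho>: "\<rho> \<in> Irr G" and f: "f \<in> gHom G (irrep_of \<rho>) V" for \<rho> f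
  proof (rule ccontr)
    assume not: "\<not> f ` carrier (irrep_of \<rho>) \<subseteq> T"
    define U where "U = irrep_of \<rho>"
    have U: "gmod G complex_field U" "irreducible_gmodule G U"
      using irrep_gmod[OF \<rho>] irreducible_irrep_of[OF \<rho>] by (auto simp: U_def)
    have fh: "f \<in> ghom G complex_field U V" using f by (simp add: gHom_eq U_def)
    note fim = gsub_image[OF U(1) V fh gsub_carrier[OF U(1)]]
    have "gsub G complex_field {u \<in> carrier U. f u \<in> T} U" by (rule gsub_vimage[OF U(1) V fh T])
    then have "{u \<in> carrier U. f u \<in> T} = {\<zero>\<^bsub>U\<^esub>}"
      using U(2) not unfolding irreducible_gmodule_def gsub_def U_def[symmetric] by blast
    then have K: "u = \<zero>\<^bsub>U\<^esub>" if "u \<in> carrier U" "f u \<in> T" for u using that by blast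
    define Z where "Z = msum V W (f ` carrier U)"
    have Z: "gsub G complex_field Z V" unfolding Z_def by (rule gsub_msum[OF V gW fim])
    note Zup = msum_upper[OF V gW fim, folded Z_def]
    have "x = \<zero>\<^bsub>V\<^esub>" if x: "x \<in> N" "x \<in> Z" for x
    proof -
      obtain w u where wu: "w \<in> W" "u \<in> carrier U" "x = w \<oplus>\<^bsub>V\<^esub> f u"
        using x(2) by (auto simp: Z_def msum_def)
      have c: "w \<in> carrier V" "f u \<in> carrier V" "x \<in> carrier V" using wu gsubD(4)[OF gW] ghomD(1)[OF fh] gsubD(4)[OF N] x by auto
      \<comment> \<open>Thus f u is a difference of elements of N and W and lies in T, where f sends
        only u = 0.\<close>
      have "f u = x \<ominus>\<^bsub>V\<^esub> w" using c V.M.a_comm[of w "f u"] by (simp add: wu(3) a_minus_def V.M.a_assoc V.M.r_neg)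
      then have "f u \<in> T" using submodule_minus(2)[OF gsubD(1)[OF T]] upper x(1) wu(1) by auto
      then have "u = \<zero>\<^bsub>U\<^esub>" using K wu(2) by blast
      then have "f u = \<zero>\<^bsub>V\<^esub>" using ghom_zero[OF U(1) V fh] by simp
      then have "x = w" using wu(3) c by simp
      then show ?thesis using NW x(1) wu(1) by blast
    qed
    then have "N \<inter> Z \<subseteq> {\<zero>\<^bsub>V\<^esub>}" by blast
    then have "N \<inter> Z = {\<zero>\<^bsub>V\<^esub>}" using gsubD(3)[OF Z] gsubD(3)[OF N] by blast
    then have "Z \<in> \<A>" using Z by (simp add: \<A>_def)
    then have "Z = W" using max Zup(1) by blast
    then show False using Zup(2) upper(2) not by (auto simp: U_def)
  qed
  then have "gens G (Irr G) V \<subseteq> T" by (auto simp: gens_def)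
  then have "carrier V \<subseteq> T" using isotypic_span_subset_iff[OF gsubD(1)[OF T]] span by blast
  then show thesis using that[OF gW NW] gsubD(2)[OF T] by (auto simp: T_def)
qed

text \<open>On an invariant complement C of its kernel, f is bijective, and s is the inverse. Each
  homomorphism law of s is checked after applying f, which is injective on C.\<close>

lemma ghom_section:
  assumes V: "gmod G complex_field V" and W: "gmod G complex_field W"
    and span: "LinearCombinations.module.span complex_field V (\<Union>\<rho>\<in>Irr G. isotypic G V \<rho>) = carrier V"
    and f: "f \<in> ghom G complex_field V W" and surj: "f ` carrier V = carrier W"
  obtains s where "s \<in> ghom G complex_field W V" "\<And>w. w \<in> carrier W \<Longrightarrow> f (s w) = w"
proof -
  interpret V: Module.module complex_field V using V by (simp add: gmod_def)
  interpret W: Module.module complex_field W using W by (simp add: gmod_def)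
  note fD = ghomD[OF f]
  define N where "N = {x \<in> carrier V. f x \<in> {\<zero>\<^bsub>W\<^esub>}}"
  have N: "gsub G complex_field N V" unfolding N_def by (rule gsub_vimage[OF V W f gsub_zero[OF W]])
  obtain C where C: "gsub G complex_field C V" "N \<inter> C = {\<zero>\<^bsub>V\<^esub>}" "msum V N C = carrier V"
    using invariant_complement[OF V span N] by blast
  note cD = gsubD[OF C(1)]
  have inj: "x = y" if "x \<in> C" "y \<in> C" "f x = f y" for x y
  proof -
    have "f (x \<ominus>\<^bsub>V\<^esub> y) = f x \<ominus>\<^bsub>W\<^esub> f y" using ghom_minus[OF V W f] cD(4) that by simp
    also have "\<dots> = \<zero>\<^bsub>W\<^esub>" using that cD(4) fD(1) by (simp add: a_minus_def W.M.r_neg)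
    finally have "x \<ominus>\<^bsub>V\<^esub> y \<in> N \<inter> C"
      using that cD(4) submodule_minus(2)[OF cD(1)] by (auto simp: N_def)
    then have "x \<ominus>\<^bsub>V\<^esub> y = \<zero>\<^bsub>V\<^esub>" using C(2) by blast
    then show ?thesis using that cD(4) by simp
  qed
  have ex: "\<exists>c\<in>C. f c = w" if w: "w \<in> carrier W" for w
  proof -
    obtain v where v: "v \<in> carrier V" "f v = w" using w unfolding surj[symmetric] by blast
    obtain n c where nc: "n \<in> N" "c \<in> C" "v = n \<oplus>\<^bsub>V\<^esub> c" using v(1) unfolding C(3)[symmetric] by (auto simp: msum_def)
    then have "f v = f n \<oplus>\<^bsub>W\<^esub> f c" "f n = \<zero>\<^bsub>W\<^esub>" "f c \<in> carrier W" using fD cD(4) by (auto simp: N_def)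
    then show ?thesis using v nc by (intro bexI[of _ c]) auto
  qed
  define s where "s w = (SOME c. c \<in> C \<and> f c = w)" for w
  have s: "s w \<in> C" "f (s w) = w" if "w \<in> carrier W" for w
    using someI_ex[of "\<lambda>c. c \<in> C \<and> f c = w"] ex[OF that] by (auto simp: s_def)
  have "s \<in> ghom G complex_field W V"
  proof (rule ghomI)
    fix x y g c assume x: "x \<in> carrier W"
    show "s x \<in> carrier V" using s x cD by auto
    show "s (x \<oplus>\<^bsub>W\<^esub> y) = s x \<oplus>\<^bsub>V\<^esub> s y" if "y \<in> carrier W"
      using s x that cD fD by (intro inj) auto
    show "s (c \<odot>\<^bsub>W\<^esub> x) = c \<odot>\<^bsub>V\<^esub> s x" if "c \<in> carrier complex_field"
      using s x that cD fD by (intro inj) auto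
    show "s (gact W g x) = gact V g (s x)" if "g \<in> G"
      using s x that cD fD gmodD[OF W] by (intro inj) auto
  qed
  with s show thesis using that by blast
qed

section \<open>Multiplicities\<close>

text \<open>Scalar multiples of an equivariant map are equivariant because the action on V commutes
  with scalars; hence V is rational and not merely a \<open>gmod\<close>.\<close>

lemma gHom_space_vectorspace:
  assumes U: "gmod G complex_field U" and V: "rational_gmodule G V"
  shows "vectorspace complex_field (gHom_space G U V)"
proof -
  interpret U: Module.module complex_field U using U by (simp add: gmod_def)
  note gV = rational_gmod[OF V]
  interpret V: Module.module complex_field V using gV by (simp add: gmod_def)
  interpret C: field complex_field by (rule field_complex_field)
  have Vsmult: "gact V g (c \<odot>\<^bsub>V\<^esub> x) = c \<odot>\<^bsub>V\<^esub> gact V g x"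
    if "g \<in> G" "x \<in> carrier V" "c \<in> carrier complex_field" for g x c
    using V that by (auto simp: rational_gmodule_def LinearCombinations.module_hom_def)
  have commute: "c \<odot>\<^bsub>V\<^esub> (c' \<odot>\<^bsub>V\<^esub> x) = c' \<odot>\<^bsub>V\<^esub> (c \<odot>\<^bsub>V\<^esub> x)"
    if "c \<in> carrier complex_field" "c' \<in> carrier complex_field" "x \<in> carrier V" for c c' x
  proof -
    have "c \<otimes>\<^bsub>complex_field\<^esub> c' = c' \<otimes>\<^bsub>complex_field\<^esub> c" by (simp add: complex_field_def)
    then show ?thesis using that by (metis V.smult_assoc1)
  qed
  have add: "(\<lambda>u\<in>carrier U. f u \<oplus>\<^bsub>V\<^esub> f' u) \<in> gHom G U V"
    if f: "f \<in> ghom G complex_field U V" "f' \<in> ghom G complex_field U V" for f f'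
    using ghomD[OF f(1)] ghomD[OF f(2)] gmodD[OF gV] V.smult_r_distr V.M.a_ac
    by (intro restrict_ghom[OF U] ghomI) simp_all
  have smult: "(\<lambda>u\<in>carrier U. c \<odot>\<^bsub>V\<^esub> f u) \<in> gHom G U V"
    if c: "c \<in> carrier complex_field" and f: "f \<in> ghom G complex_field U V" for c f
    using ghomD[OF f] c Vsmult V.smult_r_distr commute[OF c]
    by (intro restrict_ghom[OF U] ghomI) simp_all
  have zero: "(\<lambda>u\<in>carrier U. \<zero>\<^bsub>V\<^esub>) \<in> gHom G U V"
    using gmod_gact_zero[OF gV] by (intro restrict_ghom[OF U] ghomI) simp_all
  have H: "f \<in> ghom G complex_field U V \<and> f \<in> extensional (carrier U)" if "f \<in> gHom G U V" for f
    using that by (simp add: gHom_eq)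
  have "Module.module complex_field (gHom_space G U V)"
  proof (rule module_criteria; (intro allI ballI impI; (elim conjE)?)?)
    show "cring complex_field" using field_complex_field by (simp add: field_def domain_def)
    show "\<zero>\<^bsub>gHom_space G U V\<^esub> \<in> carrier (gHom_space G U V)" using zero by (simp add: gHom_space_def)
    fix f assume "f \<in> carrier (gHom_space G U V)"
    then have f: "f \<in> ghom G complex_field U V" "f \<in> extensional (carrier U)" by (auto simp: gHom_space_def fun_eq_iff restrict_def gHom_eq)
    note fD = ghomD[OF f(1)]
    show "f \<oplus>\<^bsub>gHom_space G U V\<^esub> \<zero>\<^bsub>gHom_space G U V\<^esub> = f"
      using fD f(2) by (intro extensionalityI[of _ "carrier U"]) (auto simp: gHom_space_def)
    show "\<one>\<^bsub>complex_field\<^esub> \<odot>\<^bsub>gHom_space G U V\<^esub> f = f"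
      using fD f(2) by (intro extensionalityI[of _ "carrier U"]) (auto simp: gHom_space_def)
    have m1: "\<ominus>\<^bsub>complex_field\<^esub> \<one>\<^bsub>complex_field\<^esub> \<in> carrier complex_field" by simp
    show "\<exists>w\<in>carrier (gHom_space G U V). f \<oplus>\<^bsub>gHom_space G U V\<^esub> w = \<zero>\<^bsub>gHom_space G U V\<^esub>"
    proof (rule bexI)
      show "(\<lambda>u\<in>carrier U. (\<ominus>\<^bsub>complex_field\<^esub> \<one>\<^bsub>complex_field\<^esub>) \<odot>\<^bsub>V\<^esub> f u) \<in> carrier (gHom_space G U V)"
        using smult[OF m1 f(1)] by (simp add: gHom_space_def)
      show "f \<oplus>\<^bsub>gHom_space G U V\<^esub> (\<lambda>u\<in>carrier U. (\<ominus>\<^bsub>complex_field\<^esub> \<one>\<^bsub>complex_field\<^esub>) \<odot>\<^bsub>V\<^esub> f u)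
          = \<zero>\<^bsub>gHom_space G U V\<^esub>"
        using fD by (intro extensionalityI[of _ "carrier U"]) (auto simp: gHom_space_def V.smult_minus_1 V.M.r_neg)
    qed
    fix c assume c: "c \<in> carrier complex_field"
    show "c \<odot>\<^bsub>gHom_space G U V\<^esub> f \<in> carrier (gHom_space G U V)"
      using smult[OF c f(1)] by (simp add: gHom_space_def)
    fix c' assume c': "c' \<in> carrier complex_field"
    show "(c \<otimes>\<^bsub>complex_field\<^esub> c') \<odot>\<^bsub>gHom_space G U V\<^esub> f = c \<odot>\<^bsub>gHom_space G U V\<^esub> (c' \<odot>\<^bsub>gHom_space G U V\<^esub> f)"
      using fD c c' by (auto simp: gHom_space_def fun_eq_iff restrict_def V.smult_assoc1)
    show "(c \<oplus>\<^bsub>complex_field\<^esub> c') \<odot>\<^bsub>gHom_space G U V\<^esub> f =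
        c \<odot>\<^bsub>gHom_space G U V\<^esub> f \<oplus>\<^bsub>gHom_space G U V\<^esub> c' \<odot>\<^bsub>gHom_space G U V\<^esub> f"
      using fD c c' by (auto simp: gHom_space_def fun_eq_iff restrict_def V.smult_l_distr)
  next
    fix f f' assume "f \<in> carrier (gHom_space G U V)" "f' \<in> carrier (gHom_space G U V)"
    then have f: "f \<in> ghom G complex_field U V" "f' \<in> ghom G complex_field U V" by (auto simp: gHom_space_def fun_eq_iff restrict_def gHom_eq)
    note fD = ghomD[OF f(1)] ghomD[OF f(2)]
    show "f \<oplus>\<^bsub>gHom_space G U V\<^esub> f' \<in> carrier (gHom_space G U V)" using add[OF f] by (simp add: gHom_space_def)
    show "f \<oplus>\<^bsub>gHom_space G U V\<^esub> f' = f' \<oplus>\<^bsub>gHom_space G U V\<^esub> f"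
      using fD by (auto simp: gHom_space_def fun_eq_iff restrict_def V.M.a_comm)
    show "c \<odot>\<^bsub>gHom_space G U V\<^esub> (f \<oplus>\<^bsub>gHom_space G U V\<^esub> f') =
        c \<odot>\<^bsub>gHom_space G U V\<^esub> f \<oplus>\<^bsub>gHom_space G U V\<^esub> c \<odot>\<^bsub>gHom_space G U V\<^esub> f'"
      if "c \<in> carrier complex_field" for c
      using fD that by (auto simp: gHom_space_def fun_eq_iff restrict_def V.smult_r_distr)
    fix f'' assume "f'' \<in> carrier (gHom_space G U V)"
    then have "f'' \<in> ghom G complex_field U V" by (simp add: gHom_space_def gHom_eq)
    note this[THEN ghomD(1)]
    with fD show "(f \<oplus>\<^bsub>gHom_space G U V\<^esub> f') \<oplus>\<^bsub>gHom_space G U V\<^esub> f'' =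
        f \<oplus>\<^bsub>gHom_space G U V\<^esub> (f' \<oplus>\<^bsub>gHom_space G U V\<^esub> f'')"
      using fD by (auto simp: gHom_space_def fun_eq_iff restrict_def V.M.a_assoc)
  qed
  then show ?thesis by (simp add: vectorspace_def field_complex_field)
qed

text \<open>The class of complex G-modules in which multiplicities are additive; it is closed under
  quotients and invariant subspaces.\<close>

definition admissible :: "(complex^'n^'n) set \<Rightarrow> (complex, 'b, 'n) gmodule \<Rightarrow> bool" where
  "admissible G V \<longleftrightarrow> rational_gmodule G V \<and> finite_multiplicities G V"

lemma admissible_gmod: "admissible G V \<Longrightarrow> gmod G complex_field V"
  by (auto simp: admissible_def intro: rational_gmod)

lemma mult_space_vectorspace:
  "\<rho> \<in> Irr G \<Longrightarrow> rational_gmodule G V \<Longrightarrow> vectorspace complex_field (mult_space G V \<rho>)"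
  by (intro gHom_space_vectorspace irrep_gmod)

lemma mult_space_restrict:
  "mult_space G (V\<lparr>carrier := N\<rparr>) \<rho> =
     (mult_space G V \<rho>)\<lparr>carrier := gHom G (irrep_of \<rho>) (V\<lparr>carrier := N\<rparr>)\<rparr>"
  by (simp add: gHom_space_def)

lemma gHom_restrict_iff:
  assumes "N \<subseteq> carrier V"
  shows "f \<in> gHom G U (V\<lparr>carrier := N\<rparr>) \<longleftrightarrow> f \<in> gHom G U V \<and> f ` carrier U \<subseteq> N"
  using assms by (fastforce simp: gHom_def LinearCombinations.module_hom_def Pi_def)

lemma gens_image:
  assumes D: "D \<subseteq> Irr G" and f: "f \<in> ghom G complex_field V W"
  shows "f ` gens G D V \<subseteq> gens G D W"
proof
  fix y assume "y \<in> f ` gens G D V"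
  then obtain \<rho> e u where e: "\<rho> \<in> D" "e \<in> gHom G (irrep_of \<rho>) V" "u \<in> carrier (irrep_of \<rho>)" "y = f (e u)"
    by (auto simp: gens_def)
  have eh: "e \<in> ghom G complex_field (irrep_of \<rho>) V" using e(2) by (simp add: gHom_eq)
  have \<rho>: "\<rho> \<in> Irr G" using D e(1) by blast
  define q where "q = restrict (\<lambda>u. f (e u)) (carrier (irrep_of \<rho>))"
  have "q \<in> gHom G (irrep_of \<rho>) W"
    unfolding q_def by (rule restrict_ghom[OF irrep_gmod[OF \<rho>] ghom_comp[OF eh f]])
  then have "q u \<in> gens G D W" unfolding gens_def using e(1,3) by blast
  then show "y \<in> gens G D W" using e(3,4) by (simp add: q_def)
qed

text \<open>Composition with f is a linear map from Hom(U, V) to Hom(U, W). A section of f makes it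
  onto, its kernel consists of the maps into N, and rank-nullity gives additivity.\<close>

lemma admissible_image:
  assumes G: "linear_algebraic_group G" and V: "admissible G V" and f: "f \<in> ghom G complex_field V W"
    and surj: "f ` carrier V = carrier W" and zero: "f \<zero>\<^bsub>V\<^esub> = \<zero>\<^bsub>W\<^esub>"
    and ker: "{x \<in> carrier V. f x = \<zero>\<^bsub>W\<^esub>} = N"
  shows "admissible G W"
    and "\<rho> \<in> Irr G \<Longrightarrow> mult_dim G V \<rho> = mult_dim G (V\<lparr>carrier := N\<rparr>) \<rho> + mult_dim G W \<rho>"
proof -
  have rV: "rational_gmodule G V" using V by (simp add: admissible_def)
  have rW: "rational_gmodule G W" by (rule rational_image[OF G rV f surj zero])
  note gV = rational_gmod[OF rV] and gW = rational_gmod[OF rW]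
  interpret V: Module.module complex_field V using gV by (simp add: gmod_def)
  interpret W: Module.module complex_field W using gW by (simp add: gmod_def)
  have span: "V.span (\<Union>\<rho>\<in>Irr G. isotypic G V \<rho>) = carrier V"
    using V by (simp add: admissible_def finite_multiplicities_def)
  obtain s where s: "s \<in> ghom G complex_field W V" "\<And>w. w \<in> carrier W \<Longrightarrow> f (s w) = w"
    using ghom_section[OF gV gW span f surj] by blast
  have spanW: "W.span (\<Union>\<rho>\<in>Irr G. isotypic G W \<rho>) = carrier W"
  proof (rule antisym)
    note sub = gsub_carrier[OF gW]
    show "W.span (\<Union>\<rho>\<in>Irr G. isotypic G W \<rho>) \<subseteq> carrier W"
      unfolding isotypic_span_subset_iff[OF gsubD(1)[OF sub]] by (rule gens_subset)
    have iso: "(\<Union>\<rho>\<in>Irr G. isotypic G W \<rho>) \<subseteq> carrier W"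
      unfolding isotypic_def by (intro UN_least W.span_is_subset2) (auto simp: gHom_eq dest: ghomD)
    define T where "T = W.span (\<Union>\<rho>\<in>Irr G. isotypic G W \<rho>)"
    have T: "LinearCombinations.submodule complex_field T W"
      unfolding T_def by (rule W.span_is_submodule[OF iso])
    have gT: "gens G (Irr G) W \<subseteq> T" using isotypic_span_subset_iff[OF T, where G = G and D = "Irr G"] by (simp add: T_def)
    \<comment> \<open>The preimage of T in V is a subspace containing all generators of V, so it is
      V, and surjectivity of f gives T = W.\<close>
    have Z: "LinearCombinations.submodule complex_field {x \<in> carrier V. f x \<in> T} V"
      using T V.module_axioms ghomD[OF f] zero by (auto simp: LinearCombinations.submodule_def)
    have "gens G (Irr G) V \<subseteq> {x \<in> carrier V. f x \<in> T}"
      using gens_image[OF subset_refl f] gT gens_subset[of G "Irr G" V] by blast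
    then have "carrier V \<subseteq> {x \<in> carrier V. f x \<in> T}"
      using isotypic_span_subset_iff[OF Z] span by blast
    then show "carrier W \<subseteq> W.span (\<Union>\<rho>\<in>Irr G. isotypic G W \<rho>)"
      unfolding surj[symmetric] T_def[symmetric] by blast
  qed
  have main: "vectorspace.fin_dim complex_field (mult_space G W \<rho>) \<and>
      mult_dim G V \<rho> = mult_dim G (V\<lparr>carrier := N\<rparr>) \<rho> + mult_dim G W \<rho>" if \<rho>: "\<rho> \<in> Irr G" for \<rho>
  proof -
    define U where "U = irrep_of \<rho>"
    have U: "gmod G complex_field U" unfolding U_def by (rule irrep_gmod[OF \<rho>])
    define T where "T e = restrict (\<lambda>u. f (e u)) (carrier U)" for e
    interpret HV: vectorspace complex_field "gHom_space G U V" by (rule gHom_space_vectorspace[OF U rV])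
    interpret HW: vectorspace complex_field "gHom_space G U W" by (rule gHom_space_vectorspace[OF U rW])
    interpret U: Module.module complex_field U using U by (simp add: gmod_def)
    have T_in: "T e \<in> gHom G U W" if "e \<in> gHom G U V" for e
      unfolding T_def by (rule restrict_ghom[OF U ghom_comp[OF _ f]]) (use that in \<open>simp add: gHom_eq\<close>)
    have val: "e u \<in> carrier V" if "e \<in> gHom G U V" "u \<in> carrier U" for e u
      using that by (auto simp: gHom_eq dest: ghomD)
    have "T \<in> LinearCombinations.module_hom complex_field (gHom_space G U V) (gHom_space G U W)"
      using T_in ghomD[OF f] val
      by (auto simp: LinearCombinations.module_hom_def gHom_space_def T_def fun_eq_iff)
    then interpret T: linear_map complex_field "gHom_space G U V" "gHom_space G U W" T
      by (simp add: linear_map_def mod_hom_def mod_hom_axioms_def HV.vectorspace_axioms HW.vectorspace_axioms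
          HV.module_axioms HW.module_axioms)
    have fd: "HV.fin_dim" using V \<rho> by (simp add: admissible_def finite_multiplicities_def U_def)
    have onto: "T ` carrier (gHom_space G U V) = carrier (gHom_space G U W)"
    proof (intro antisym subsetI)
      fix e assume "e \<in> carrier (gHom_space G U W)"
      then have e: "e \<in> ghom G complex_field U W" "e \<in> extensional (carrier U)" by (auto simp: gHom_space_def gHom_eq)
      define e' where "e' = restrict (\<lambda>u. s (e u)) (carrier U)"
      have "e' \<in> gHom G U V" unfolding e'_def by (rule restrict_ghom[OF U ghom_comp[OF e(1) s(1)]])
      moreover have "T e' = e"
        using e s(2) ghomD(1)[OF e(1)] by (intro extensionalityI[of _ "carrier U"]) (auto simp: T_def e'_def)
      ultimately show "e \<in> T ` carrier (gHom_space G U V)" by (auto simp: gHom_space_def)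
    qed (use T_in in \<open>auto simp: gHom_space_def\<close>)
    have kerT: "T.ker = gHom G U (V\<lparr>carrier := N\<rparr>)"
    proof -
      have sub: "N \<subseteq> carrier V" using ker by auto
      have "T e = (\<lambda>u\<in>carrier U. \<zero>\<^bsub>W\<^esub>) \<longleftrightarrow> e ` carrier U \<subseteq> N" if "e \<in> gHom G U V" for e
      proof -
        have "e u \<in> carrier V" if "u \<in> carrier U" for u using \<open>e \<in> _\<close> that by (auto simp: gHom_eq dest: ghomD)
        moreover have "T e = (\<lambda>u\<in>carrier U. \<zero>\<^bsub>W\<^esub>) \<longleftrightarrow> (\<forall>u\<in>carrier U. f (e u) = \<zero>\<^bsub>W\<^esub>)"
          by (auto simp: T_def restrict_def fun_eq_iff)
        ultimately show ?thesis unfolding ker[symmetric] by blast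
      qed
      then show ?thesis
        unfolding T.ker_def by (auto simp: gHom_restrict_iff[OF sub] gHom_space_def)
    qed
    have imT: "T.im = carrier (gHom_space G U W)" using onto by (simp add: T.im_def)
    have "HW.fin_dim" by (rule T.rank_nullity_main(2)[OF fd onto])
    moreover have "vectorspace.dim complex_field (gHom_space G U W) +
        vectorspace.dim complex_field (gHom_space G U (V\<lparr>carrier := N\<rparr>)) = HV.dim"
      using T.rank_nullity[OF fd] unfolding imT kerT by (simp add: gHom_space_def)
    ultimately show ?thesis by (simp add: mult_dim_def U_def)
  qed
  show "admissible G W" using rW spanW main by (simp add: admissible_def finite_multiplicities_def)
  show "mult_dim G V \<rho> = mult_dim G (V\<lparr>carrier := N\<rparr>) \<rho> + mult_dim G W \<rho>" if "\<rho> \<in> Irr G"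
    using main[OF that] by blast
qed

lemma admissible_quotient:
  assumes G: "linear_algebraic_group G" and V: "admissible G V" and N: "gsub G complex_field N V"
  shows "admissible G (quotient_gmodule V N)"
    and "\<rho> \<in> Irr G \<Longrightarrow> mult_dim G V \<rho> = mult_dim G (V\<lparr>carrier := N\<rparr>) \<rho> + mult_dim G (quotient_gmodule V N) \<rho>"
  using admissible_image[OF G V coset_map[OF admissible_gmod[OF V] N]] by auto

text \<open>The vectors \<open>w\<^sub>i\<close> that witness rationality of \<open>V\<close> at a point of \<open>N\<close> need not lie in \<open>N\<close>.
  An equivariant retraction of \<open>V\<close> onto \<open>N\<close> moves them there.\<close>

lemma admissible_gsub:
  assumes G: "linear_algebraic_group G" and V: "admissible G V" and N: "gsub G complex_field N V"
  shows "admissible G (V\<lparr>carrier := N\<rparr>)"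
proof -
  define W where "W = quotient_gmodule V N"
  define f where "f = (\<lambda>x. N +>\<^bsub>V\<^esub> x)"
  note gV = admissible_gmod[OF V]
  note f = coset_map[OF gV N, folded W_def, folded f_def]
  have gW: "gmod G complex_field W" by (rule image_gmod[OF gV f(1-3)])
  interpret V: Module.module complex_field V using gV by (simp add: gmod_def)
  interpret W: Module.module complex_field W using gW by (simp add: gmod_def)
  have "V.span (\<Union>\<rho>\<in>Irr G. isotypic G V \<rho>) = carrier V"
    using V by (simp add: admissible_def finite_multiplicities_def)
  then obtain s where s: "s \<in> ghom G complex_field W V" "\<And>w. w \<in> carrier W \<Longrightarrow> f (s w) = w"
    using ghom_section[OF gV gW _ f(1,2)] by blast
  note fD = ghomD[OF f(1)] and sD = ghomD[OF s(1)]
  \<comment> \<open>The projection onto N along the image of s: \<open>f (s y) = y\<close> puts its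
    values into the kernel N, and s 0 = 0 makes it the identity on N.\<close>
  define p where "p x = x \<ominus>\<^bsub>V\<^esub> s (f x)" for x
  have act_minus: "gact V g (x \<ominus>\<^bsub>V\<^esub> y) = gact V g x \<ominus>\<^bsub>V\<^esub> gact V g y"
    if "g \<in> G" "x \<in> carrier V" "y \<in> carrier V" for g x y
  proof -
    have "gact V g \<in> LinearCombinations.module_hom complex_field V V"
      using V that(1) by (simp add: admissible_def rational_gmodule_def)
    then interpret h: mod_hom complex_field V V "gact V g"
      by (simp add: mod_hom_def mod_hom_axioms_def V.module_axioms)
    show ?thesis using that by simp
  qed
  have pN: "p x \<in> N" if x: "x \<in> carrier V" for x
  proof -
    have "f (p x) = f x \<ominus>\<^bsub>W\<^esub> f x"
      unfolding p_def using ghom_minus[OF gV gW f(1)] x sD(1) fD(1) s(2) by simp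
    also have "\<dots> = \<zero>\<^bsub>W\<^esub>" using x fD(1) by (simp add: a_minus_def W.M.r_neg)
    finally have "p x \<in> {x \<in> carrier V. f x = \<zero>\<^bsub>W\<^esub>}" using x fD(1) sD(1) by (simp add: p_def)
    then show ?thesis unfolding f(4) .
  qed
  have pid: "p x = x" if x: "x \<in> N" for x
  proof -
    have "x \<in> carrier V" "f x = \<zero>\<^bsub>W\<^esub>" using x unfolding f(4)[symmetric] by auto
    then show ?thesis using ghom_zero[OF gW gV s(1)] by (simp add: p_def a_minus_def)
  qed
  have "p \<in> ghom G complex_field V (V\<lparr>carrier := N\<rparr>)"
  proof (rule ghomI)
    fix x y g c assume x: "x \<in> carrier V"
    show "p x \<in> carrier (V\<lparr>carrier := N\<rparr>)" using pN[OF x] by simp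
    show "p (x \<oplus>\<^bsub>V\<^esub> y) = p x \<oplus>\<^bsub>V\<lparr>carrier := N\<rparr>\<^esub> p y" if "y \<in> carrier V"
      using x that fD sD by (simp add: p_def a_minus_def V.M.minus_add V.M.a_ac)
    show "p (c \<odot>\<^bsub>V\<^esub> x) = c \<odot>\<^bsub>V\<lparr>carrier := N\<rparr>\<^esub> p x" if "c \<in> carrier complex_field"
      using x that fD sD by (simp add: p_def a_minus_def V.smult_r_distr V.smult_r_minus)
    show "p (gact V g x) = gact (V\<lparr>carrier := N\<rparr>) g (p x)" if "g \<in> G"
      using x that fD sD act_minus gmodD(2)[OF gV] by (simp add: p_def)
  qed
  moreover have "p ` carrier V = carrier (V\<lparr>carrier := N\<rparr>)"
    using pN pid gsubD(4)[OF N] by force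
  moreover have "p \<zero>\<^bsub>V\<^esub> = \<zero>\<^bsub>V\<lparr>carrier := N\<rparr>\<^esub>" using pid[OF gsubD(3)[OF N]] by simp
  ultimately show ?thesis using admissible_image(1)[OF G V _ _ _ refl, of p] by blast
qed

lemma ghom_restrict:
  assumes "f \<in> ghom G R M N" "B \<subseteq> carrier M"
  shows "f \<in> ghom G R (M\<lparr>carrier := B\<rparr>) N"
  using ghomD[OF assms(1)] subsetD[OF assms(2)] by (intro ghomI) simp_all

text \<open>A section of f carries the generators of W into those of V. This is the converse of
  \<open>gens_image\<close> and rests on complete reducibility.\<close>

lemma gens_lift:
  assumes D: "D \<subseteq> Irr G" and V: "admissible G V" and W: "gmod G complex_field W"
    and f: "f \<in> ghom G complex_field V W" and surj: "f ` carrier V = carrier W"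
  shows "gens G D W \<subseteq> f ` gens G D V"
proof -
  have "LinearCombinations.module.span complex_field V (\<Union>\<rho>\<in>Irr G. isotypic G V \<rho>) = carrier V"
    using V by (simp add: admissible_def finite_multiplicities_def)
  then obtain s where s: "s \<in> ghom G complex_field W V" "\<And>w. w \<in> carrier W \<Longrightarrow> f (s w) = w"
    using ghom_section[OF admissible_gmod[OF V] W _ f surj] by blast
  show ?thesis
  proof
    fix w assume w: "w \<in> gens G D W"
    then have "s w \<in> gens G D V" using gens_image[OF D s(1)] by blast
    moreover have "w = f (s w)" using s(2)[OF subsetD[OF gens_subset w]] by simp
    ultimately show "w \<in> f ` gens G D V" by (rule rev_image_eqI)
  qed
qed

section \<open>Multiplicities of invariant subspaces\<close>

lemma (in vectorspace) dim_0_carrier: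
  assumes "fin_dim" "dim = 0"
  shows "carrier V = {\<zero>\<^bsub>V\<^esub>}"
proof -
  obtain B where B: "finite B" "basis B" using finite_basis_exists[OF assms(1)] by blast
  then have "B = {}" using dim_basis assms(2) by auto
  then have "carrier V = span {}" using B by (simp add: basis_def)
  then show ?thesis using span_empty by simp
qed

text \<open>The two multiplicities differ by that of the quotient. If it vanishes, every
  homomorphism into V becomes zero in V/N and so takes values in N.\<close>

lemma mult_dim_gsub:
  assumes G: "linear_algebraic_group G" and V: "admissible G V" and N: "gsub G complex_field N V"
    and \<rho>: "\<rho> \<in> Irr G"
  shows "mult_dim G (V\<lparr>carrier := N\<rparr>) \<rho> \<le> mult_dim G V \<rho>"
    and "mult_dim G (V\<lparr>carrier := N\<rparr>) \<rho> = mult_dim G V \<rho> \<Longrightarrow>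
      gHom G (irrep_of \<rho>) (V\<lparr>carrier := N\<rparr>) = gHom G (irrep_of \<rho>) V"
proof -
  define Q where "Q = quotient_gmodule V N"
  define \<pi> where "\<pi> = (\<lambda>x. N +>\<^bsub>V\<^esub> x)"
  note \<pi> = coset_map[OF admissible_gmod[OF V] N, folded Q_def, folded \<pi>_def]
  note Q = admissible_quotient[OF G V N, folded Q_def]
  show "mult_dim G (V\<lparr>carrier := N\<rparr>) \<rho> \<le> mult_dim G V \<rho>" using Q(2)[OF \<rho>] by simp
  assume "mult_dim G (V\<lparr>carrier := N\<rparr>) \<rho> = mult_dim G V \<rho>"
  then have 0: "mult_dim G Q \<rho> = 0" using Q(2)[OF \<rho>] by simp
  interpret H: vectorspace complex_field "mult_space G Q \<rho>"
    using Q(1) \<rho> by (intro mult_space_vectorspace) (simp_all add: admissible_def)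
  have "H.fin_dim" using Q(1) \<rho> by (simp add: admissible_def finite_multiplicities_def)
  then have H0: "gHom G (irrep_of \<rho>) Q = {\<lambda>u\<in>carrier (irrep_of \<rho>). \<zero>\<^bsub>Q\<^esub>}"
    using H.dim_0_carrier 0 by (simp add: mult_dim_def gHom_space_def)
  have "f ` carrier (irrep_of \<rho>) \<subseteq> N" if f: "f \<in> gHom G (irrep_of \<rho>) V" for f
  proof
    fix x assume "x \<in> f ` carrier (irrep_of \<rho>)"
    then obtain u where u: "u \<in> carrier (irrep_of \<rho>)" "x = f u" by blast
    have fh: "f \<in> ghom G complex_field (irrep_of \<rho>) V" using f by (simp add: gHom_eq)
    have "restrict (\<lambda>u. \<pi> (f u)) (carrier (irrep_of \<rho>)) \<in> gHom G (irrep_of \<rho>) Q"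
      by (rule restrict_ghom[OF irrep_gmod[OF \<rho>] ghom_comp[OF fh \<pi>(1)]])
    then have "restrict (\<lambda>u. \<pi> (f u)) (carrier (irrep_of \<rho>)) = (\<lambda>u\<in>carrier (irrep_of \<rho>). \<zero>\<^bsub>Q\<^esub>)"
      unfolding H0 by simp
    from fun_cong[OF this, of u] have "\<pi> x = \<zero>\<^bsub>Q\<^esub>" using u by simp
    then show "x \<in> N" using u ghomD(1)[OF fh] unfolding \<pi>(4)[symmetric] by simp
  qed
  then show "gHom G (irrep_of \<rho>) (V\<lparr>carrier := N\<rparr>) = gHom G (irrep_of \<rho>) V"
    using gHom_restrict_iff[OF gsubD(2)[OF N]] by blast
qed

text \<open>Additivity applied to the identity map, whose kernel is zero.\<close>

lemma mult_dim_zero: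
  assumes G: "linear_algebraic_group G" and V: "admissible G V" and \<rho>: "\<rho> \<in> Irr G"
  shows "mult_dim G (V\<lparr>carrier := {\<zero>\<^bsub>V\<^esub>}\<rparr>) \<rho> = 0"
proof -
  interpret V: Module.module complex_field V using admissible_gmod[OF V] by (simp add: gmod_def)
  have "{x \<in> carrier V. x = \<zero>\<^bsub>V\<^esub>} = {\<zero>\<^bsub>V\<^esub>}" by auto
  then have "mult_dim G V \<rho> = mult_dim G (V\<lparr>carrier := {\<zero>\<^bsub>V\<^esub>}\<rparr>) \<rho> + mult_dim G V \<rho>"
    using \<rho> by (intro admissible_image(2)[OF G V, of "\<lambda>x. x"] ghomI) auto
  then show ?thesis by simp
qed

text \<open>Rather than through an isomorphism between (A + B)/A and B/(A \<inter> B), one quotient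
  Q is used twice: as image of A + B with kernel A, and as image of B with kernel A \<inter>
  B.\<close>

lemma mult_dim_modular:
  assumes G: "linear_algebraic_group G" and V: "admissible G V"
    and A: "gsub G complex_field A V" and B: "gsub G complex_field B V" and \<rho>: "\<rho> \<in> Irr G"
  shows "mult_dim G (V\<lparr>carrier := msum V A B\<rparr>) \<rho> + mult_dim G (V\<lparr>carrier := A \<inter> B\<rparr>) \<rho> =
    mult_dim G (V\<lparr>carrier := A\<rparr>) \<rho> + mult_dim G (V\<lparr>carrier := B\<rparr>) \<rho>"
proof -
  note gV = admissible_gmod[OF V]
  define S where "S = V\<lparr>carrier := msum V A B\<rparr>"
  define Q where "Q = quotient_gmodule S A"
  define \<pi> where "\<pi> = (\<lambda>x. A +>\<^bsub>S\<^esub> x)"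
  note sum = gsub_msum[OF gV A B] and up = msum_upper[OF gV A B]
  have S: "admissible G S" unfolding S_def by (rule admissible_gsub[OF G V sum])
  note gS = admissible_gmod[OF S]
  have AS: "gsub G complex_field A S" using gsub_restrict_iff[OF gV sum] A up by (simp add: S_def)
  note \<pi> = coset_map[OF gS AS, folded Q_def, folded \<pi>_def]
  note Q = admissible_quotient[OF G S AS, folded Q_def]
  note gQ = admissible_gmod[OF Q(1)]
  interpret Q: Module.module complex_field Q using gQ by (simp add: gmod_def)
  have 1: "mult_dim G S \<rho> = mult_dim G (V\<lparr>carrier := A\<rparr>) \<rho> + mult_dim G Q \<rho>"
    using Q(2)[OF \<rho>] by (simp add: S_def)
  have hB: "\<pi> \<in> ghom G complex_field (V\<lparr>carrier := B\<rparr>) Q"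
    using ghom_restrict[OF \<pi>(1), of B] up(2) by (simp add: S_def)
  have mem: "x \<in> A \<longleftrightarrow> \<pi> x = \<zero>\<^bsub>Q\<^esub>" if "x \<in> msum V A B" for x
  proof -
    have "{x \<in> msum V A B. \<pi> x = \<zero>\<^bsub>Q\<^esub>} = A" using \<pi>(4) by (simp add: S_def)
    then show ?thesis using that by blast
  qed
  have surj: "\<pi> ` B = carrier Q"
  proof (intro antisym subsetI)
    fix y assume "y \<in> carrier Q"
    then obtain x where x: "x \<in> msum V A B" "y = \<pi> x" unfolding \<pi>(2)[symmetric] by (auto simp: S_def)
    then obtain a b where ab: "a \<in> A" "b \<in> B" "x = a \<oplus>\<^bsub>V\<^esub> b" by (auto simp: msum_def)
    then have "a \<in> msum V A B" "b \<in> msum V A B" using up by auto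
    moreover from this have "\<pi> (a \<oplus>\<^bsub>S\<^esub> b) = \<pi> a \<oplus>\<^bsub>Q\<^esub> \<pi> b"
      by (intro ghomD(2)[OF \<pi>(1)]) (auto simp: S_def)
    moreover have "\<pi> b \<in> carrier Q" using ghomD(1)[OF hB] ab by simp
    ultimately have "y = \<pi> b" using mem[of a] ab x by (simp add: S_def)
    then show "y \<in> \<pi> ` B" using ab by blast
  qed (use ghomD(1)[OF hB] in auto)
  have ker: "{x \<in> B. \<pi> x = \<zero>\<^bsub>Q\<^esub>} = A \<inter> B" using mem up(2) by blast
  have "mult_dim G (V\<lparr>carrier := B\<rparr>) \<rho> =
      mult_dim G ((V\<lparr>carrier := B\<rparr>)\<lparr>carrier := A \<inter> B\<rparr>) \<rho> + mult_dim G Q \<rho>"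
    using surj \<pi>(3) ker by (intro admissible_image(2)[OF G admissible_gsub[OF G V B] hB _ _ _ \<rho>]) (simp_all add: S_def)
  with 1 show ?thesis by (simp add: S_def)
qed

text \<open>By rationality the orbit of a non-zero v lies in the span of finitely many vectors. The
  span of the orbit is invariant and non-zero, hence everything.\<close>

lemma irreducible_finite_span:
  assumes G: "linear_algebraic_group G" and U: "irreducible_gmodule G U"
  obtains S where "finite S" "S \<subseteq> carrier U" "LinearCombinations.module.span complex_field U S = carrier U"
proof -
  have rU: "rational_gmodule G U" using U by (simp add: irreducible_gmodule_def)
  note gU = rational_gmod[OF rU]
  interpret U: Module.module complex_field U using gU by (simp add: gmod_def)
  have grp: "mat 1 \<in> G" "\<And>g h. g \<in> G \<Longrightarrow> h \<in> G \<Longrightarrow> g ** h \<in> G"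
    using G by (auto simp: linear_algebraic_group_def)
  obtain v where v: "v \<in> carrier U" "v \<noteq> \<zero>\<^bsub>U\<^esub>"
    using U U.M.zero_closed by (auto simp: irreducible_gmodule_def)
  have "\<exists>(k::nat) a w. (\<forall>i<k. a i \<in> regular_functions \<and> w i \<in> carrier U) \<and>
      (\<forall>g\<in>G. gact U g v = (\<Oplus>\<^bsub>U\<^esub>i\<in>{..<k}. a i g \<odot>\<^bsub>U\<^esub> w i))"
    using rU v(1) unfolding rational_gmodule_def by simp
  then obtain k :: nat and a w where w: "\<And>i. i < k \<Longrightarrow> w i \<in> carrier U"
    and eq: "\<And>g. g \<in> G \<Longrightarrow> gact U g v = (\<Oplus>\<^bsub>U\<^esub>i\<in>{..<k}. a i g \<odot>\<^bsub>U\<^esub> w i)"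
    by blast
  define S where "S = w ` {..<k}"
  have S: "finite S" "S \<subseteq> carrier U" using w by (auto simp: S_def)
  note sub = U.span_is_submodule[OF S(2)]
  define orb where "orb = {gact U g v |g. g \<in> G}"
  have orb_car: "orb \<subseteq> carrier U" using gmodD(2)[OF gU _ v(1)] by (auto simp: orb_def)
  have "orb \<subseteq> U.span S"
  proof -
    have "(\<Oplus>\<^bsub>U\<^esub>i\<in>A. a i g \<odot>\<^bsub>U\<^esub> w i) \<in> U.span S" if "finite A" "A \<subseteq> {..<k}" for A g
      using that
    proof (induction A rule: finite_induct)
      case empty
      then show ?case using sub by (simp add: LinearCombinations.submodule_def)
    next
      case (insert i A)
      have c: "c \<in> carrier complex_field" for c by (simp add: complex_field_def)
      have "w i \<in> U.span S" using insert.prems U.in_own_span[OF S(2)] by (auto simp: S_def)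
      then have "a i g \<odot>\<^bsub>U\<^esub> w i \<in> U.span S" using sub c by (auto simp: LinearCombinations.submodule_def)
      moreover have "(\<lambda>i. a i g \<odot>\<^bsub>U\<^esub> w i) \<in> A \<rightarrow> carrier U" "a i g \<odot>\<^bsub>U\<^esub> w i \<in> carrier U"
        using w c insert.prems by auto
      ultimately show ?case using insert sub by (auto simp: LinearCombinations.submodule_def)
    qed
    then show ?thesis using eq by (auto simp: orb_def)
  qed
  then have le: "U.span orb \<subseteq> U.span S" using submodule_span_subset_iff[OF sub orb_car] by simp
  note subO = U.span_is_submodule[OF orb_car]
  have act: "gact U h \<in> LinearCombinations.module_hom complex_field U U" if "h \<in> G" for h
    using rU that by (simp add: rational_gmodule_def)
  have stable: "gact U h x \<in> U.span orb" if h: "h \<in> G" and x: "x \<in> U.span orb" for h x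
  proof -
    have hO: "LinearCombinations.submodule complex_field {x \<in> carrier U. gact U h x \<in> U.span orb} U"
      using subO act[OF h] gmod_gact_zero[OF gU h] U.module_axioms
      by (auto simp: LinearCombinations.submodule_def LinearCombinations.module_hom_def)
    have "orb \<subseteq> {x \<in> carrier U. gact U h x \<in> U.span orb}"
    proof
      fix x assume "x \<in> orb"
      then obtain g where g: "g \<in> G" "x = gact U g v" by (auto simp: orb_def)
      then have "gact U h x = gact U (h ** g) v" using rU h v(1) by (simp add: rational_gmodule_def)
      then have "gact U h x \<in> orb" using grp(2)[OF h g(1)] by (auto simp: orb_def)
      then show "x \<in> {x \<in> carrier U. gact U h x \<in> U.span orb}" using U.in_own_span[OF orb_car] orb_car \<open>x \<in> orb\<close> by blast
    qed
    then have "U.span orb \<subseteq> {x \<in> carrier U. gact U h x \<in> U.span orb}"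
      unfolding submodule_span_subset_iff[OF hO orb_car] .
    then show ?thesis using x by blast
  qed
  have "gact U (mat 1) v = v" using rU v(1) by (simp add: rational_gmodule_def)
  then have "v \<in> orb" using grp(1) unfolding orb_def by (metis (mono_tags, lifting) mem_Collect_eq)
  then have "U.span orb \<noteq> {\<zero>\<^bsub>U\<^esub>}" using v(2) U.in_own_span[OF orb_car] by blast
  then have "U.span orb = carrier U"
    using U subO stable unfolding irreducible_gmodule_def by (meson subO stable)
  then have "U.span S = carrier U" using le U.span_is_subset2[OF S(2)] by blast
  with S show thesis using that by blast
qed

text \<open>With f in a finite spanning set of Hom(U, V) and u in a finite spanning set of U, the
  values f u suffice, by linearity first in u and then in f. Testing against arbitrary subspaces T
  makes the result applicable to spans over the coordinate ring as well.\<close>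

lemma gens_finitely_generated:
  assumes G: "linear_algebraic_group G" and V: "admissible G V" and D: "finite D" "D \<subseteq> Irr G"
  obtains S where "finite S" "S \<subseteq> gens G D V"
    "\<And>T. LinearCombinations.submodule complex_field T V \<Longrightarrow> S \<subseteq> T \<Longrightarrow> gens G D V \<subseteq> T"
proof -
  have "\<exists>S. finite S \<and> S \<subseteq> gens G {\<rho>} V \<and>
      (\<forall>T. LinearCombinations.submodule complex_field T V \<longrightarrow> S \<subseteq> T \<longrightarrow> gens G {\<rho>} V \<subseteq> T)" if \<rho>: "\<rho> \<in> Irr G" for \<rho>
  proof -
    define U where "U = irrep_of \<rho>"
    have U: "irreducible_gmodule G U" "gmod G complex_field U"
      using irreducible_irrep_of[OF \<rho>] irrep_gmod[OF \<rho>] by (auto simp: U_def)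
    interpret U: Module.module complex_field U using U(2) by (simp add: gmod_def)
    obtain P where P: "finite P" "P \<subseteq> carrier U" "U.span P = carrier U"
      using irreducible_finite_span[OF G U(1)] by blast
    interpret H: vectorspace complex_field "gHom_space G U V"
      using V U by (intro gHom_space_vectorspace) (simp_all add: admissible_def)
    have "H.fin_dim" using V \<rho> by (simp add: admissible_def finite_multiplicities_def U_def)
    then obtain B where B: "finite B" "B \<subseteq> carrier (gHom_space G U V)" "H.span B = carrier (gHom_space G U V)"
      unfolding H.fin_dim_def by blast
    have gens: "gens G {\<rho>} V = (\<Union>f\<in>gHom G U V. f ` carrier U)" by (simp add: gens_def U_def)
    have car: "carrier (gHom_space G U V) = gHom G U V" by (simp add: gHom_space_def)
    have hom: "f \<in> ghom G complex_field U V" if "f \<in> gHom G U V" for f using that by (simp add: gHom_eq)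
    have gV: "gmod G complex_field V" by (rule admissible_gmod[OF V])
    show ?thesis
    proof (intro exI[of _ "\<Union>f\<in>B. f ` P"] conjI allI impI)
      show "finite (\<Union>f\<in>B. f ` P)" using P B by blast
      show "(\<Union>f\<in>B. f ` P) \<subseteq> gens G {\<rho>} V" using P(2) B(2) unfolding gens car by blast
      fix T assume T: "LinearCombinations.submodule complex_field T V" and sub: "(\<Union>f\<in>B. f ` P) \<subseteq> T"
      have B_im: "f ` carrier U \<subseteq> T" if f: "f \<in> B" for f
      proof -
        note fh = hom[OF subsetD[OF B(2)[unfolded car] f]]
        have UT: "LinearCombinations.submodule complex_field {u \<in> carrier U. f u \<in> T} U"
          using T ghomD[OF fh] ghom_zero[OF U(2) gV fh] U.module_axioms
          by (auto simp: LinearCombinations.submodule_def)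
        have "P \<subseteq> {u \<in> carrier U. f u \<in> T}" using P(2) sub f by blast
        then have "carrier U \<subseteq> {u \<in> carrier U. f u \<in> T}"
          unfolding submodule_span_subset_iff[OF UT P(2), symmetric] P(3) .
        then show ?thesis by blast
      qed
      have HT: "LinearCombinations.submodule complex_field {f \<in> gHom G U V. f ` carrier U \<subseteq> T} (gHom_space G U V)"
        unfolding LinearCombinations.submodule_def
      proof (intro conjI allI impI)
        show "Module.module complex_field (gHom_space G U V)" by (rule H.module_axioms)
        show "{f \<in> gHom G U V. f ` carrier U \<subseteq> T} \<subseteq> carrier (gHom_space G U V)" by (auto simp: car)
        show "\<zero>\<^bsub>gHom_space G U V\<^esub> \<in> {f \<in> gHom G U V. f ` carrier U \<subseteq> T}"
          using H.M.zero_closed T by (auto simp: gHom_space_def LinearCombinations.submodule_def)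
        show "f \<oplus>\<^bsub>gHom_space G U V\<^esub> f' \<in> {f \<in> gHom G U V. f ` carrier U \<subseteq> T}"
          if "f \<in> {f \<in> gHom G U V. f ` carrier U \<subseteq> T}" "f' \<in> {f \<in> gHom G U V. f ` carrier U \<subseteq> T}" for f f'
          using H.M.a_closed[of f f'] that T unfolding car
          by (auto simp: gHom_space_def LinearCombinations.submodule_def image_subset_iff)
        show "c \<odot>\<^bsub>gHom_space G U V\<^esub> f \<in> {f \<in> gHom G U V. f ` carrier U \<subseteq> T}"
          if "c \<in> carrier complex_field" "f \<in> {f \<in> gHom G U V. f ` carrier U \<subseteq> T}" for c f
          using H.smult_closed[of c f] that T unfolding car
          by (auto simp: gHom_space_def LinearCombinations.submodule_def image_subset_iff)
      qed
      have "B \<subseteq> {f \<in> gHom G U V. f ` carrier U \<subseteq> T}" using B(2) B_im unfolding car by blast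
      then have "gHom G U V \<subseteq> {f \<in> gHom G U V. f ` carrier U \<subseteq> T}"
        unfolding submodule_span_subset_iff[OF HT B(2), symmetric] B(3) car .
      then show "gens G {\<rho>} V \<subseteq> T" unfolding gens by blast
    qed
  qed
  then obtain S where S: "\<And>\<rho>. \<rho> \<in> Irr G \<Longrightarrow> finite (S \<rho>) \<and> S \<rho> \<subseteq> gens G {\<rho>} V \<and>
      (\<forall>T. LinearCombinations.submodule complex_field T V \<longrightarrow> S \<rho> \<subseteq> T \<longrightarrow> gens G {\<rho>} V \<subseteq> T)" by metis
  have eq: "gens G D V = (\<Union>\<rho>\<in>D. gens G {\<rho>} V)" by (simp add: gens_def)
  show thesis
  proof (rule that[of "\<Union>\<rho>\<in>D. S \<rho>"])
    show "finite (\<Union>\<rho>\<in>D. S \<rho>)" using D S by blast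
    show "(\<Union>\<rho>\<in>D. S \<rho>) \<subseteq> gens G D V" unfolding eq using D S by blast
    show "gens G D V \<subseteq> T" if "LinearCombinations.submodule complex_field T V" "(\<Union>\<rho>\<in>D. S \<rho>) \<subseteq> T" for T
      unfolding eq using D S that by blast
  qed
qed

section \<open>Submodules generated by their negative part\<close>

lemma global_sections_restrict [simp]:
  "global_sections X (M\<lparr>carrier := N\<rparr>) = (global_sections X M)\<lparr>carrier := N\<rparr>"
  by (simp add: global_sections_def)

lemma global_sections_simps [simp]:
  "carrier (global_sections X M) = carrier M" "\<zero>\<^bsub>global_sections X M\<^esub> = \<zero>\<^bsub>M\<^esub>"
  "x \<oplus>\<^bsub>global_sections X M\<^esub> y = x \<oplus>\<^bsub>M\<^esub> y"
  "c \<odot>\<^bsub>global_sections X M\<^esub> x = scal X c \<odot>\<^bsub>M\<^esub> x"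
  "gact (global_sections X M) = gact M"
  by (simp_all add: global_sections_def)

lemma msum_global_sections [simp]: "msum (global_sections X M) A B = msum M A B"
  by (simp add: msum_def)

definition compatible_action ::
    "(complex^'n^'n) set \<Rightarrow> ('a, 'n) gscheme \<Rightarrow> ('a, 'b, 'n) gmodule \<Rightarrow> bool" where
  "compatible_action G X M \<longleftrightarrow> (\<forall>g\<in>G. \<forall>a\<in>carrier X. \<forall>m\<in>carrier M.
     gact M g (a \<odot>\<^bsub>M\<^esub> m) = ract X g a \<odot>\<^bsub>M\<^esub> gact M g m)"

lemma OXG_module_iff:
  "OXG_module G X M \<longleftrightarrow> Module.module X M \<and>
     (\<exists>S \<subseteq> carrier M. finite S \<and> LinearCombinations.module.span X M S = carrier M) \<and>
     admissible G (global_sections X M) \<and> compatible_action G X M"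
  by (auto simp: OXG_module_def admissible_def compatible_action_def)

lemma OXG_moduleD:
  assumes "OXG_module G X M"
  shows "gmod G X M" "admissible G (global_sections X M)" "gmod G complex_field (global_sections X M)"
    "Module.module X M" "compatible_action G X M"
proof -
  show *: "admissible G (global_sections X M)" "Module.module X M" "compatible_action G X M"
    using assms by (auto simp: OXG_module_iff)
  show "gmod G complex_field (global_sections X M)" by (rule admissible_gmod[OF *(1)])
  then show "gmod G X M" using *(2) by (auto simp: gmod_def)
qed

lemma (in abelian_group) minus_plus_cancel:
  "x \<in> carrier G \<Longrightarrow> y \<in> carrier G \<Longrightarrow> (x \<ominus> y) \<oplus> y = x"
  by (simp add: a_minus_def a_assoc l_neg)

lemma complex_in_carrier [simp]: "c \<in> carrier complex_field"
  by (simp add: complex_field_def)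

locale stability_setting =
  fixes G :: "(complex^'n^'n) set" and X :: "('a, 'n) gscheme" and \<theta> :: "'n irrep set \<Rightarrow> rat"
  assumes group: "linear_algebraic_group G" and scheme: "affine_gscheme G X"
    and finite_D: "finite (D_minus G \<theta>)"
begin

abbreviation D where "D \<equiv> D_minus G \<theta>"

abbreviation sec :: "('a, 'b, 'n) gmodule \<Rightarrow> (complex, 'b, 'n) gmodule" where
  "sec \<equiv> global_sections X"

abbreviation generated :: "('a, 'b, 'n) gmodule \<Rightarrow> bool" where
  "generated \<equiv> generated_in_D_minus G X \<theta>"

lemma D_Irr: "D \<subseteq> Irr G"
  by (auto simp: D_minus_def)

lemma scal_closed [simp]: "scal X c \<in> carrier X"
  using scheme by (auto simp: affine_gscheme_def ring_hom_def complex_field_def)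

lemma submodule_sec:
  assumes "LinearCombinations.submodule X T M" "gmod G complex_field (sec M)"
  shows "LinearCombinations.submodule complex_field T (sec M)"
  using assms by (auto simp: LinearCombinations.submodule_def gmod_def)

lemma gsub_sec:
  assumes "gsub G X N M" "gmod G complex_field (sec M)"
  shows "gsub G complex_field N (sec M)"
  using assms submodule_sec[of N M] by (auto simp: gsub_def)

lemma ghom_sec:
  assumes "f \<in> ghom G X M N"
  shows "f \<in> ghom G complex_field (sec M) (sec N)"
  using ghomD[OF assms] by (intro ghomI) simp_all

text \<open>Trades the nested spans, over the complex numbers inside and over the coordinate ring
  outside, for one test against submodules over the coordinate ring.\<close>

lemma generated_iff:
  assumes M: "Module.module X M" and V: "gmod G complex_field (sec M)"
  shows "generated M \<longleftrightarrow> (\<forall>T. LinearCombinations.submodule X T M \<and> gens G D (sec M) \<subseteq> T \<longrightarrow> carrier M \<subseteq> T)"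
proof -
  interpret M: Module.module X M by fact
  interpret V: Module.module complex_field "sec M" using V by (simp add: gmod_def)
  define Np where "Np = negative_part G \<theta> (sec M)"
  have iff: "Np \<subseteq> T \<longleftrightarrow> gens G D (sec M) \<subseteq> T" if "LinearCombinations.submodule X T M" for T
    unfolding Np_def negative_part_def by (rule isotypic_span_subset_iff[OF submodule_sec[OF that V]])
  have car: "LinearCombinations.submodule X (carrier M) M"
    using M.module_axioms by (simp add: LinearCombinations.submodule_def)
  have Np: "Np \<subseteq> carrier M" using iff[OF car] gens_subset[of G D "sec M"] by simp
  have iff2: "M.span Np \<subseteq> T \<longleftrightarrow> gens G D (sec M) \<subseteq> T" if "LinearCombinations.submodule X T M" for T
    using submodule_span_subset_iff[OF that Np] iff[OF that] by simp
  note sp = M.span_is_submodule[OF Np]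
  have "generated M \<longleftrightarrow> M.span Np = carrier M" by (simp add: generated_in_D_minus_def Np_def)
  also have "\<dots> \<longleftrightarrow> carrier M \<subseteq> M.span Np" using M.span_is_subset2[OF Np] by auto
  also have "\<dots> \<longleftrightarrow> (\<forall>T. LinearCombinations.submodule X T M \<and> gens G D (sec M) \<subseteq> T \<longrightarrow> carrier M \<subseteq> T)"
  proof
    assume "carrier M \<subseteq> M.span Np"
    then show "\<forall>T. LinearCombinations.submodule X T M \<and> gens G D (sec M) \<subseteq> T \<longrightarrow> carrier M \<subseteq> T"
      using iff2 by (metis order_trans)
  next
    assume *: "\<forall>T. LinearCombinations.submodule X T M \<and> gens G D (sec M) \<subseteq> T \<longrightarrow> carrier M \<subseteq> T"
    have "gens G D (sec M) \<subseteq> M.span Np" using iff2[OF sp] by simp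
    with * sp show "carrier M \<subseteq> M.span Np" by blast
  qed
  finally show ?thesis .
qed

text \<open>T ranges over submodules of the ambient M, so that different N are tested against the
  same family. Finite generation and admissibility of N are recovered in
  \<open>gen_sub_OXG\<close>.\<close>

definition gen_sub :: "('a, 'b, 'n) gmodule \<Rightarrow> 'b set \<Rightarrow> bool" where
  "gen_sub M N \<longleftrightarrow> gsub G X N M \<and>
     (\<forall>T. LinearCombinations.submodule X T M \<and> gens G D (sec M\<lparr>carrier := N\<rparr>) \<subseteq> T \<longrightarrow> N \<subseteq> T)"

lemma gen_subD:
  assumes "gen_sub M N"
  shows "gsub G X N M" "N \<subseteq> carrier M"
    and "LinearCombinations.submodule X T M \<Longrightarrow> gens G D (sec M\<lparr>carrier := N\<rparr>) \<subseteq> T \<Longrightarrow> N \<subseteq> T"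
  using assms by (auto simp: gen_sub_def dest: gsubD)

lemma generated_restrict_iff:
  assumes M: "OXG_module G X M" and N: "gsub G X N M"
  shows "generated (M\<lparr>carrier := N\<rparr>) \<longleftrightarrow> gen_sub M N"
proof -
  note m = OXG_moduleD[OF M]
  note gN = gmod_restrict[OF m(1) N]
  have Ns: "gsub G complex_field N (sec M)" by (rule gsub_sec[OF N m(3)])
  have gNs: "gmod G complex_field (sec (M\<lparr>carrier := N\<rparr>))"
    using gmod_restrict[OF m(3) Ns] by simp
  have modN: "Module.module X (M\<lparr>carrier := N\<rparr>)" using gN by (simp add: gmod_def)
  have gens: "gens G D (sec M\<lparr>carrier := N\<rparr>) \<subseteq> N" using gens_subset[of G D "sec M\<lparr>carrier := N\<rparr>"] by simp
  have sub: "LinearCombinations.submodule X T (M\<lparr>carrier := N\<rparr>) \<longleftrightarrow> LinearCombinations.submodule X T M \<and> T \<subseteq> N" for T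
    using modN m(4) gsubD[OF N] by (auto simp: LinearCombinations.submodule_def)
  have inter: "LinearCombinations.submodule X (T \<inter> N) M" if "LinearCombinations.submodule X T M" for T
    using that gsubD(1)[OF N] by (auto simp: LinearCombinations.submodule_def)
  show ?thesis
    unfolding generated_iff[OF modN gNs] gen_sub_def sub global_sections_restrict
  proof (intro iffI conjI allI impI N; elim conjE)
    fix T assume *: "\<forall>T. (LinearCombinations.submodule X T M \<and> T \<subseteq> N) \<and> gens G D (sec M\<lparr>carrier := N\<rparr>) \<subseteq> T \<longrightarrow>
        carrier (M\<lparr>carrier := N\<rparr>) \<subseteq> T"
      and T: "LinearCombinations.submodule X T M" "gens G D (sec M\<lparr>carrier := N\<rparr>) \<subseteq> T"
    \<comment> \<open>T is cut down to \<open>T \<inter> N\<close>, a submodule of N that still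
      contains the generators.\<close>
    show "N \<subseteq> T" using *[rule_format, of "T \<inter> N"] inter[OF T(1)] T(2) gens by simp
  next
    fix T assume "\<forall>T. LinearCombinations.submodule X T M \<and> gens G D (sec M\<lparr>carrier := N\<rparr>) \<subseteq> T \<longrightarrow> N \<subseteq> T"
      and "LinearCombinations.submodule X T M" "gens G D (sec M\<lparr>carrier := N\<rparr>) \<subseteq> T"
    then show "carrier (M\<lparr>carrier := N\<rparr>) \<subseteq> T" by simp
  qed
qed

text \<open>Finitely many negative sections that span the negative generators over the complex
  numbers also generate N over the coordinate ring, because a submodule over the latter is a complex
  subspace.\<close>

lemma gen_sub_OXG:
  assumes M: "OXG_module G X M" and N: "gen_sub M N"
  shows "OXG_submodule G X N M"
proof -
  note m = OXG_moduleD[OF M]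
  note n = gen_subD[OF N]
  note gN = gmod_restrict[OF m(1) n(1)]
  interpret M: Module.module X M by (rule m(4))
  interpret N: Module.module X "M\<lparr>carrier := N\<rparr>" using gN by (simp add: gmod_def)
  have adm: "admissible G (sec M\<lparr>carrier := N\<rparr>)"
    by (rule admissible_gsub[OF group m(2) gsub_sec[OF n(1) m(3)]])
  note gNs = admissible_gmod[OF adm]
  obtain S where S: "finite S" "S \<subseteq> gens G D (sec M\<lparr>carrier := N\<rparr>)"
    "\<And>T. LinearCombinations.submodule complex_field T (sec M\<lparr>carrier := N\<rparr>) \<Longrightarrow> S \<subseteq> T \<Longrightarrow>
      gens G D (sec M\<lparr>carrier := N\<rparr>) \<subseteq> T"
    using gens_finitely_generated[OF group adm finite_D D_Irr] by blast
  have SN: "S \<subseteq> carrier (M\<lparr>carrier := N\<rparr>)"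
    using S(2) gens_subset[of G D "sec M\<lparr>carrier := N\<rparr>"] by simp
  note sp = N.span_is_submodule[OF SN]
  have "gens G D (sec M\<lparr>carrier := N\<rparr>) \<subseteq> N.span S"
    using S(3)[of "N.span S"] submodule_sec[OF sp] gNs N.in_own_span[OF SN] by simp
  moreover have "LinearCombinations.submodule X (N.span S) M"
    using sp n(1,2) m(4) by (auto simp: LinearCombinations.submodule_def)
  ultimately have "N \<subseteq> N.span S" using n(3) by blast
  then have "N.span S = carrier (M\<lparr>carrier := N\<rparr>)" using N.span_is_subset2[OF SN] by auto
  moreover have "compatible_action G X (M\<lparr>carrier := N\<rparr>)"
    using m(5) n(2) by (auto simp: compatible_action_def)
  ultimately have "OXG_module G X (M\<lparr>carrier := N\<rparr>)"
    unfolding OXG_module_iff using N.module_axioms S(1) SN adm by auto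
  then show ?thesis using n(2) by (simp add: OXG_submodule_def)
qed

text \<open>Applied both to the members of a filtration of F and to the test submodules of a
  quotient.\<close>

lemma gen_sub_iff:
  assumes M: "OXG_module G X M"
  shows "OXG_submodule G X N M \<and> generated (M\<lparr>carrier := N\<rparr>) \<longleftrightarrow> gen_sub M N"
proof
  assume *: "OXG_submodule G X N M \<and> generated (M\<lparr>carrier := N\<rparr>)"
  then have "N \<subseteq> carrier M" "gmod G X (M\<lparr>carrier := N\<rparr>)"
    by (auto simp: OXG_submodule_def dest: OXG_moduleD(1))
  then have "gsub G X N M" using gsub_of_restrict_gmod[OF OXG_moduleD(1)[OF M]] by blast
  then show "gen_sub M N" using generated_restrict_iff[OF M] * by blast
next
  assume N: "gen_sub M N"
  then show "OXG_submodule G X N M \<and> generated (M\<lparr>carrier := N\<rparr>)"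
    using gen_sub_OXG[OF M N] generated_restrict_iff[OF M gen_subD(1)[OF N]] by blast
qed

lemma gens_mono:
  assumes "N \<subseteq> N'" "N' \<subseteq> carrier V"
  shows "gens G D (V\<lparr>carrier := N\<rparr>) \<subseteq> gens G D (V\<lparr>carrier := N'\<rparr>)"
proof -
  have "gHom G U (V\<lparr>carrier := N\<rparr>) \<subseteq> gHom G U (V\<lparr>carrier := N'\<rparr>)" for U :: "'n irrep"
    using assms gHom_restrict_iff[of N V _ G U] gHom_restrict_iff[of N' V _ G U] by blast
  then show ?thesis unfolding gens_def by blast
qed

lemma gen_sub_zero:
  assumes "OXG_module G X M"
  shows "gen_sub M {\<zero>\<^bsub>M\<^esub>}"
  using gsub_zero[OF OXG_moduleD(1)[OF assms]] by (auto simp: gen_sub_def LinearCombinations.submodule_def)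

lemma gen_sub_carrier:
  assumes "OXG_module G X M" "generated M"
  shows "gen_sub M (carrier M)"
  using gsub_carrier[OF OXG_moduleD(1)[OF assms(1)]]
    generated_restrict_iff[OF assms(1), of "carrier M"] assms(2) by simp

lemma gen_sub_msum:
  assumes M: "OXG_module G X M" and A: "gen_sub M A" and B: "gen_sub M B"
  shows "gen_sub M (msum M A B)"
proof -
  note m = OXG_moduleD[OF M]
  note sum = gsub_msum[OF m(1) gen_subD(1)[OF A] gen_subD(1)[OF B]]
  note up = msum_upper[OF m(1) gen_subD(1)[OF A] gen_subD(1)[OF B]]
  have car: "msum M A B \<subseteq> carrier (sec M)" using gsubD(2)[OF sum] by simp
  have "msum M A B \<subseteq> T"
    if T: "LinearCombinations.submodule X T M" "gens G D (sec M\<lparr>carrier := msum M A B\<rparr>) \<subseteq> T" for T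
  proof -
    have "A \<subseteq> T" using gen_subD(3)[OF A T(1)] gens_mono[OF up(1) car] T(2) by blast
    moreover have "B \<subseteq> T" using gen_subD(3)[OF B T(1)] gens_mono[OF up(2) car] T(2) by blast
    ultimately show ?thesis
      using LinearCombinations.submodule.m_closed[OF T(1)] unfolding msum_def by blast
  qed
  with sum show ?thesis by (auto simp: gen_sub_def)
qed

text \<open>For invariant I this is the largest submodule of I that is generated in D_-.\<close>

definition core :: "('a, 'b, 'n) gmodule \<Rightarrow> 'b set \<Rightarrow> 'b set" where
  "core M I = LinearCombinations.module.span X M (gens G D (sec M\<lparr>carrier := I\<rparr>))"

lemma gens_stable:
  assumes "gmod G complex_field V" "g \<in> G" "x \<in> gens G D V"
  shows "gact V g x \<in> gens G D V"
proof -
  obtain \<rho> f u where f: "\<rho> \<in> D" "f \<in> gHom G (irrep_of \<rho>) V" "u \<in> carrier (irrep_of \<rho>)" "x = f u"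
    using assms(3) by (auto simp: gens_def)
  have fh: "f \<in> ghom G complex_field (irrep_of \<rho>) V" using f(2) by (simp add: gHom_eq)
  have \<rho>: "\<rho> \<in> Irr G" using f(1) D_Irr by blast
  have "gact V g x = f (gact (irrep_of \<rho>) g u)" using ghomD(4)[OF fh assms(2) f(3)] f(4) by simp
  moreover have "gact (irrep_of \<rho>) g u \<in> carrier (irrep_of \<rho>)"
    using gmodD(2)[OF irrep_gmod[OF \<rho>] assms(2) f(3)] .
  ultimately show ?thesis unfolding gens_def using f(1,2) by blast
qed

text \<open>Maps from negative irreducible modules into I have their images among the generators, so
  they already land in the core. Hence the core keeps the negative multiplicities of I and is
  generated by its own negative part.\<close>

lemma core_properties:
  assumes M: "OXG_module G X M" and I: "gsub G X I M"
  shows "core M I \<subseteq> I" and "gens G D (sec M\<lparr>carrier := I\<rparr>) \<subseteq> core M I" and "gen_sub M (core M I)"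
    and "gen_sub M N \<Longrightarrow> N \<subseteq> I \<Longrightarrow> N \<subseteq> core M I"
    and "\<rho> \<in> D \<Longrightarrow> gHom G (irrep_of \<rho>) (sec M\<lparr>carrier := core M I\<rparr>) = gHom G (irrep_of \<rho>) (sec M\<lparr>carrier := I\<rparr>)"
proof -
  note m = OXG_moduleD[OF M]
  interpret M: Module.module X M by (rule m(4))
  define E where "E = gens G D (sec M\<lparr>carrier := I\<rparr>)"
  have EI: "E \<subseteq> I" using gens_subset[of G D "sec M\<lparr>carrier := I\<rparr>"] by (simp add: E_def)
  then have EM: "E \<subseteq> carrier M" using gsubD(2)[OF I] by blast
  have core: "core M I = M.span E" by (simp add: core_def E_def)
  have sub: "LinearCombinations.submodule X (core M I) M" unfolding core by (rule M.span_is_submodule[OF EM])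
  show cI: "core M I \<subseteq> I" unfolding core using submodule_span_subset_iff[OF gsubD(1)[OF I] EM] EI by blast
  show Ecore: "gens G D (sec M\<lparr>carrier := I\<rparr>) \<subseteq> core M I"
    unfolding core E_def[symmetric] by (rule M.in_own_span[OF EM])
  have Icar: "I \<subseteq> carrier (sec M)" using gsubD(2)[OF I] by simp
  have ccar: "core M I \<subseteq> carrier (sec M)" using cI Icar by blast
  show hom: "gHom G (irrep_of \<rho>) (sec M\<lparr>carrier := core M I\<rparr>) = gHom G (irrep_of \<rho>) (sec M\<lparr>carrier := I\<rparr>)"
    if \<rho>: "\<rho> \<in> D" for \<rho>
  proof -
    have im: "f ` carrier (irrep_of \<rho>) \<subseteq> core M I" if "f \<in> gHom G (irrep_of \<rho>) (sec M\<lparr>carrier := I\<rparr>)" for f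
      using Ecore \<rho> that unfolding gens_def by blast
    show ?thesis
    proof (rule Set.set_eqI)
      show "f \<in> gHom G (irrep_of \<rho>) (sec M\<lparr>carrier := core M I\<rparr>) \<longleftrightarrow>
          f \<in> gHom G (irrep_of \<rho>) (sec M\<lparr>carrier := I\<rparr>)" for f
        using gHom_restrict_iff[OF Icar, of f G "irrep_of \<rho>"] gHom_restrict_iff[OF ccar, of f G "irrep_of \<rho>"]
          cI im[of f] by blast
    qed
  qed
  have gens_core: "gens G D (sec M\<lparr>carrier := core M I\<rparr>) = E"
    unfolding E_def gens_def using hom by simp
  have "gact M g x \<in> core M I" if g: "g \<in> G" and x: "x \<in> core M I" for g x
  proof -
    \<comment> \<open>The action is only semilinear over the coordinate ring; compatibility with
      \<open>ract\<close> still makes the preimage of a submodule under g a submodule.\<close>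
    have "LinearCombinations.submodule X {x \<in> carrier M. gact M g x \<in> core M I} M"
    proof -
      have "ract X g a \<in> carrier X" if "a \<in> carrier X" for a
        using scheme g that by (auto simp: affine_gscheme_def ring_hom_def)
      then show ?thesis
        using sub m(5) g gmodD[OF m(1)] gmod_gact_zero[OF m(1) g]
        by (auto simp: LinearCombinations.submodule_def compatible_action_def)
    qed
    note iff = submodule_span_subset_iff[OF this EM]
    have Is: "gsub G complex_field I (sec M)" by (rule gsub_sec[OF I m(3)])
    have "gact M g x \<in> E" if "x \<in> E" for x
      using gens_stable[OF gmod_restrict[OF m(3) Is] g] that by (simp add: E_def)
    then have "E \<subseteq> {x \<in> carrier M. gact M g x \<in> core M I}" using Ecore EM unfolding E_def[symmetric] by blast
    then have "core M I \<subseteq> {x \<in> carrier M. gact M g x \<in> core M I}" using iff unfolding core by simp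
    then show ?thesis using x by blast
  qed
  then have "gsub G X (core M I) M" using sub by (simp add: gsub_def)
  moreover have "core M I \<subseteq> T" if T: "LinearCombinations.submodule X T M" "E \<subseteq> T" for T
    unfolding core using submodule_span_subset_iff[OF T(1) EM] T(2) by blast
  ultimately show "gen_sub M (core M I)" unfolding gen_sub_def gens_core by blast
  show "N \<subseteq> core M I" if N: "gen_sub M N" "N \<subseteq> I"
    using gen_subD(3)[OF N(1) sub] gens_mono[OF N(2) Icar] Ecore by blast
qed

text \<open>If T contains the negative generators of N, its preimage contains those of M and is
  therefore M. Finite generation is inherited by pushing forward a finite generating set.\<close>

lemma image_generated:
  assumes M: "OXG_module G X M" and gen: "generated M" and f: "f \<in> ghom G X M N"
    and surj: "f ` carrier M = carrier N" and zero: "f \<zero>\<^bsub>M\<^esub> = \<zero>\<^bsub>N\<^esub>"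
  shows "OXG_module G X N" "generated N"
proof -
  note m = OXG_moduleD[OF M]
  note fD = ghomD[OF f]
  interpret M: Module.module X M by (rule m(4))
  have gN: "gmod G X N" by (rule image_gmod[OF m(1) f surj zero])
  interpret N: Module.module X N using gN by (simp add: gmod_def)
  have adm: "admissible G (sec N)"
    using admissible_image(1)[OF group m(2) ghom_sec[OF f] _ _ refl] surj zero by simp
  have compat: "compatible_action G X N"
    unfolding compatible_action_def
  proof (intro ballI)
    fix g a y assume g: "g \<in> G" and a: "a \<in> carrier X" and "y \<in> carrier N"
    then obtain x where x: "x \<in> carrier M" "y = f x" unfolding surj[symmetric] by blast
    have ra: "ract X g a \<in> carrier X" using scheme g a by (auto simp: affine_gscheme_def ring_hom_def)
    have "gact N g (a \<odot>\<^bsub>N\<^esub> y) = f (gact M g (a \<odot>\<^bsub>M\<^esub> x))" using fD x g a by simp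
    also have "\<dots> = f (ract X g a \<odot>\<^bsub>M\<^esub> gact M g x)" using m(5) g a x by (simp add: compatible_action_def)
    also have "\<dots> = ract X g a \<odot>\<^bsub>N\<^esub> gact N g y" using fD x g ra gmodD(2)[OF m(1)] by simp
    finally show "gact N g (a \<odot>\<^bsub>N\<^esub> y) = ract X g a \<odot>\<^bsub>N\<^esub> gact N g y" .
  qed
  have vim: "LinearCombinations.submodule X {x \<in> carrier M. f x \<in> T} M"
    if "LinearCombinations.submodule X T N" for T
    using that fD zero m(4) by (auto simp: LinearCombinations.submodule_def)
  obtain S where S: "S \<subseteq> carrier M" "finite S" "M.span S = carrier M"
    using M by (auto simp: OXG_module_iff)
  have fS: "f ` S \<subseteq> carrier N" using S(1) fD(1) by blast
  have "S \<subseteq> {x \<in> carrier M. f x \<in> N.span (f ` S)}" using S(1) N.in_own_span[OF fS] by blast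
  then have "carrier M \<subseteq> {x \<in> carrier M. f x \<in> N.span (f ` S)}"
    unfolding submodule_span_subset_iff[OF vim[OF N.span_is_submodule[OF fS]] S(1), symmetric] S(3) .
  then have "carrier N \<subseteq> N.span (f ` S)" unfolding surj[symmetric] by blast
  then have spN: "N.span (f ` S) = carrier N" using N.span_is_subset2[OF fS] by (intro antisym)
  show OXG: "OXG_module G X N"
    unfolding OXG_module_iff
    by (intro conjI exI[of _ "f ` S"] N.module_axioms adm compat fS finite_imageI S(2) spN)
  have "carrier N \<subseteq> T" if T: "LinearCombinations.submodule X T N" "gens G D (sec N) \<subseteq> T" for T
  proof -
    have "gens G D (sec M) \<subseteq> {x \<in> carrier M. f x \<in> T}"
      using gens_image[OF D_Irr ghom_sec[OF f]] T(2) gens_subset[of G D "sec M"] by auto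
    then have "carrier M \<subseteq> {x \<in> carrier M. f x \<in> T}"
      using generated_iff[OF m(4,3)] gen vim[OF T(1)] by blast
    then show ?thesis unfolding surj[symmetric] by blast
  qed
  then show "generated N" using generated_iff[OF OXG_moduleD(4,3)[OF OXG]] by blast
qed

text \<open>Let T contain the negative generators of P. It contains N, and by
  \<open>gens_lift\<close> the image of P \<inter> T contains the negative generators of Q, hence is
  Q. Every element of P then differs from an element of T by an element of N, so it lies in
  T.\<close>

lemma extension_gen_sub:
  assumes M: "OXG_module G X M" and N: "gen_sub M N" and P: "gsub G X P M" and NP: "N \<subseteq> P"
    and f: "f \<in> ghom G X (M\<lparr>carrier := P\<rparr>) Q" and surj: "f ` P = carrier Q"
    and ker: "{x \<in> P. f x = \<zero>\<^bsub>Q\<^esub>} = N" and Q: "OXG_module G X Q" "generated Q"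
  shows "gen_sub M P"
proof -
  note m = OXG_moduleD[OF M] and q = OXG_moduleD[OF Q(1)]
  note gP = gmod_restrict[OF m(1) P]
  interpret M: Module.module X M by (rule m(4))
  interpret Q: Module.module X Q by (rule q(4))
  note fD = ghomD[OF f, simplified]
  have Ps: "gsub G complex_field P (sec M)" by (rule gsub_sec[OF P m(3)])
  have adm: "admissible G (sec (M\<lparr>carrier := P\<rparr>))" using admissible_gsub[OF group m(2) Ps] by simp
  have lift: "gens G D (sec Q) \<subseteq> f ` gens G D (sec M\<lparr>carrier := P\<rparr>)"
    using gens_lift[OF D_Irr adm q(3) ghom_sec[OF f]] surj by simp
  have "P \<subseteq> T" if T: "LinearCombinations.submodule X T M" "gens G D (sec M\<lparr>carrier := P\<rparr>) \<subseteq> T" for T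
  proof
    have NT: "N \<subseteq> T" using gen_subD(3)[OF N T(1)] gens_mono[OF NP, of "sec M"] gsubD(2)[OF P] T(2) by simp
    have PT: "LinearCombinations.submodule X (P \<inter> T) M"
      using gsubD(1)[OF P] T(1) by (auto simp: LinearCombinations.submodule_def)
    note c = LinearCombinations.submodule.m_closed[OF PT] LinearCombinations.submodule.smult_closed[OF PT]
    have imT: "LinearCombinations.submodule X (f ` (P \<inter> T)) Q"
      unfolding LinearCombinations.submodule_def
    proof (intro conjI allI impI)
      show "Module.module X Q" by (rule q(4))
      show "f ` (P \<inter> T) \<subseteq> carrier Q" using surj by blast
      have "\<zero>\<^bsub>M\<^esub> \<in> N" by (rule gsubD(3)[OF gen_subD(1)[OF N]])
      then have "\<zero>\<^bsub>M\<^esub> \<in> P \<inter> T" "f \<zero>\<^bsub>M\<^esub> = \<zero>\<^bsub>Q\<^esub>" using NT NP ker by auto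
      then show "\<zero>\<^bsub>Q\<^esub> \<in> f ` (P \<inter> T)" by (metis imageI)
      show "v \<oplus>\<^bsub>Q\<^esub> w \<in> f ` (P \<inter> T)" if vw: "v \<in> f ` (P \<inter> T)" "w \<in> f ` (P \<inter> T)" for v w
      proof -
        obtain x y where "x \<in> P \<inter> T" "y \<in> P \<inter> T" "v = f x" "w = f y" using vw by blast
        then show ?thesis using fD(2)[of x y] c(1)[of x y] by (intro image_eqI[of _ _ "x \<oplus>\<^bsub>M\<^esub> y"]) auto
      qed
      show "a \<odot>\<^bsub>Q\<^esub> v \<in> f ` (P \<inter> T)" if av: "a \<in> carrier X" "v \<in> f ` (P \<inter> T)" for a v
      proof -
        obtain x where "x \<in> P \<inter> T" "v = f x" using av by blast
        then show ?thesis using fD(3)[of a x] c(2)[of a x] av(1) by (intro image_eqI[of _ _ "a \<odot>\<^bsub>M\<^esub> x"]) auto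
      qed
    qed
    have "gens G D (sec M\<lparr>carrier := P\<rparr>) \<subseteq> P" using gens_subset[of G D "sec M\<lparr>carrier := P\<rparr>"] by simp
    then have "gens G D (sec Q) \<subseteq> f ` (P \<inter> T)" using lift T(2) by blast
    then have all: "carrier Q \<subseteq> f ` (P \<inter> T)" using generated_iff[OF q(4,3)] Q(2) imT by blast
    fix p assume p: "p \<in> P"
    then obtain t where t: "t \<in> P" "t \<in> T" "f p = f t" using all surj by blast
    have cM: "p \<in> carrier M" "t \<in> carrier M" using p t gsubD(4)[OF P] by auto
    \<comment> \<open>Negatives are defined relative to the carrier, so the subtraction is formed in
      P. Addition is the same operation in P and in M, which allows the return to M at the
      end.\<close>
    have "f (p \<ominus>\<^bsub>M\<lparr>carrier := P\<rparr>\<^esub> t) = \<zero>\<^bsub>Q\<^esub>"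
      using ghom_minus[OF gP q(1) f, of p t] p t fD(1)[OF t(1)] by (simp add: a_minus_def Q.M.r_neg)
    moreover have PP: "LinearCombinations.submodule X P (M\<lparr>carrier := P\<rparr>)"
      using gsub_carrier[OF gP] by (simp add: gsub_def)
    ultimately have n: "p \<ominus>\<^bsub>M\<lparr>carrier := P\<rparr>\<^esub> t \<in> T"
      using submodule_minus(2)[OF PP p t(1)] ker NT by blast
    interpret P: Module.module X "M\<lparr>carrier := P\<rparr>" using gP by (simp add: gmod_def)
    have "(p \<ominus>\<^bsub>M\<lparr>carrier := P\<rparr>\<^esub> t) \<oplus>\<^bsub>M\<lparr>carrier := P\<rparr>\<^esub> t = p"
      by (rule P.M.minus_plus_cancel) (use p t in simp_all)
    then have "(p \<ominus>\<^bsub>M\<lparr>carrier := P\<rparr>\<^esub> t) \<oplus>\<^bsub>M\<^esub> t = p" by simp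
    then show "p \<in> T" using LinearCombinations.submodule.m_closed[OF T(1) n t(2)] by simp
  qed
  with P show ?thesis by (auto simp: gen_sub_def)
qed

end

section \<open>The slope lattice of a constellation\<close>

locale constellation_setting = stability_setting G X \<theta>
  for G :: "(complex^'n^'n) set" and X :: "('a, 'n) gscheme" and \<theta> :: "'n irrep set \<Rightarrow> rat" +
  fixes h :: "'n irrep set \<Rightarrow> nat" and F :: "('a, 'm, 'n) gmodule"
  assumes h_nonzero: "\<exists>\<rho>\<in>Irr G. h \<rho> \<noteq> 0"
    and stability: "stability_function G h \<theta>"
    and constellation: "constellation G X h \<theta> F"
begin

lemma OXG: "OXG_module G X F" and gen: "generated F"
  and hilbert: "\<rho> \<in> Irr G \<Longrightarrow> mult_dim G (sec F) \<rho> = h \<rho>"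
  using constellation by (auto simp: constellation_def)

lemmas OXG' = OXG_moduleD[OF OXG]

definition m :: "'m set \<Rightarrow> 'n irrep set \<Rightarrow> nat" where
  "m N \<rho> = mult_dim G (sec F\<lparr>carrier := N\<rparr>) \<rho>"

definition deg :: "'m set \<Rightarrow> real" where
  "deg N = - theta G X \<theta> (F\<lparr>carrier := N\<rparr>)"

definition rk :: "'m set \<Rightarrow> nat" where
  "rk N = neg_rank G X \<theta> (F\<lparr>carrier := N\<rparr>)"

lemma deg_eq: "deg N = - (\<Sum>\<^sub>\<infinity>\<rho>\<in>Irr G. real_of_rat (\<theta> \<rho>) * real (m N \<rho>))"
  by (simp add: deg_def theta_def m_def)

lemma rk_eq: "rk N = (\<Sum>\<rho>\<in>D. m N \<rho>)"
  by (simp add: rk_def neg_rank_def m_def)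

lemma gsub_F_sec: "gsub G X N F \<Longrightarrow> gsub G complex_field N (sec F)"
  by (rule gsub_sec[OF _ OXG'(3)])

lemma m_mono:
  assumes N: "gsub G X N F" and N': "gsub G X N' F" and le: "N \<subseteq> N'" and \<rho>: "\<rho> \<in> Irr G"
  shows "m N \<rho> \<le> m N' \<rho>"
    and "m N \<rho> = m N' \<rho> \<Longrightarrow> gHom G (irrep_of \<rho>) (sec F\<lparr>carrier := N\<rparr>) = gHom G (irrep_of \<rho>) (sec F\<lparr>carrier := N'\<rparr>)"
proof -
  define V where "V = sec F\<lparr>carrier := N'\<rparr>"
  have V: "admissible G V" unfolding V_def by (rule admissible_gsub[OF group OXG'(2) gsub_F_sec[OF N']])
  have NV: "gsub G complex_field N V"
    unfolding V_def using gsub_restrict_iff[OF OXG'(3) gsub_F_sec[OF N']] gsub_F_sec[OF N] le by blast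
  have eq: "V\<lparr>carrier := N\<rparr> = sec F\<lparr>carrier := N\<rparr>" by (simp add: V_def)
  show "m N \<rho> \<le> m N' \<rho>" using mult_dim_gsub(1)[OF group V NV \<rho>] by (simp add: m_def eq) (simp add: V_def)
  assume "m N \<rho> = m N' \<rho>"
  then show "gHom G (irrep_of \<rho>) (sec F\<lparr>carrier := N\<rparr>) = gHom G (irrep_of \<rho>) (sec F\<lparr>carrier := N'\<rparr>)"
    using mult_dim_gsub(2)[OF group V NV \<rho>] unfolding eq unfolding V_def m_def by simp
qed

lemma m_carrier:
  assumes "\<rho> \<in> Irr G"
  shows "m (carrier F) \<rho> = h \<rho>"
proof -
  have "sec F\<lparr>carrier := carrier F\<rparr> = sec F" by (simp add: global_sections_def)
  then show ?thesis using hilbert[OF assms] by (simp only: m_def)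
qed

lemma m_le_h: "gsub G X N F \<Longrightarrow> \<rho> \<in> Irr G \<Longrightarrow> m N \<rho> \<le> h \<rho>"
  using m_mono(1)[OF _ gsub_carrier[OF OXG'(1)] gsubD(2)] m_carrier by metis

text \<open>Unordered summability of real families is absolute. The absolute series then dominates
  those of all submodules.\<close>

lemma abs_theta_summable: "(\<lambda>\<rho>. \<bar>real_of_rat (\<theta> \<rho>)\<bar> * real (h \<rho>)) summable_on Irr G"
proof -
  have "(\<lambda>\<rho>. real_of_rat (\<theta> \<rho>) * real (h \<rho>)) summable_on Irr G"
    using stability by (auto simp: stability_function_def summable_on_def)
  then have "(\<lambda>\<rho>. \<bar>real_of_rat (\<theta> \<rho>) * real (h \<rho>)\<bar>) summable_on Irr G"
    by (subst (asm) summable_on_iff_abs_summable_on_real) simp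
  then show ?thesis by (simp add: abs_mult)
qed

lemma theta_term_bound:
  "gsub G X N F \<Longrightarrow> \<rho> \<in> Irr G \<Longrightarrow> \<bar>real_of_rat (\<theta> \<rho>) * real (m N \<rho>)\<bar> \<le> \<bar>real_of_rat (\<theta> \<rho>)\<bar> * real (h \<rho>)"
  using m_le_h[of N \<rho>] by (simp add: abs_mult mult_left_mono)

lemma theta_summable:
  assumes "gsub G X N F"
  shows "(\<lambda>\<rho>. real_of_rat (\<theta> \<rho>) * real (m N \<rho>)) summable_on Irr G"
proof -
  have "(\<lambda>\<rho>. norm (real_of_rat (\<theta> \<rho>) * real (m N \<rho>))) summable_on Irr G"
    by (rule Infinite_Sum.abs_summable_on_comparison_test'[OF abs_theta_summable])
      (use theta_term_bound[OF assms] in simp)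
  then show ?thesis by (rule abs_summable_summable)
qed

text \<open>Instantiates the constant K of \<open>slope_lattice\<close>: multiplicities of
  submodules are at most h, so this bounds every degree.\<close>

definition deg_bound :: real where
  "deg_bound = (\<Sum>\<^sub>\<infinity>\<rho>\<in>Irr G. \<bar>real_of_rat (\<theta> \<rho>)\<bar> * real (h \<rho>))"

lemma deg_le_bound:
  assumes "gsub G X N F"
  shows "deg N \<le> deg_bound"
proof -
  have "deg N = (\<Sum>\<^sub>\<infinity>\<rho>\<in>Irr G. - (real_of_rat (\<theta> \<rho>) * real (m N \<rho>)))"
    by (simp add: deg_eq infsum_uminus)
  also have "\<dots> \<le> deg_bound"
    unfolding deg_bound_def
  proof (rule infsum_mono)
    show "(\<lambda>\<rho>. - (real_of_rat (\<theta> \<rho>) * real (m N \<rho>))) summable_on Irr G"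
      using theta_summable[OF assms] by (simp add: summable_on_uminus)
    show "- (real_of_rat (\<theta> \<rho>) * real (m N \<rho>)) \<le> \<bar>real_of_rat (\<theta> \<rho>)\<bar> * real (h \<rho>)" if "\<rho> \<in> Irr G" for \<rho>
      using theta_term_bound[OF assms that] by linarith
  qed (rule abs_theta_summable)
  finally show ?thesis .
qed

lemma m_modular:
  assumes "gsub G X A F" "gsub G X B F" "\<rho> \<in> Irr G"
  shows "m (msum F A B) \<rho> + m (A \<inter> B) \<rho> = m A \<rho> + m B \<rho>"
  using mult_dim_modular[OF group OXG'(2) gsub_F_sec[OF assms(1)] gsub_F_sec[OF assms(2)] assms(3)]
  by (simp add: m_def)

lemma deg_modular:
  assumes A: "gsub G X A F" and B: "gsub G X B F"
  shows "deg (msum F A B) + deg (A \<inter> B) = deg A + deg B"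
proof -
  let ?t = "\<lambda>N \<rho>. real_of_rat (\<theta> \<rho>) * real (m N \<rho>)"
  note S = theta_summable[OF gsub_msum[OF OXG'(1) A B]] theta_summable[OF gsub_inter[OF A B]]
    theta_summable[OF A] theta_summable[OF B]
  have "infsum (?t (msum F A B)) (Irr G) + infsum (?t (A \<inter> B)) (Irr G) =
      (\<Sum>\<^sub>\<infinity>\<rho>\<in>Irr G. ?t (msum F A B) \<rho> + ?t (A \<inter> B) \<rho>)"
    by (rule infsum_add[symmetric, OF S(1,2)])
  also have "\<dots> = (\<Sum>\<^sub>\<infinity>\<rho>\<in>Irr G. ?t A \<rho> + ?t B \<rho>)"
  proof (rule infsum_cong)
    fix \<rho> assume "\<rho> \<in> Irr G"
    then have "real (m (msum F A B) \<rho>) + real (m (A \<inter> B) \<rho>) = real (m A \<rho>) + real (m B \<rho>)"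
      using m_modular[OF A B] by (metis of_nat_add)
    then show "?t (msum F A B) \<rho> + ?t (A \<inter> B) \<rho> = ?t A \<rho> + ?t B \<rho>" by (metis distrib_left)
  qed
  also have "\<dots> = infsum (?t A) (Irr G) + infsum (?t B) (Irr G)" by (rule infsum_add[OF S(3,4)])
  finally show ?thesis by (simp add: deg_eq)
qed

lemma m_core: "gsub G X I F \<Longrightarrow> \<rho> \<in> D \<Longrightarrow> m (core F I) \<rho> = m I \<rho>"
  using core_properties(5)[OF OXG] by (simp add: m_def mult_dim_def mult_space_restrict)

lemma deg_core:
  assumes I: "gsub G X I F"
  shows "deg I \<le> deg (core F I)"
proof -
  note c = core_properties[OF OXG I]
  have "(\<Sum>\<^sub>\<infinity>\<rho>\<in>Irr G. real_of_rat (\<theta> \<rho>) * real (m (core F I) \<rho>)) \<le>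
      (\<Sum>\<^sub>\<infinity>\<rho>\<in>Irr G. real_of_rat (\<theta> \<rho>) * real (m I \<rho>))"
  proof (rule infsum_mono[OF theta_summable[OF gen_subD(1)[OF c(3)]] theta_summable[OF I]])
    fix \<rho> assume \<rho>: "\<rho> \<in> Irr G"
    show "real_of_rat (\<theta> \<rho>) * real (m (core F I) \<rho>) \<le> real_of_rat (\<theta> \<rho>) * real (m I \<rho>)"
    proof (cases "\<theta> \<rho> < 0")
      case True
      then show ?thesis using m_core[OF I] \<rho> by (simp add: D_minus_def)
    next
      case False
      then show ?thesis using m_mono(1)[OF gen_subD(1)[OF c(3)] I c(1) \<rho>]
        by (intro mult_left_mono) auto
    qed
  qed
  then show ?thesis by (simp add: deg_eq)
qed

lemma rk_strict:
  assumes A: "gen_sub F A" and B: "gen_sub F B" and less: "A \<subset> B"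
  shows "rk A < rk B"
proof -
  note gA = gen_subD(1)[OF A] and gB = gen_subD(1)[OF B]
  have le: "m A \<rho> \<le> m B \<rho>" if "\<rho> \<in> D" for \<rho> using m_mono(1)[OF gA gB] less that D_Irr by blast
  have "\<exists>\<rho>\<in>D. m A \<rho> < m B \<rho>"
  proof (rule ccontr)
    assume "\<not> ?thesis"
    then have "m A \<rho> = m B \<rho>" if "\<rho> \<in> D" for \<rho> using le[OF that] that by force
    then have "gHom G (irrep_of \<rho>) (sec F\<lparr>carrier := A\<rparr>) = gHom G (irrep_of \<rho>) (sec F\<lparr>carrier := B\<rparr>)"
      if "\<rho> \<in> D" for \<rho> using m_mono(2)[OF gA gB] less that D_Irr by blast
    then have "gens G D (sec F\<lparr>carrier := B\<rparr>) = gens G D (sec F\<lparr>carrier := A\<rparr>)" by (simp add: gens_def)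
    then have "gens G D (sec F\<lparr>carrier := B\<rparr>) \<subseteq> A" using gens_subset[of G D "sec F\<lparr>carrier := A\<rparr>"] by simp
    then have "B \<subseteq> A" using gen_subD(3)[OF B] gsubD(1)[OF gA] by blast
    with less show False by blast
  qed
  then show ?thesis unfolding rk_eq using le finite_D by (intro sum_strict_mono_ex1) auto
qed

sublocale slope_lattice "{N. gen_sub F N}" "carrier F" "msum F" "\<lambda>A B. core F (A \<inter> B)" deg rk deg_bound
proof (unfold_locales, unfold mem_Collect_eq)
  show "gen_sub F (carrier F)" by (rule gen_sub_carrier[OF OXG gen])
  show "A \<subseteq> carrier F" if "gen_sub F A" for A by (rule gen_subD(2)[OF that])
  show "deg A \<le> deg_bound" if "gen_sub F A" for A by (rule deg_le_bound[OF gen_subD(1)[OF that]])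
  fix A B assume A: "gen_sub F A" and B: "gen_sub F B"
  note gA = gen_subD(1)[OF A] and gB = gen_subD(1)[OF B]
  note gI = gsub_inter[OF gA gB]
  note c = core_properties[OF OXG gI]
  show "gen_sub F (msum F A B)" by (rule gen_sub_msum[OF OXG A B])
  show "A \<subseteq> msum F A B" "B \<subseteq> msum F A B" using msum_upper[OF OXG'(1) gA gB] by auto
  show "msum F A B \<subseteq> C" if "gen_sub F C" "A \<subseteq> C" "B \<subseteq> C" for C
    by (rule msum_least[OF gen_subD(1)[OF that(1)] that(2,3)])
  show "gen_sub F (core F (A \<inter> B))" by (rule c(3))
  show "core F (A \<inter> B) \<subseteq> A" "core F (A \<inter> B) \<subseteq> B" using c(1) by auto
  show "C \<subseteq> core F (A \<inter> B)" if "gen_sub F C" "C \<subseteq> A" "C \<subseteq> B" for C using c(4) that by blast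
  show "rk A < rk B" if "A \<subset> B" by (rule rk_strict[OF A B that])
  \<comment> \<open>Over D_- the core and the intersection have the same multiplicities, so the rank
    is exactly modular while the degree obeys only an inequality.\<close>
  have "rk (msum F A B) + rk (core F (A \<inter> B)) = (\<Sum>\<rho>\<in>D. m (msum F A B) \<rho> + m (A \<inter> B) \<rho>)"
    using m_core[OF gI] by (simp add: rk_eq sum.distrib)
  also have "\<dots> = (\<Sum>\<rho>\<in>D. m A \<rho> + m B \<rho>)"
    using m_modular[OF gA gB] D_Irr by (intro sum.cong refl) blast
  finally show "rk (msum F A B) + rk (core F (A \<inter> B)) = rk A + rk B" by (simp add: rk_eq sum.distrib)
  show "deg A + deg B \<le> deg (msum F A B) + deg (core F (A \<inter> B))"
    using deg_modular[OF gA gB] deg_core[OF gI] by linarith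
qed

text \<open>Stated for any image Q of P with kernel N, so that it covers P/N and also the images in
  P/N of submodules between N and P, which are restricted records rather than coset
  quotients.\<close>

lemma image_invariants:
  assumes N: "gsub G X N F" and P: "gsub G X P F" and NP: "N \<subseteq> P"
    and f: "f \<in> ghom G X (F\<lparr>carrier := P\<rparr>) Q" and surj: "f ` P = carrier Q"
    and zero: "f \<zero>\<^bsub>F\<^esub> = \<zero>\<^bsub>Q\<^esub>" and ker: "{x \<in> P. f x = \<zero>\<^bsub>Q\<^esub>} = N"
  shows "rk P = rk N + neg_rank G X \<theta> Q" and "slope G X \<theta> Q = sl N P"
proof -
  have adm: "admissible G (sec (F\<lparr>carrier := P\<rparr>))"
    using admissible_gsub[OF group OXG'(2) gsub_F_sec[OF P]] by simp
  have m: "m P \<rho> = m N \<rho> + mult_dim G (sec Q) \<rho>" if "\<rho> \<in> Irr G" for \<rho>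
    using admissible_image(2)[OF group adm ghom_sec[OF f] _ _ _ that, of N] surj zero ker
    by (simp add: m_def)
  have "(\<Sum>\<rho>\<in>D. m P \<rho>) = (\<Sum>\<rho>\<in>D. m N \<rho> + mult_dim G (sec Q) \<rho>)"
    using m D_Irr by (intro sum.cong refl) blast
  then show rk: "rk P = rk N + neg_rank G X \<theta> Q" by (simp add: rk_eq neg_rank_def sum.distrib)
  \<comment> \<open>The series of P and of N converge separately, so the difference may be summed
    termwise.\<close>
  have "theta G X \<theta> Q = (\<Sum>\<^sub>\<infinity>\<rho>\<in>Irr G. real_of_rat (\<theta> \<rho>) * real (m P \<rho>) + - (real_of_rat (\<theta> \<rho>) * real (m N \<rho>)))"
    unfolding theta_def using m by (intro infsum_cong) (simp add: algebra_simps)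
  also have "\<dots> = deg N - deg P"
    using theta_summable[OF N] by (subst infsum_add[OF theta_summable[OF P]])
      (simp_all add: deg_eq infsum_uminus summable_on_uminus)
  finally show "slope G X \<theta> Q = sl N P" using rk by (simp add: slope_def sl_def)
qed

text \<open>Submodules generated in D_- between N and P correspond to those of P/N by images and
  preimages. Images are generated by \<open>image_generated\<close>, preimages by
  \<open>extension_gen_sub\<close>, and slopes match by \<open>image_invariants\<close>.\<close>

lemma quotient_piece:
  assumes N: "gen_sub F N" and P: "gen_sub F P" and less: "N \<subset> P"
  defines "Q \<equiv> quotient_gmodule (F\<lparr>carrier := P\<rparr>) N"
  shows "slope G X \<theta> Q = sl N P" and "mu_semistable G X \<theta> Q \<longleftrightarrow> semistable N P"
proof -
  note gN = gen_subD(1)[OF N] and gP = gen_subD(1)[OF P]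
  note FP = gmod_restrict[OF OXG'(1) gP]
  have NP: "gsub G X N (F\<lparr>carrier := P\<rparr>)" using gsub_restrict_iff[OF OXG'(1) gP] gN less by blast
  define \<pi> where "\<pi> = (\<lambda>x. N +>\<^bsub>F\<lparr>carrier := P\<rparr>\<^esub> x)"
  note \<pi> = coset_map[OF FP NP, folded Q_def, folded \<pi>_def]
  have surj: "\<pi> ` P = carrier Q" and zero: "\<pi> \<zero>\<^bsub>F\<^esub> = \<zero>\<^bsub>Q\<^esub>" and ker: "{x \<in> P. \<pi> x = \<zero>\<^bsub>Q\<^esub>} = N"
    using \<pi>(2-4) by simp_all
  have sub_OXG: "OXG_module G X (F\<lparr>carrier := A\<rparr>)" "generated (F\<lparr>carrier := A\<rparr>)" if "gen_sub F A" for A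
    using gen_sub_iff[OF OXG, of A] that by (auto simp: OXG_submodule_def)
  have Q: "OXG_module G X Q" "generated Q"
    using image_generated[OF sub_OXG[OF P] \<pi>(1-3)] by auto
  note q = OXG_moduleD[OF Q(1)]
  have inN: "x \<in> N \<longleftrightarrow> \<pi> x = \<zero>\<^bsub>Q\<^esub>" if "x \<in> P" for x using ker that by blast
  show slope_Q: "slope G X \<theta> Q = sl N P"
    by (rule image_invariants(2)[OF gN gP _ \<pi>(1) surj zero ker]) (use less in blast)
  have rk_Q: "rk P = rk N + neg_rank G X \<theta> Q"
    by (rule image_invariants(1)[OF gN gP _ \<pi>(1) surj zero ker]) (use less in blast)
  have restr: "\<pi> \<in> ghom G X (F\<lparr>carrier := A\<rparr>) (Q\<lparr>carrier := \<pi> ` A\<rparr>)" if "A \<subseteq> P" for A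
    using ghomD[OF \<pi>(1)] subsetD[OF that] by (intro ghomI) simp_all
  have inv: "rk A = rk N + neg_rank G X \<theta> (Q\<lparr>carrier := \<pi> ` A\<rparr>)" "slope G X \<theta> (Q\<lparr>carrier := \<pi> ` A\<rparr>) = sl N A"
    if A: "gsub G X A F" "N \<subseteq> A" "A \<subseteq> P" for A
  proof -
    have "{x \<in> A. \<pi> x = \<zero>\<^bsub>Q\<lparr>carrier := \<pi> ` A\<rparr>\<^esub>} = N" using inN A(2,3) by auto
    note * = image_invariants[OF gN A(1,2) restr[OF A(3)] _ _ this]
    show "rk A = rk N + neg_rank G X \<theta> (Q\<lparr>carrier := \<pi> ` A\<rparr>)" by (rule *(1)) (use zero in simp_all)
    show "slope G X \<theta> (Q\<lparr>carrier := \<pi> ` A\<rparr>) = sl N A" by (rule *(2)) (use zero in simp_all)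
  qed
  show "mu_semistable G X \<theta> Q \<longleftrightarrow> semistable N P"
  proof
    assume ss: "mu_semistable G X \<theta> Q"
    show "semistable N P"
      unfolding semistable_def
    proof (intro ballI impI; elim conjE)
      fix A assume "A \<in> {N. gen_sub F N}" and NA: "N \<subset> A" and AP: "A \<subset> P"
      then have A: "gen_sub F A" by simp
      note gA = gen_subD(1)[OF A]
      define K where "K = \<pi> ` A"
      have sub: "N \<subseteq> A" "A \<subseteq> P" using NA AP by auto
      have K: "OXG_module G X (Q\<lparr>carrier := K\<rparr>)" "generated (Q\<lparr>carrier := K\<rparr>)"
        using image_generated[OF sub_OXG[OF A] restr[OF sub(2)]] zero by (auto simp: K_def)
      have KQ: "K \<subseteq> carrier Q" using sub(2) surj by (auto simp: K_def)
      \<comment> \<open>If the image were everything, A and P would have equal rank, against strict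
        monotonicity.\<close>
      have "K \<noteq> carrier Q"
      proof
        assume "K = carrier Q"
        then have "Q\<lparr>carrier := \<pi> ` A\<rparr> = Q" by (simp add: K_def)
        then have "rk A = rk P" using inv(1)[OF gA sub] rk_Q by simp
        then show False using rk_strict[OF A P AP] by simp
      qed
      moreover have "{\<zero>\<^bsub>Q\<^esub>} \<noteq> K"
      proof
        assume "{\<zero>\<^bsub>Q\<^esub>} = K"
        then have "\<pi> x = \<zero>\<^bsub>Q\<^esub>" if "x \<in> A" for x using that unfolding K_def by blast
        then have "A \<subseteq> N" using inN sub(2) by blast
        with NA show False by blast
      qed
      ultimately have "slope G X \<theta> (Q\<lparr>carrier := K\<rparr>) \<le> slope G X \<theta> Q"
        using ss K KQ unfolding mu_semistable_def OXG_submodule_def by blast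
      then show "sl N A \<le> sl N P" using inv(2)[OF gA sub] slope_Q by (simp add: K_def)
    qed
  next
    assume ss: "semistable N P"
    have "slope G X \<theta> (Q\<lparr>carrier := K\<rparr>) \<le> slope G X \<theta> Q"
      if K: "OXG_submodule G X K Q" "generated (Q\<lparr>carrier := K\<rparr>)" "{\<zero>\<^bsub>Q\<^esub>} \<noteq> K" "K \<subset> carrier Q" for K
    proof -
      have "gen_sub Q K" using gen_sub_iff[OF Q(1)] K(1,2) by blast
      then have gK: "gsub G X K Q" by (rule gen_subD(1))
      define A where "A = {x \<in> P. \<pi> x \<in> K}"
      have "gsub G X A (F\<lparr>carrier := P\<rparr>)" using gsub_vimage[OF FP q(1) \<pi>(1) gK] by (simp add: A_def)
      then have gA: "gsub G X A F" and AP: "A \<subseteq> P" using gsub_restrict_iff[OF OXG'(1) gP] by auto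
      have NA: "N \<subseteq> A" using inN gsubD(3)[OF gK] less by (auto simp: A_def)
      have im: "\<pi> ` A = K" using K(4) unfolding surj[symmetric] A_def by blast
      have ker_A: "{x \<in> A. \<pi> x = \<zero>\<^bsub>Q\<lparr>carrier := K\<rparr>\<^esub>} = N" using inN NA AP by auto
      have "gen_sub F A"
        by (rule extension_gen_sub[OF OXG N gA NA restr[OF AP, unfolded im] _ ker_A _ K(2)])
          (use K(1) im in \<open>auto simp: OXG_submodule_def\<close>)
      moreover have "N \<noteq> A"
      proof
        assume "N = A"
        then have "K \<subseteq> {\<zero>\<^bsub>Q\<^esub>}" using im inN AP by auto
        then show False using gsubD(3)[OF gK] K(3) by blast
      qed
      moreover have "A \<noteq> P" using im surj K(4) by blast
      ultimately have "sl N A \<le> sl N P" using ss NA AP unfolding semistable_def by blast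
      then show ?thesis using inv(2)[OF gA NA AP] slope_Q im by simp
    qed
    then show "mu_semistable G X \<theta> Q" unfolding mu_semistable_def using Q by blast
  qed
qed

text \<open>A non-zero value of h is a non-zero multiplicity of F, while all multiplicities of the
  zero submodule vanish.\<close>

lemma zero_less_carrier: "{\<zero>\<^bsub>F\<^esub>} \<subset> carrier F"
proof -
  obtain \<rho> where \<rho>: "\<rho> \<in> Irr G" "h \<rho> \<noteq> 0" using h_nonzero by blast
  have "m {\<zero>\<^bsub>F\<^esub>} \<rho> = 0" using mult_dim_zero[OF group OXG'(2) \<rho>(1)] by (simp add: m_def)
  then have "{\<zero>\<^bsub>F\<^esub>} \<noteq> carrier F" using m_carrier[OF \<rho>(1)] \<rho>(2) by auto
  then show ?thesis using gen_subD(2)[OF gen_sub_zero[OF OXG]] by blast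
qed

lemma filtration_iff:
  assumes L: "\<forall>i\<le>t+1. gen_sub F (Fs ! i)" and strict: "\<forall>i\<le>t. Fs ! i \<subset> Fs ! (i + 1)" and i: "i \<le> t"
  shows "mu_semistable G X \<theta> (graded_piece F Fs i) \<longleftrightarrow> semistable (Fs ! i) (Fs ! (i + 1))"
    and "slope G X \<theta> (graded_piece F Fs i) = sl (Fs ! i) (Fs ! (i + 1))"
proof -
  have "gen_sub F (Fs ! i)" "gen_sub F (Fs ! (i + 1))" "Fs ! i \<subset> Fs ! (i + 1)" using L strict i by auto
  from quotient_piece[OF this]
  show "mu_semistable G X \<theta> (graded_piece F Fs i) \<longleftrightarrow> semistable (Fs ! i) (Fs ! (i + 1))"
    and "slope G X \<theta> (graded_piece F Fs i) = sl (Fs ! i) (Fs ! (i + 1))"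
    by (simp_all add: graded_piece_def)
qed

lemma hn_filtration:
  "\<exists>!Fs :: 'm set list. \<exists>t. length Fs = t + 2 \<and>
     Fs ! 0 = {\<zero>\<^bsub>F\<^esub>} \<and> Fs ! (t + 1) = carrier F \<and>
     (\<forall>i\<le>t. Fs ! i \<subset> Fs ! (i + 1)) \<and>
     (\<forall>i\<le>t+1. OXG_submodule G X (Fs ! i) F \<and> generated (F\<lparr>carrier := Fs ! i\<rparr>)) \<and>
     (\<forall>i\<le>t. mu_semistable G X \<theta> (graded_piece F Fs i)) \<and>
     (\<forall>i<t. slope G X \<theta> (graded_piece F Fs i) > slope G X \<theta> (graded_piece F Fs (i + 1)))"
proof -
  have eq: "(length Fs = t + 2 \<and> Fs ! 0 = {\<zero>\<^bsub>F\<^esub>} \<and> Fs ! (t + 1) = carrier F \<and>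
      (\<forall>i\<le>t. Fs ! i \<subset> Fs ! (i + 1)) \<and> (\<forall>i\<le>t+1. gen_sub F (Fs ! i)) \<and>
      (\<forall>i\<le>t. mu_semistable G X \<theta> (graded_piece F Fs i)) \<and>
      (\<forall>i<t. slope G X \<theta> (graded_piece F Fs i) > slope G X \<theta> (graded_piece F Fs (i + 1)))) \<longleftrightarrow>
    (length Fs = t + 2 \<and> Fs ! 0 = {\<zero>\<^bsub>F\<^esub>} \<and> Fs ! (t + 1) = carrier F \<and>
      (\<forall>i\<le>t. Fs ! i \<subset> Fs ! (i + 1)) \<and> (\<forall>i\<le>t+1. Fs ! i \<in> {N. gen_sub F N}) \<and>
      (\<forall>i\<le>t. semistable (Fs ! i) (Fs ! (i + 1))) \<and>
      (\<forall>i<t. sl (Fs ! i) (Fs ! (i + 1)) > sl (Fs ! (i + 1)) (Fs ! (i + 2))))" for Fs t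
  \<comment> \<open>The translation by \<open>filtration_iff\<close> is valid for strict chains of
    generated submodules; for all other lists both sides are false.\<close>
  proof (cases "(\<forall>i\<le>t+1. gen_sub F (Fs ! i)) \<and> (\<forall>i\<le>t. Fs ! i \<subset> Fs ! (i + 1))")
    case True
    note * = filtration_iff[of t Fs, OF conjunct1[OF True] conjunct2[OF True]]
    have "slope G X \<theta> (graded_piece F Fs i) > slope G X \<theta> (graded_piece F Fs (i + 1)) \<longleftrightarrow>
        sl (Fs ! i) (Fs ! (i + 1)) > sl (Fs ! (i + 1)) (Fs ! (i + 2))" if "i < t" for i
      using *(2)[of i] *(2)[of "i + 1"] that by simp
    with * True show ?thesis by (auto simp del: add_2_eq_Suc' Suc_eq_plus1)
  qed auto
  show ?thesis
    unfolding gen_sub_iff[OF OXG] eq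
    by (rule hn_filtration_unique_exists)
      (use gen_sub_zero[OF OXG] zero_less_carrier in auto)
qed

end

theorem theorem1p1:
  fixes G :: "(complex^'n^'n) set"
    and X :: "('a, 'n) gscheme"
    and h :: "'n irrep set \<Rightarrow> nat"
    and \<theta> :: "'n irrep set \<Rightarrow> rat"
    and F :: "('a, 'm, 'n) gmodule"
  assumes "reductive_group G" and "infinite G"
    and "affine_gscheme G X"
    and "\<exists>\<rho>\<in>Irr G. h \<rho> \<noteq> 0"
    and "stability_function G h \<theta>"
    and "constellation G X h \<theta> F"
  shows "\<exists>!Fs :: 'm set list. \<exists>t. length Fs = t + 2 \<and>
           Fs ! 0 = {\<zero>\<^bsub>F\<^esub>} \<and> Fs ! (t + 1) = carrier F \<and>
           (\<forall>i\<le>t. Fs ! i \<subset> Fs ! (i + 1)) \<and>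
           (\<forall>i\<le>t+1. OXG_submodule G X (Fs ! i) F \<and>
                     generated_in_D_minus G X \<theta> (F\<lparr>carrier := Fs ! i\<rparr>)) \<and>
           (\<forall>i\<le>t. mu_semistable G X \<theta> (graded_piece F Fs i)) \<and>
           (\<forall>i<t. slope G X \<theta> (graded_piece F Fs i) > slope G X \<theta> (graded_piece F Fs (i + 1)))"
proof -
  interpret constellation_setting G X \<theta> h F
    using assms by unfold_locales (auto simp: reductive_group_def stability_function_def)
  show ?thesis by (rule hn_filtration)
qed

end
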